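(* Let $X=(X_t)_{t\ge 0}$ be a one-dimensional time-homogeneous diffusion process starting from zero which is a (weak) solution of $dX_t=b(X_t)\,dt+\sigma(X_t)\,dB_t$, $X_0=0$, where $b:\mathbb{R}\to\mathbb{R}$ is Borel measurable, $\sigma:\mathbb{R}\to[0,\infty)$ is locally bounded, and $B$ is a standard Brownian motion on a filtered probability space $(\Omega,\mathcal{F},\{\mathcal{F}_t\},\mathbb{P})$ satisfying the usual conditions. Let $X^*_t=\sup_{0\le s\le t}|X_s|$ and let $\mathcal{L}=b(x)\frac{d}{dx}+\frac12\sigma^2(x)\frac{d^2}{dx^2}$ be the generator of $X$. Let $g:\mathbb{R}_+\to\mathbb{R}_+$ be a strictly increasing continuous function with $g(0)=0$. Suppose that: (i) $X$ is controllable; (ii) there exist constants $q>0$ and $K>0$ such that $\mathbb{E}(X^*_t)^q\le K\,(g(t))^q$ for every (deterministic) $t\ge 0$; (iii) there exist a $C^2$ function $f:\mathbb{R}\to\mathbb{R}$ with $\mathcal{L}f=1$ on $\mathbb{R}$ and $f(0)=0$, and a constant $\beta>1$, such that $$\lim_{\delta\downarrow 0}\ \sup_{\lambda>0,\ |x|<\delta\lambda,\ |y|<\delta\lambda}\ \frac{f(y)-f(x)}{g^{-1}(\beta\lambda)-g^{-1}(\lambda)}=0.$$ Then for every moderate function $F$ there exist two constants $c_F,C_F>0$ such that for every stopping time $\tau$ with respect to $\{\mathcal{F}_t\}$, $$c_F\,\mathbb{E}F(g(\tau))\le\mathbb{E}F(X^*_\tau)\le C_F\,\mathbb{E}F(g(\tau)).$$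 In particular, for every $p>0$ there exist two constants $c_p,C_p>0$ such that for every stopping time $\tau$ with respect to $\{\mathcal{F}_t\}$, $$c_p\,\mathbb{E}(g(\tau))^p\le\mathbb{E}(X^*_\tau)^p\le C_p\,\mathbb{E}(g(\tau))^p.$$
   Context: $\mathbb{R}_+=[0,\infty)$. A function $F:\mathbb{R}_+\to\mathbb{R}_+$ is called moderate if (a) it is continuous, increasing (in the weak sense) and $F(0)=0$, and (b) there exists $\beta>1$ such that $\sup_{x>0}F(\beta x)/F(x)<\infty$, with the conventions $0/0=1$ and $x/0=\infty$ for $x>0$. $X$ is a time-homogeneous diffusion, so it has continuous paths and is a time-homogeneous strong Markov process with respect to $\{\mathcal{F}_t\}$; $\mathbb{P}_x(\cdot)=\mathbb{P}(\cdot\mid X_0=x)$ denotes the law of the diffusion (same coefficients $b,\sigma$) started from $x$, and $\mathbb{E}$ is expectation for the process started from $0$. $X$ is called controllable if there exist constants $\gamma,C>0$ and $\beta>1$ such that for all $t\ge 0$ and $\lambda>0$, $$\sup_{|x|=\lambda}\mathbb{P}_x(X^*_t\ge\beta\lambda)\le C\,\mathbb{P}_0(X^*_t\ge\gamma\lambda).$$ Hypothesis (iii) presupposes that $g^{-1}$ is defined on all of $\mathbb{R}_+$, i.e. that $g$ maps $\mathbb{R}_+$ onto $\mathbb{R}_+$. *)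

theory Defs
  imports "HOL-Probability.Probability"
begin

section \<open>Moderate functions and values at infinity\<close>

text \<open>The quotient with the conventions 0/0 = 1 and x/0 = \<open>\<infinity>\<close> for x > 0.\<close>

definition ext_quotient :: "real \<Rightarrow> real \<Rightarrow> ennreal" where
  "ext_quotient a b = (if b = 0 then (if a = 0 then 1 else \<infinity>) else ennreal (a / b))"

definition moderate :: "(real \<Rightarrow> real) \<Rightarrow> bool" where
  "moderate \<Phi> \<longleftrightarrow>
     (\<forall>x\<ge>0. 0 \<le> \<Phi> x) \<and> continuous_on {0..} \<Phi> \<and> mono_on {0..} \<Phi> \<and> \<Phi> 0 = 0 \<and>
     (\<exists>\<beta>>1. (SUP x\<in>{0<..}. ext_quotient (\<Phi> (\<beta> * x)) (\<Phi> x)) < \<infinity>)"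

text \<open>Stopping times and running maxima may be infinite.  An increasing function on the half-line
  \<open>[0,\<infinity>)\<close> is evaluated at \<open>\<infinity>\<close> by its limit, i.e. its supremum.\<close>

definition at_ext :: "(real \<Rightarrow> real) \<Rightarrow> ennreal \<Rightarrow> ennreal" where
  "at_ext \<Phi> z = (if z = \<infinity> then (SUP y\<in>{0..}. ennreal (\<Phi> y)) else ennreal (\<Phi> (enn2real z)))"

section \<open>Paths\<close>

text \<open>Continuous paths on \<open>[0,\<infinity>)\<close>, extended by \<^const>\<open>undefined\<close> to negative times, with the
  sigma-algebra generated by the evaluations.\<close>

definition path_space :: "(real \<Rightarrow> real) measure" where
  "path_space = restrict_space (\<Pi>\<^sub>M t\<in>{0..}. borel) {w. continuous_on {0..} w}"

definition path_from :: "(real \<Rightarrow> 'a \<Rightarrow> real) \<Rightarrow> real \<Rightarrow> 'a \<Rightarrow> real \<Rightarrow> real" where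
  "path_from X s \<omega> = (\<lambda>t\<in>{0..}. X (s + t) \<omega>)"

text \<open>The running maximum of the absolute value, at a possibly infinite time.\<close>

definition run_max :: "(real \<Rightarrow> real) \<Rightarrow> ennreal \<Rightarrow> ennreal" where
  "run_max w t = (SUP s\<in>{s. 0 \<le> s \<and> ennreal s \<le> t}. ennreal \<bar>w s\<bar>)"

section \<open>Filtered probability spaces and Brownian motion\<close>

text \<open>Time ranges over \<^typ>\<open>ennreal\<close> so that the library's \<^const>\<open>stopping_time\<close> covers stopping
  times with values in \<open>[0,\<infinity>]\<close>.  The last sigma-algebra \<open>\<F> \<infinity>\<close> may be any one
  that contains all \<open>\<F> t\<close> and is contained in that of \<open>M\<close>.\<close>

definition usual_conditions :: "'a measure \<Rightarrow> (ennreal \<Rightarrow> 'a measure) \<Rightarrow> bool" where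
  "usual_conditions M \<F> \<longleftrightarrow>
     prob_space M \<and> complete_measure M \<and>
     filtration (space M) \<F> \<and> (\<forall>t. sets (\<F> t) \<subseteq> sets M) \<and>
     null_sets M \<subseteq> sets (\<F> 0) \<and>
     (\<forall>t<\<infinity>. sets (\<F> t) = (\<Inter>s\<in>{t<..}. sets (\<F> s)))"

definition continuous_adapted ::
  "'a measure \<Rightarrow> (ennreal \<Rightarrow> 'a measure) \<Rightarrow> (real \<Rightarrow> 'a \<Rightarrow> real) \<Rightarrow> bool" where
  "continuous_adapted M \<F> X \<longleftrightarrow>
     (\<forall>t\<ge>0. X t \<in> borel_measurable (\<F> (ennreal t))) \<and>
     (\<forall>\<omega>\<in>space M. continuous_on {0..} (\<lambda>t. X t \<omega>))"

definition progressive :: "(ennreal \<Rightarrow> 'a measure) \<Rightarrow> (real \<Rightarrow> 'a \<Rightarrow> real) \<Rightarrow> bool" where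
  "progressive \<F> H \<longleftrightarrow>
     (\<forall>t\<ge>0. (\<lambda>(s, \<omega>). H s \<omega>) \<in>
        borel_measurable (restrict_space borel {0..t} \<Otimes>\<^sub>M \<F> (ennreal t)))"

definition brownian_motion ::
  "'a measure \<Rightarrow> (ennreal \<Rightarrow> 'a measure) \<Rightarrow> (real \<Rightarrow> 'a \<Rightarrow> real) \<Rightarrow> bool" where
  "brownian_motion M \<F> B \<longleftrightarrow>
     continuous_adapted M \<F> B \<and> (AE \<omega> in M. B 0 \<omega> = 0) \<and>
     (\<forall>s t. 0 \<le> s \<longrightarrow> s < t \<longrightarrow>
        distributed M lborel (\<lambda>\<omega>. B t \<omega> - B s \<omega>) (\<lambda>x. ennreal (normal_density 0 (sqrt (t - s)) x)) \<and>
        prob_space.indep_set M (sets (\<F> (ennreal s)))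
          {(\<lambda>\<omega>. B t \<omega> - B s \<omega>) -` A \<inter> space M | A. A \<in> sets borel})"

section \<open>The stochastic integral\<close>

text \<open>A simple process is \<open>\<xi> i \<omega>\<close> on the interval \<open>(T i, T (i + 1)]\<close>, for \<open>i < m\<close>, and
  vanishes elsewhere.\<close>

definition simple_data ::
  "'a measure \<Rightarrow> (ennreal \<Rightarrow> 'a measure) \<Rightarrow> nat \<Rightarrow> (nat \<Rightarrow> real) \<Rightarrow> (nat \<Rightarrow> 'a \<Rightarrow> real) \<Rightarrow> bool" where
  "simple_data M \<F> m T \<xi> \<longleftrightarrow>
     0 \<le> T 0 \<and> (\<forall>i<m. T i \<le> T (Suc i)) \<and>
     (\<forall>i<m. \<xi> i \<in> borel_measurable (\<F> (ennreal (T i))) \<and> (\<exists>c. \<forall>\<omega>\<in>space M. \<bar>\<xi> i \<omega>\<bar> \<le> c))"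

definition simple_process ::
  "nat \<Rightarrow> (nat \<Rightarrow> real) \<Rightarrow> (nat \<Rightarrow> 'a \<Rightarrow> real) \<Rightarrow> real \<Rightarrow> 'a \<Rightarrow> real" where
  "simple_process m T \<xi> s \<omega> = (\<Sum>i<m. \<xi> i \<omega> * indicator {T i<..T (Suc i)} s)"

definition simple_integral ::
  "nat \<Rightarrow> (nat \<Rightarrow> real) \<Rightarrow> (nat \<Rightarrow> 'a \<Rightarrow> real) \<Rightarrow> (real \<Rightarrow> 'a \<Rightarrow> real) \<Rightarrow> real \<Rightarrow> 'a \<Rightarrow> real" where
  "simple_integral m T \<xi> B t \<omega> =
     (\<Sum>i<m. \<xi> i \<omega> * (B (min t (T (Suc i))) \<omega> - B (min t (T i)) \<omega>))"

definition null_in_prob :: "'a measure \<Rightarrow> (nat \<Rightarrow> 'a \<Rightarrow> ennreal) \<Rightarrow> bool" where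
  "null_in_prob M Y \<longleftrightarrow>
     (\<forall>\<epsilon>>0. (\<lambda>n. measure M {\<omega>\<in>space M. ennreal \<epsilon> \<le> Y n \<omega>}) \<longlonglongrightarrow> 0)"

text \<open>\<open>I\<close> is (a version of) the Ito integral of the progressive, locally square integrable
  process \<open>H\<close>: the limit, uniformly on compact time intervals in probability, of the integrals of
  simple processes that approximate \<open>H\<close> in \<open>L\<^sup>2([0,t])\<close> in probability for every \<open>t\<close>.
  Such a sequence always exists for Brownian \<open>B\<close>, and \<open>I\<close> does not depend on it up to
  indistinguishability.\<close>

definition ito_integral ::
  "'a measure \<Rightarrow> (ennreal \<Rightarrow> 'a measure) \<Rightarrow> (real \<Rightarrow> 'a \<Rightarrow> real) \<Rightarrow>
   (real \<Rightarrow> 'a \<Rightarrow> real) \<Rightarrow> (real \<Rightarrow> 'a \<Rightarrow> real) \<Rightarrow> bool" where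
  "ito_integral M \<F> B H I \<longleftrightarrow>
     progressive \<F> H \<and>
     (\<forall>t\<ge>0. AE \<omega> in M. (\<integral>\<^sup>+ s\<in>{0..t}. ennreal ((H s \<omega>)\<^sup>2) \<partial>lborel) < \<infinity>) \<and>
     continuous_adapted M \<F> I \<and>
     (\<exists>m T \<xi>. (\<forall>n. simple_data M \<F> (m n) (T n) (\<xi> n)) \<and>
        (\<forall>t\<ge>0.
           null_in_prob M (\<lambda>n \<omega>. \<integral>\<^sup>+ s\<in>{0..t}.
             ennreal ((simple_process (m n) (T n) (\<xi> n) s \<omega> - H s \<omega>)\<^sup>2) \<partial>lborel) \<and>
           null_in_prob M (\<lambda>n \<omega>.
             run_max (\<lambda>s. simple_integral (m n) (T n) (\<xi> n) B s \<omega> - I s \<omega>) (ennreal t))))"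

section \<open>Diffusions\<close>

text \<open>The integrals of \<open>b(X)\<close> and \<open>\<sigma>(X)\<close> are required to exist; progressive measurability of
  \<open>\<sigma>(X)\<close> is part of \<^const>\<open>ito_integral\<close>, so \<open>\<sigma>\<close> itself need not be assumed
  measurable.\<close>

definition weak_solution ::
  "(real \<Rightarrow> real) \<Rightarrow> (real \<Rightarrow> real) \<Rightarrow> real \<Rightarrow> 'a measure \<Rightarrow> (ennreal \<Rightarrow> 'a measure) \<Rightarrow>
   (real \<Rightarrow> 'a \<Rightarrow> real) \<Rightarrow> (real \<Rightarrow> 'a \<Rightarrow> real) \<Rightarrow> bool" where
  "weak_solution b \<sigma> x M \<F> B X \<longleftrightarrow>
     usual_conditions M \<F> \<and> brownian_motion M \<F> B \<and> continuous_adapted M \<F> X \<and>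
     (AE \<omega> in M. X 0 \<omega> = x) \<and>
     (\<forall>t\<ge>0. AE \<omega> in M. set_integrable lborel {0..t} (\<lambda>s. b (X s \<omega>))) \<and>
     (\<exists>I. ito_integral M \<F> B (\<lambda>s \<omega>. \<sigma> (X s \<omega>)) I \<and>
        (\<forall>t\<ge>0. AE \<omega> in M. X t \<omega> = x + (LBINT s:{0..t}. b (X s \<omega>)) + I t \<omega>))"

text \<open>Strong Markov property with transition laws \<open>P x\<close>: on \<open>{\<tau> < \<infinity>}\<close>, the conditional law of the
  path after \<open>\<tau>\<close> given \<open>\<F>\<^sub>\<tau>\<close> is \<open>P\<close> at \<open>X\<^sub>\<tau>\<close>.  With \<open>\<tau> = 0\<close> this contains that
  a process started at \<open>x\<close> has law \<open>P x\<close>.\<close>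

definition strong_markov ::
  "(real \<Rightarrow> (real \<Rightarrow> real) measure) \<Rightarrow> 'a measure \<Rightarrow> (ennreal \<Rightarrow> 'a measure) \<Rightarrow>
   (real \<Rightarrow> 'a \<Rightarrow> real) \<Rightarrow> bool" where
  "strong_markov P M \<F> X \<longleftrightarrow>
     (\<forall>\<tau>. stopping_time \<F> \<tau> \<longrightarrow> (\<forall>\<Gamma>\<in>sets path_space. AE \<omega> in M. \<tau> \<omega> < \<infinity> \<longrightarrow>
        real_cond_exp M (filtration.pre_sigma (space M) \<F> \<tau>)
          (indicator {\<omega>. \<tau> \<omega> < \<infinity> \<and> path_from X (enn2real (\<tau> \<omega>)) \<omega> \<in> \<Gamma>}) \<omega>
        = measure (P (X (enn2real (\<tau> \<omega>)) \<omega>)) \<Gamma>))"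

definition diffusion ::
  "(real \<Rightarrow> real) \<Rightarrow> (real \<Rightarrow> real) \<Rightarrow> (real \<Rightarrow> (real \<Rightarrow> real) measure) \<Rightarrow> real \<Rightarrow>
   'a measure \<Rightarrow> (ennreal \<Rightarrow> 'a measure) \<Rightarrow> (real \<Rightarrow> 'a \<Rightarrow> real) \<Rightarrow> (real \<Rightarrow> 'a \<Rightarrow> real) \<Rightarrow> bool" where
  "diffusion b \<sigma> P x M \<F> B X \<longleftrightarrow> weak_solution b \<sigma> x M \<F> B X \<and> strong_markov P M \<F> X"

definition controllable :: "(real \<Rightarrow> (real \<Rightarrow> real) measure) \<Rightarrow> bool" where
  "controllable P \<longleftrightarrow>
     (\<exists>\<gamma>>0. \<exists>C>0. \<exists>\<beta>>1. \<forall>t\<ge>0. \<forall>l>0.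
        (SUP x\<in>{x. \<bar>x\<bar> = l}.
           measure (P x) {w\<in>space path_space. run_max w (ennreal t) \<ge> ennreal (\<beta> * l)})
        \<le> C * measure (P 0) {w\<in>space path_space. run_max w (ennreal t) \<ge> ennreal (\<gamma> * l)})"

section \<open>The generator\<close>

definition C2 :: "(real \<Rightarrow> real) \<Rightarrow> bool" where
  "C2 f \<longleftrightarrow> (\<forall>x. f differentiable (at x)) \<and> (\<forall>x. deriv f differentiable (at x)) \<and>
     continuous_on UNIV (deriv (deriv f))"

definition generator :: "(real \<Rightarrow> real) \<Rightarrow> (real \<Rightarrow> real) \<Rightarrow> (real \<Rightarrow> real) \<Rightarrow> real \<Rightarrow> real" where
  "generator b \<sigma> f x = b x * deriv f x + 1 / 2 * (\<sigma> x)\<^sup>2 * deriv (deriv f) x"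

end

theory Submission
  imports Defs
begin

text \<open>Write \<open>X*\<close> for the running maximum of \<open>|X|\<close>.  Both inequalities are instances of one
principle (\<open>good_lambda\<close>): if for every \<open>\<epsilon>\<close> there is a \<open>\<delta>\<close> such that
\<open>P(U \<ge> \<beta>l, Z < \<delta>l) \<le> \<epsilon> P(U \<ge> l)\<close> for all \<open>l > 0\<close>, then \<open>E \<Phi>(U)\<close> is
at most a constant times \<open>E \<Phi>(Z)\<close> for every moderate \<open>\<Phi>\<close>.  The constant depends only
on \<open>\<Phi>\<close>, \<open>\<beta>\<close> and the choice of \<open>\<delta>\<close>, hence is the same for all stopping times.

With \<open>U = X*\<close> at \<open>\<tau>\<close> and \<open>Z = g(\<tau>)\<close>, the event requires that \<open>X\<close>, once it has reached the
level \<open>l\<close> in absolute value, reaches \<open>\<beta>l\<close> within the time \<open>T\<close> with \<open>g(T) = \<delta>l\<close>.  The strong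
Markov property at the hitting time of \<open>l\<close> and controllability bound its conditional probability by
\<open>C P(X* at T \<ge> \<gamma>l)\<close>, and by Markov's inequality and the moment hypothesis this is at most
\<open>C K (\<delta>/\<gamma>)\<^sup>q\<close> (\<open>controllable_maximum_good_lambda\<close>).

With \<open>U = g(\<tau>)\<close> and \<open>Z = X*\<close>, let \<open>s\<close> and \<open>t\<close> be the times at which \<open>g\<close> takes the values \<open>l\<close> and
\<open>\<beta>l\<close>.  On the event, \<open>\<tau> \<ge> t\<close> and \<open>|X|\<close> stays below \<open>\<delta>l\<close> on \<open>[s,t]\<close>.  Since the generator maps \<open>f\<close> to 1,
the process \<open>f(X)\<close> minus time is a local martingale up to the exit from a bounded interval, so the
expected time after \<open>s\<close> until \<open>X\<close> leaves that interval is at most the oscillation of \<open>f\<close> there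
(\<open>exit_inequality\<close>).  Hypothesis (iii) makes this oscillation small compared with \<open>t - s\<close>
(\<open>scale_good_lambda\<close>).

The exit inequality is a form of the Ito formula and is proved directly from the definition of the
integral.  The interval \<open>[s,t]\<close> is cut into small pieces, and on each piece the increment of the
Ito integral is replaced by an elementary integral whose integrand is clipped at a bound for
\<open>\<sigma>\<close> on the interval in question (\<open>ito_increment_approx\<close>).  Such an integral has explicit first and second
moments and a fourth moment of the order of the square of the mesh, so a second-order Taylor
expansion gives the drift of \<open>f(X)\<close> on the piece, with an error that is negligible after summation
(\<open>drift_increment_inequality\<close>).  The drift \<open>b(X)\<close> is only integrable along almost every path; the
process is therefore also stopped when the integral of \<open>|b(X)|\<close> exceeds a constant \<open>m\<close>, and
\<open>m\<close> tends to infinity at the end.  Stopping is done on the partition: the events \<open>G\<close> that nothing has happened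
up to a partition point decrease, and only the last increment of each path, the one during which \<open>G\<close> is left,
needs separate care.\<close>

section \<open>Moderate functions and the good-lambda inequality\<close>

lemma at_ext_real: "0 \<le> x \<Longrightarrow> at_ext \<Phi> (ennreal x) = ennreal (\<Phi> x)"
  by (simp add: at_ext_def)

lemma at_ext_mono:
  assumes "mono_on {0..} \<Phi>" "a \<le> b"
  shows "at_ext \<Phi> a \<le> at_ext \<Phi> b"
proof (cases b)
  case (real y)
  then obtain x where "a = ennreal x" "0 \<le> x" "x \<le> y"
    using assms(2) by (cases a) (auto simp: ennreal_le_iff top_unique)
  then show ?thesis using real assms(1) by (auto simp: at_ext_real intro!: ennreal_leI mono_onD[OF assms(1)])
next
  case top
  then show ?thesis
    by (cases a) (auto simp: at_ext_def intro!: SUP_upper)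
qed

text \<open>The point at infinity needs a separate argument: both sides are suprema there, and dilating the
argument permutes the points over which the supremum is taken.\<close>

lemma at_ext_scale:
  assumes r: "0 < r" and c: "0 \<le> c" and le: "\<And>x. 0 \<le> x \<Longrightarrow> \<Phi> (r * x) \<le> c * \<Phi> x"
  shows "at_ext \<Phi> (ennreal r * z) \<le> ennreal c * at_ext \<Phi> z"
proof (cases z)
  case (real x)
  then show ?thesis using r c le[of x]
    by (simp add: at_ext_real ennreal_mult[symmetric] ennreal_mult'[symmetric] ennreal_leI)
next
  case top
  have "at_ext \<Phi> \<top> \<le> ennreal c * at_ext \<Phi> \<top>"
    unfolding at_ext_def infinity_ennreal_def if_True simp_thms
  proof (rule SUP_least)
    fix y :: real assume "y \<in> {0..}"
    then have y: "0 \<le> y / r" using r by simp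
    have "ennreal (\<Phi> y) \<le> ennreal (c * \<Phi> (y / r))" using le[OF y] r by (intro ennreal_leI) simp
    also have "\<dots> = ennreal c * ennreal (\<Phi> (y / r))" by (rule ennreal_mult'[OF c])
    also have "\<dots> \<le> ennreal c * (SUP y\<in>{0..}. ennreal (\<Phi> y))"
      using y by (intro mult_left_mono SUP_upper) auto
    finally show "ennreal (\<Phi> y) \<le> ennreal c * (SUP y\<in>{0..}. ennreal (\<Phi> y))" .
  qed
  moreover have "ennreal r * \<top> = \<top>" using r by (simp add: ennreal_mult_eq_top_iff)
  ultimately show ?thesis using top by simp
qed

lemma at_ext_measurable:
  assumes "continuous_on {0..} \<Phi>"
  shows "at_ext \<Phi> \<in> borel_measurable borel"
proof -
  have c: "continuous_on UNIV (\<lambda>x. \<Phi> (max 0 x))"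
    by (rule continuous_on_compose2[OF assms]) (auto intro!: continuous_intros)
  have "(\<lambda>z. if z = \<infinity> then (SUP y\<in>{0..}. ennreal (\<Phi> y)) else ennreal (\<Phi> (max 0 (enn2real z)))) \<in> borel_measurable borel"
    using borel_measurable_continuous_onI[OF c] by measurable
  moreover have "at_ext \<Phi> = (\<lambda>z. if z = \<infinity> then (SUP y\<in>{0..}. ennreal (\<Phi> y)) else ennreal (\<Phi> (max 0 (enn2real z))))"
    by (simp add: at_ext_def fun_eq_iff)
  ultimately show ?thesis by simp
qed

text \<open>Truncation at a height makes all expectations finite, which the good-lambda argument needs in order to
absorb a term; this identity undoes the truncation by monotone convergence.\<close>

lemma at_ext_truncate:
  "at_ext \<Phi> z = (SUP k::nat. at_ext (\<lambda>x. min (\<Phi> x) (real k)) z)"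
proof -
  have *: "ennreal x = (SUP k::nat. ennreal (min x (real k)))" for x
  proof (rule antisym)
    obtain k :: nat where "x \<le> real k" using real_arch_simple by blast
    then show "ennreal x \<le> (SUP k::nat. ennreal (min x (real k)))"
      by (intro SUP_upper2[of k]) auto
  qed (auto intro!: SUP_least ennreal_leI)
  show ?thesis
  proof (cases "z = \<infinity>")
    case True
    have "(SUP y\<in>{0..}. ennreal (\<Phi> y)) = (SUP y\<in>{0..}. SUP k::nat. ennreal (min (\<Phi> y) (real k)))"
      by (subst *) simp
    also have "\<dots> = (SUP k::nat. SUP y\<in>{0..}. ennreal (min (\<Phi> y) (real k)))" by (rule SUP_commute)
    finally show ?thesis using True by (simp add: at_ext_def)
  next
    case False
    then show ?thesis unfolding at_ext_def by (simp add: *[of "\<Phi> (enn2real z)"])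
  qed
qed

text \<open>Two versions, because a monotone \<open>\<Psi>\<close> need not be strictly monotone: \<open>\<Psi> u > \<Psi> l\<close> implies
\<open>u \<ge> l\<close>, but \<open>u \<ge> l\<close> implies only \<open>\<Psi> u \<ge> \<Psi> l\<close>.\<close>

lemma nn_integral_layer_cake:
  fixes h :: "'a \<Rightarrow> ennreal"
  assumes "sigma_finite_measure M" and h[measurable]: "h \<in> borel_measurable M"
  shows "(\<integral>\<^sup>+ \<omega>. h \<omega> \<partial>M) = (\<integral>\<^sup>+ y\<in>{0<..}. emeasure M {\<omega>\<in>space M. ennreal y < h \<omega>} \<partial>lborel)" (is ?A)
    and "(\<integral>\<^sup>+ \<omega>. h \<omega> \<partial>M) = (\<integral>\<^sup>+ y\<in>{0<..}. emeasure M {\<omega>\<in>space M. ennreal y \<le> h \<omega>} \<partial>lborel)" (is ?B)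
proof -
  interpret M: sigma_finite_measure M by fact
  interpret pair_sigma_finite M lborel ..
  have gen: "(\<integral>\<^sup>+ \<omega>. h \<omega> \<partial>M) = (\<integral>\<^sup>+ y\<in>{0<..}. emeasure M {\<omega>\<in>space M. P y \<omega>} \<partial>lborel)"
    if P[measurable]: "Measurable.pred (M \<Otimes>\<^sub>M lborel) (\<lambda>p. P (snd p) (fst p))"
      and S: "\<And>\<omega>. \<omega> \<in> space M \<Longrightarrow> emeasure lborel {y. 0 < y \<and> P y \<omega>} = h \<omega>" for P :: "real \<Rightarrow> 'a \<Rightarrow> bool"
  proof -
    have sec: "{y. 0 < y \<and> P y \<omega>} \<in> sets lborel" if "\<omega> \<in> space M" for \<omega>
      proof -
      have "{y. P y \<omega>} \<in> sets borel" using measurable_Pair2[OF P, of \<omega>] that by (simp add: pred_def)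
      then have "{0<..} \<inter> {y. P y \<omega>} \<in> sets borel" by (intro sets.Int) auto
      moreover have "{0<..} \<inter> {y. P y \<omega>} = {y. 0 < y \<and> P y \<omega>}" by auto
      ultimately show ?thesis by simp
    qed
    have "(\<integral>\<^sup>+ \<omega>. h \<omega> \<partial>M) = (\<integral>\<^sup>+ \<omega>. (\<integral>\<^sup>+ y. indicator {y. 0 < y \<and> P y \<omega>} y \<partial>lborel) \<partial>M)"
      using S sec by (intro nn_integral_cong) (simp add: nn_integral_indicator)
    also have "\<dots> = (\<integral>\<^sup>+ \<omega>. (\<integral>\<^sup>+ y. of_bool (0 < y \<and> P y \<omega>) \<partial>lborel) \<partial>M)"
      by (intro nn_integral_cong) (auto simp: indicator_def)
    also have "\<dots> = (\<integral>\<^sup>+ y. (\<integral>\<^sup>+ \<omega>. of_bool (0 < y \<and> P y \<omega>) \<partial>M) \<partial>lborel)"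
    proof (rule Fubini'[symmetric])
      have "Measurable.pred (M \<Otimes>\<^sub>M lborel) (\<lambda>p. 0 < snd p \<and> P (snd p) (fst p))" by measurable
      then show "(\<lambda>(\<omega>, y). of_bool (0 < y \<and> P y \<omega>)) \<in> borel_measurable (M \<Otimes>\<^sub>M lborel)"
        unfolding case_prod_beta of_bool_def by measurable
    qed
    also have "\<dots> = (\<integral>\<^sup>+ y\<in>{0<..}. emeasure M {\<omega>\<in>space M. P y \<omega>} \<partial>lborel)"
    proof (rule nn_integral_cong)
      fix y :: real
      have m: "{\<omega>\<in>space M. P y \<omega>} \<in> sets M" using measurable_Pair1[OF P, of y] by (simp add: pred_def)
      have "(\<integral>\<^sup>+ \<omega>. of_bool (0 < y \<and> P y \<omega>) \<partial>M) = (\<integral>\<^sup>+ \<omega>. of_bool (0 < y) * indicator {\<omega>\<in>space M. P y \<omega>} \<omega> \<partial>M)"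
        by (intro nn_integral_cong) (auto simp: indicator_def)
      also have "\<dots> = of_bool (0 < y) * emeasure M {\<omega>\<in>space M. P y \<omega>}"
        by (subst nn_integral_cmult) (use m in auto)
      finally show "(\<integral>\<^sup>+ \<omega>. of_bool (0 < y \<and> P y \<omega>) \<partial>M) = emeasure M {\<omega>\<in>space M. P y \<omega>} * indicator {0<..} y"
        by (auto simp: indicator_def)
    qed
    finally show ?thesis .
  qed
  have inf: "emeasure lborel {y::real. 0 < y} = \<infinity>"
  proof -
    have "of_nat n \<le> emeasure lborel {y::real. 0 < y}" for n :: nat
    proof -
      have "emeasure lborel {0<..real n} \<le> emeasure lborel {y::real. 0 < y}" by (rule emeasure_mono) auto
      then show ?thesis by (simp add: ennreal_of_nat_eq_real_of_nat)
    qed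
    then show ?thesis by (metis ennreal_SUP_of_nat_eq_top SUP_least top_unique infinity_ennreal_def)
  qed
  show ?A
  proof (rule gen)
    show "emeasure lborel {y. 0 < y \<and> ennreal y < h \<omega>} = h \<omega>" for \<omega>
    proof (cases "h \<omega>")
      case (real r)
      then have "{y. 0 < y \<and> ennreal y < h \<omega>} = {0<..<r}" by (auto simp: ennreal_less_iff)
      then show ?thesis using real by simp
    qed (simp add: inf)
  qed measurable
  show ?B
  proof (rule gen)
    show "emeasure lborel {y. 0 < y \<and> ennreal y \<le> h \<omega>} = h \<omega>" for \<omega>
    proof (cases "h \<omega>")
      case (real r)
      then have "{y. 0 < y \<and> ennreal y \<le> h \<omega>} = {0<..r}" by (auto simp: ennreal_le_iff)
      then show ?thesis using real by simp
    qed (simp add: inf)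
  qed measurable
qed

text \<open>For a level \<open>y = \<Psi> l\<close>, the hypothesis at \<open>l\<close> compares the superlevel sets of \<open>\<Psi>(U/\<beta>)\<close>,
\<open>\<Psi>(U)\<close> and \<open>\<Psi>(Z/\<delta>)\<close>; integration over \<open>y\<close> gives
\<open>E \<Psi>(U/\<beta>) \<le> \<epsilon> E \<Psi>(U) + E \<Psi>(Z/\<delta>)\<close>.  Since \<open>\<Psi>(U) \<le> c \<Psi>(U/\<beta>)\<close> and \<open>c \<epsilon> \<le> 1/2\<close>, the term with
\<open>E \<Psi>(U)\<close>, which is finite as \<open>\<Psi>\<close> is bounded, can be absorbed on the left.\<close>

lemma good_lambda_bounded:
  fixes U Z :: "'a \<Rightarrow> ennreal" and \<Psi> :: "real \<Rightarrow> real"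
  assumes "prob_space M" and U[measurable]: "U \<in> borel_measurable M" and Z[measurable]: "Z \<in> borel_measurable M"
    and cont: "continuous_on {0..} \<Psi>" and mono: "mono_on {0..} \<Psi>" and \<Psi>0: "\<Psi> 0 = 0"
    and bd: "\<And>x. 0 \<le> x \<Longrightarrow> \<Psi> x \<le> k"
    and pos: "0 < \<beta>" "0 < \<delta>" "0 \<le> c" "0 \<le> c'" "0 \<le> \<epsilon>" and eps: "2 * (c * \<epsilon>) \<le> 1"
    and sc: "\<And>x. 0 \<le> x \<Longrightarrow> \<Psi> (\<beta> * x) \<le> c * \<Psi> x" and sc': "\<And>x. 0 \<le> x \<Longrightarrow> \<Psi> (1 / \<delta> * x) \<le> c' * \<Psi> x"
    and good: "\<And>l. 0 < l \<Longrightarrow> measure M {\<omega>\<in>space M. ennreal (\<beta> * l) \<le> U \<omega> \<and> Z \<omega> < ennreal (\<delta> * l)}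
      \<le> \<epsilon> * measure M {\<omega>\<in>space M. ennreal l \<le> U \<omega>}"
  shows "(\<integral>\<^sup>+ \<omega>. at_ext \<Psi> (U \<omega>) \<partial>M) \<le> ennreal (2 * c * c') * (\<integral>\<^sup>+ \<omega>. at_ext \<Psi> (Z \<omega>) \<partial>M)"
proof -
  interpret prob_space M by fact
  note [measurable] = at_ext_measurable[OF cont]
  define U1 where "U1 \<omega> = ennreal (1 / \<beta>) * U \<omega>" for \<omega>
  define Z1 where "Z1 \<omega> = ennreal (1 / \<delta>) * Z \<omega>" for \<omega>
  have [measurable]: "U1 \<in> borel_measurable M" "Z1 \<in> borel_measurable M"
    unfolding U1_def[abs_def] Z1_def[abs_def] by measurable
  have layer: "emeasure M {\<omega>\<in>space M. ennreal y < at_ext \<Psi> (U1 \<omega>)}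
     \<le> ennreal \<epsilon> * emeasure M {\<omega>\<in>space M. ennreal y \<le> at_ext \<Psi> (U \<omega>)} + emeasure M {\<omega>\<in>space M. ennreal y \<le> at_ext \<Psi> (Z1 \<omega>)}"
    if y: "0 < y" for y
  proof (cases "\<exists>l\<ge>0. \<Psi> l = y")
    case True
    then obtain l where l: "0 \<le> l" "\<Psi> l = y" by blast
    have lpos: "0 < l" using l \<Psi>0 y by (cases "l = 0") auto
    have al: "at_ext \<Psi> (ennreal l) = ennreal y" using l by (simp add: at_ext_real)
    have sub: "{\<omega>\<in>space M. ennreal y < at_ext \<Psi> (U1 \<omega>)} \<subseteq>
        {\<omega>\<in>space M. ennreal (\<beta> * l) \<le> U \<omega> \<and> Z \<omega> < ennreal (\<delta> * l)} \<union> {\<omega>\<in>space M. ennreal y \<le> at_ext \<Psi> (Z1 \<omega>)}"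
    proof safe
      fix \<omega> assume w: "\<omega> \<in> space M" and lt: "ennreal y < at_ext \<Psi> (U1 \<omega>)" and nz: "\<not> ennreal y \<le> at_ext \<Psi> (Z1 \<omega>)"
      have "ennreal l \<le> U1 \<omega>"
      proof (rule ccontr)
        assume "\<not> ennreal l \<le> U1 \<omega>"
        then have "at_ext \<Psi> (U1 \<omega>) \<le> at_ext \<Psi> (ennreal l)" by (intro at_ext_mono[OF mono]) simp
        then show False using lt al by simp
      qed
      then have "ennreal \<beta> * ennreal l \<le> ennreal \<beta> * (ennreal (1 / \<beta>) * U \<omega>)"
        unfolding U1_def by (rule mult_left_mono) simp
      then show "ennreal (\<beta> * l) \<le> U \<omega>"
        using pos l by (simp add: ennreal_mult[symmetric] mult.assoc[symmetric])
      have "Z1 \<omega> < ennreal l"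
      proof (rule ccontr)
        assume "\<not> Z1 \<omega> < ennreal l"
        then have "at_ext \<Psi> (ennreal l) \<le> at_ext \<Psi> (Z1 \<omega>)" by (intro at_ext_mono[OF mono]) simp
        then show False using nz al by simp
      qed
      then have "ennreal \<delta> * (ennreal (1 / \<delta>) * Z \<omega>) < ennreal \<delta> * ennreal l"
        unfolding Z1_def using pos by (intro ennreal_mult_strict_left_mono) auto
      then show "Z \<omega> < ennreal (\<delta> * l)"
        using pos l by (simp add: ennreal_mult[symmetric] mult.assoc[symmetric])
    qed
    have "emeasure M {\<omega>\<in>space M. ennreal y < at_ext \<Psi> (U1 \<omega>)} \<le>
        emeasure M ({\<omega>\<in>space M. ennreal (\<beta> * l) \<le> U \<omega> \<and> Z \<omega> < ennreal (\<delta> * l)} \<union> {\<omega>\<in>space M. ennreal y \<le> at_ext \<Psi> (Z1 \<omega>)})"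
      by (rule emeasure_mono[OF sub]) measurable
    also have "\<dots> \<le> emeasure M {\<omega>\<in>space M. ennreal (\<beta> * l) \<le> U \<omega> \<and> Z \<omega> < ennreal (\<delta> * l)} + emeasure M {\<omega>\<in>space M. ennreal y \<le> at_ext \<Psi> (Z1 \<omega>)}"
      by (rule emeasure_subadditive) measurable
    also have "emeasure M {\<omega>\<in>space M. ennreal (\<beta> * l) \<le> U \<omega> \<and> Z \<omega> < ennreal (\<delta> * l)} \<le> ennreal \<epsilon> * emeasure M {\<omega>\<in>space M. ennreal l \<le> U \<omega>}"
      using good[OF lpos] pos by (simp add: emeasure_eq_measure ennreal_mult[symmetric] ennreal_leI)
    also have "emeasure M {\<omega>\<in>space M. ennreal l \<le> U \<omega>} \<le> emeasure M {\<omega>\<in>space M. ennreal y \<le> at_ext \<Psi> (U \<omega>)}"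
      using at_ext_mono[OF mono, of "ennreal l"] al by (intro emeasure_mono) auto
    finally show ?thesis by (simp add: add_right_mono mult_left_mono)
  next
    case False
    \<comment> \<open>If no argument has the value \<open>y\<close>, then by continuity
      \<open>\<Psi>\<close> stays below \<open>y\<close> and there is nothing to prove.\<close>
    have lt: "\<Psi> x < y" if "0 \<le> x" for x
    proof (rule ccontr)
      assume "\<not> \<Psi> x < y"
      then have "\<exists>l. 0 \<le> l \<and> l \<le> x \<and> \<Psi> l = y"
        using \<Psi>0 y that cont by (intro IVT') (auto intro: continuous_on_subset)
      then show False using False by blast
    qed
    have "at_ext \<Psi> z \<le> ennreal y" for z
    proof (cases z)
      case (real x)
      then show ?thesis using lt[of x] by (simp add: at_ext_real ennreal_leI less_imp_le)
    next
      case top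
      have "(SUP y\<in>{0..}. ennreal (\<Psi> y)) \<le> ennreal y"
        by (rule SUP_least, rule ennreal_leI, rule less_imp_le, rule lt) simp
      then show ?thesis using top by (simp add: at_ext_def)
    qed
    then have "{\<omega>\<in>space M. ennreal y < at_ext \<Psi> (U1 \<omega>)} = {}" by (auto simp: not_less)
    then show ?thesis by (simp only: emeasure_empty) simp
  qed
  have sf: "sigma_finite_measure M" ..
  let ?u = "\<integral>\<^sup>+ \<omega>. at_ext \<Psi> (U \<omega>) \<partial>M" and ?u1 = "\<integral>\<^sup>+ \<omega>. at_ext \<Psi> (U1 \<omega>) \<partial>M" and ?z1 = "\<integral>\<^sup>+ \<omega>. at_ext \<Psi> (Z1 \<omega>) \<partial>M"
  have lay: "(\<integral>\<^sup>+ \<omega>. h \<omega> \<partial>M) = (\<integral>\<^sup>+ y. emeasure M {\<omega>\<in>space M. ennreal y < h \<omega>} * indicator {0<..} y \<partial>lborel)"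
     "(\<integral>\<^sup>+ \<omega>. h \<omega> \<partial>M) = (\<integral>\<^sup>+ y. emeasure M {\<omega>\<in>space M. ennreal y \<le> h \<omega>} * indicator {0<..} y \<partial>lborel)"
     if "h \<in> borel_measurable M" for h using nn_integral_layer_cake[OF sf that] by blast+
  have Fm: "(\<lambda>y. emeasure M {\<omega>\<in>space M. ennreal y \<le> h \<omega>}) \<in> borel_measurable lborel"
    if [measurable]: "h \<in> borel_measurable M" for h
    by measurable
  have "?u1 = (\<integral>\<^sup>+ y. emeasure M {\<omega>\<in>space M. ennreal y < at_ext \<Psi> (U1 \<omega>)} * indicator {0<..} y \<partial>lborel)"
    by (rule lay(1)) measurable
  also have "\<dots> \<le> (\<integral>\<^sup>+ y. (ennreal \<epsilon> * (emeasure M {\<omega>\<in>space M. ennreal y \<le> at_ext \<Psi> (U \<omega>)} * indicator {0<..} y)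
      + emeasure M {\<omega>\<in>space M. ennreal y \<le> at_ext \<Psi> (Z1 \<omega>)} * indicator {0<..} y) \<partial>lborel)"
    using layer by (intro nn_integral_mono) (auto simp: indicator_def)
  also have "\<dots> = ennreal \<epsilon> * ?u + ?z1"
    using Fm[of "\<lambda>\<omega>. at_ext \<Psi> (U \<omega>)"] Fm[of "\<lambda>\<omega>. at_ext \<Psi> (Z1 \<omega>)"]
    by (subst nn_integral_add) (auto simp: nn_integral_cmult lay(2)[symmetric])
  finally have main: "?u1 \<le> ennreal \<epsilon> * ?u + ?z1" .
  have "at_ext \<Psi> (U \<omega>) \<le> ennreal c * at_ext \<Psi> (U1 \<omega>)" for \<omega>
  proof -
    have "ennreal \<beta> * U1 \<omega> = U \<omega>"
      using pos by (simp add: U1_def ennreal_mult[symmetric] mult.assoc[symmetric])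
    then show ?thesis using at_ext_scale[where r=\<beta> and c=c and \<Phi>=\<Psi> and z="U1 \<omega>", OF pos(1,3) sc] by simp
  qed
  then have "?u \<le> (\<integral>\<^sup>+ \<omega>. ennreal c * at_ext \<Psi> (U1 \<omega>) \<partial>M)" by (intro nn_integral_mono)
  also have "\<dots> = ennreal c * ?u1" by (rule nn_integral_cmult) measurable
  also have "\<dots> \<le> ennreal c * (ennreal \<epsilon> * ?u + ?z1)" using main by (rule mult_left_mono) simp
  finally have u: "?u \<le> ennreal (c * \<epsilon>) * ?u + ennreal c * ?z1"
    using pos by (simp add: distrib_left ennreal_mult mult.assoc)
  have "at_ext \<Psi> (U \<omega>) \<le> ennreal k" for \<omega>
    by (cases "U \<omega>") (auto simp: at_ext_def intro!: SUP_least ennreal_leI bd)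
  then have "?u \<le> (\<integral>\<^sup>+ \<omega>. ennreal k \<partial>M)" by (intro nn_integral_mono)
  also have "\<dots> < \<infinity>" by (simp add: emeasure_space_1)
  finally obtain v where v: "?u = ennreal v" "0 \<le> v" by (cases ?u) auto
  have uz: "?u \<le> ennreal (2 * c) * ?z1"
  proof (cases "ennreal c * ?z1")
    case (real w)
    have "ennreal v \<le> ennreal (c * \<epsilon> * v + w)"
      using u v real pos by (simp add: ennreal_mult[symmetric])
    moreover have "0 \<le> c * \<epsilon> * v + w" using v real pos by auto
    ultimately have "v \<le> c * \<epsilon> * v + w" by (simp only: ennreal_le_iff)
    moreover have "2 * (c * \<epsilon>) * v \<le> 1 * v" using eps v by (intro mult_right_mono) auto
    ultimately have "v \<le> 2 * w" by linarith
    then have "ennreal v \<le> ennreal 2 * (ennreal c * ?z1)" using v real by (simp add: ennreal_mult[symmetric] ennreal_leI del: ennreal_numeral)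
    then show ?thesis using v pos by (simp add: ennreal_mult mult.assoc)
  next
    case top
    then have "ennreal (2 * c) * ?z1 = \<top>" using pos by (simp add: ennreal_mult mult.assoc ennreal_mult_eq_top_iff)
    then show ?thesis by simp
  qed
  have "at_ext \<Psi> (Z1 \<omega>) \<le> ennreal c' * at_ext \<Psi> (Z \<omega>)" for \<omega>
    unfolding Z1_def using at_ext_scale[of "1/\<delta>" c' \<Psi>] pos sc' by simp
  then have "?z1 \<le> (\<integral>\<^sup>+ \<omega>. ennreal c' * at_ext \<Psi> (Z \<omega>) \<partial>M)" by (intro nn_integral_mono)
  also have "\<dots> = ennreal c' * (\<integral>\<^sup>+ \<omega>. at_ext \<Psi> (Z \<omega>) \<partial>M)" by (rule nn_integral_cmult) measurable
  finally have "ennreal (2 * c) * ?z1 \<le> ennreal (2 * c) * (ennreal c' * (\<integral>\<^sup>+ \<omega>. at_ext \<Psi> (Z \<omega>) \<partial>M))"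
    by (rule mult_left_mono) simp
  then show ?thesis using uz pos by (simp add: ennreal_mult mult.assoc order_trans)
qed

text \<open>The truncations of \<open>\<Phi>\<close> satisfy the growth bounds with the same constants, because these are at
least 1; so the estimate for bounded functions is uniform in the truncation.\<close>

lemma good_lambda:
  fixes U Z :: "'a \<Rightarrow> ennreal" and \<Phi> :: "real \<Rightarrow> real"
  assumes M: "prob_space M" and U[measurable]: "U \<in> borel_measurable M" and Z[measurable]: "Z \<in> borel_measurable M"
    and cont: "continuous_on {0..} \<Phi>" and mono: "mono_on {0..} \<Phi>" and \<Phi>0: "\<Phi> 0 = 0"
    and pos: "0 < \<beta>" "0 < \<delta>" "1 \<le> c" "1 \<le> c'" "0 \<le> \<epsilon>" and eps: "2 * (c * \<epsilon>) \<le> 1"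
    and sc: "\<And>x. 0 \<le> x \<Longrightarrow> \<Phi> (\<beta> * x) \<le> c * \<Phi> x" and sc': "\<And>x. 0 \<le> x \<Longrightarrow> \<Phi> (1 / \<delta> * x) \<le> c' * \<Phi> x"
    and good: "\<And>l. 0 < l \<Longrightarrow> measure M {\<omega>\<in>space M. ennreal (\<beta> * l) \<le> U \<omega> \<and> Z \<omega> < ennreal (\<delta> * l)}
      \<le> \<epsilon> * measure M {\<omega>\<in>space M. ennreal l \<le> U \<omega>}"
  shows "(\<integral>\<^sup>+ \<omega>. at_ext \<Phi> (U \<omega>) \<partial>M) \<le> ennreal (2 * c * c') * (\<integral>\<^sup>+ \<omega>. at_ext \<Phi> (Z \<omega>) \<partial>M)"
proof -
  define \<Psi> where "\<Psi> k x = min (\<Phi> x) (real k)" for k :: nat and x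
  have \<Phi>_pos: "0 \<le> \<Phi> x" if "0 \<le> x" for x using mono_onD[OF mono, of 0 x] that \<Phi>0 by simp
  have cut: "min (a * y) (real k) \<le> a * min y (real k)" if "1 \<le> a" "0 \<le> y" for a y k
  proof (cases "y \<le> real k")
    case False
    have "min (a * y) (real k) \<le> 1 * real k" by simp
    also have "\<dots> \<le> a * real k" using that by (intro mult_right_mono) auto
    finally show ?thesis using False by simp
  qed (use that in simp)
  have c\<Psi>: "continuous_on {0..} (\<Psi> k)" for k unfolding \<Psi>_def using cont by (intro continuous_intros)
  have m\<Psi>: "mono_on {0..} (\<Psi> k)" for k
    unfolding \<Psi>_def mono_on_def using mono_onD[OF mono] by (auto simp: min_le_iff_disj intro: min.coboundedI1)
  have s\<Psi>: "\<Psi> k (r * x) \<le> a * \<Psi> k x" if "1 \<le> a" "0 \<le> x" "\<Phi> (r * x) \<le> a * \<Phi> x" for k r x a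
    using cut[of a "\<Phi> x" k] that \<Phi>_pos[of x] unfolding \<Psi>_def by (auto simp: min_def split: if_splits)
  have step: "(\<integral>\<^sup>+ \<omega>. at_ext (\<Psi> k) (U \<omega>) \<partial>M) \<le> ennreal (2 * c * c') * (\<integral>\<^sup>+ \<omega>. at_ext \<Phi> (Z \<omega>) \<partial>M)" for k
  proof -
    have "(\<integral>\<^sup>+ \<omega>. at_ext (\<Psi> k) (U \<omega>) \<partial>M) \<le> ennreal (2 * c * c') * (\<integral>\<^sup>+ \<omega>. at_ext (\<Psi> k) (Z \<omega>) \<partial>M)"
      using pos eps sc sc' by (intro good_lambda_bounded[OF M U Z c\<Psi> m\<Psi>, where k="real k" and \<beta>=\<beta> and \<delta>=\<delta> and \<epsilon>=\<epsilon>] s\<Psi> good)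
        (auto simp: \<Psi>_def \<Phi>0)
    also have "\<dots> \<le> ennreal (2 * c * c') * (\<integral>\<^sup>+ \<omega>. at_ext \<Phi> (Z \<omega>) \<partial>M)"
      unfolding \<Psi>_def by (intro mult_left_mono nn_integral_mono) (auto simp: at_ext_truncate[of \<Phi>] intro: SUP_upper)
    finally show ?thesis .
  qed
  have "(\<integral>\<^sup>+ \<omega>. at_ext \<Phi> (U \<omega>) \<partial>M) = (\<integral>\<^sup>+ \<omega>. (SUP k. at_ext (\<Psi> k) (U \<omega>)) \<partial>M)"
    by (simp add: at_ext_truncate[of \<Phi>] \<Psi>_def[abs_def])
  also have "\<dots> = (SUP k. \<integral>\<^sup>+ \<omega>. at_ext (\<Psi> k) (U \<omega>) \<partial>M)"
  proof (rule nn_integral_monotone_convergence_SUP)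
    show "incseq (\<lambda>k \<omega>. at_ext (\<Psi> k) (U \<omega>))"
    proof (rule incseq_SucI, rule le_funI)
      fix k \<omega>
      show "at_ext (\<Psi> k) (U \<omega>) \<le> at_ext (\<Psi> (Suc k)) (U \<omega>)"
        unfolding at_ext_def \<Psi>_def by (auto intro!: SUP_mono' ennreal_leI)
    qed
    show "(\<lambda>\<omega>. at_ext (\<Psi> k) (U \<omega>)) \<in> borel_measurable M" for k
      using at_ext_measurable[OF c\<Psi>] by measurable
  qed
  also have "\<dots> \<le> ennreal (2 * c * c') * (\<integral>\<^sup>+ \<omega>. at_ext \<Phi> (Z \<omega>) \<partial>M)"
    by (rule SUP_least) (rule step)
  finally show ?thesis .
qed

text \<open>One doubling-type bound can be iterated, so every dilation is controlled.  The convention 0/0 = 1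
and x/0 = \<open>\<infinity>\<close> ensures that the bound also holds where \<open>\<Phi>\<close> vanishes.\<close>

lemma moderate_scale:
  assumes "moderate \<Phi>" and r: "0 < r"
  obtains c where "1 \<le> c" "\<And>x. 0 \<le> x \<Longrightarrow> \<Phi> (r * x) \<le> c * \<Phi> x"
proof -
  from assms obtain \<beta> where \<Phi>: "\<And>x. 0 \<le> x \<Longrightarrow> 0 \<le> \<Phi> x" "mono_on {0..} \<Phi>" "\<Phi> 0 = 0"
    and \<beta>: "1 < \<beta>" and fin: "(SUP x\<in>{0<..}. ext_quotient (\<Phi> (\<beta> * x)) (\<Phi> x)) < \<infinity>"
    by (auto simp: moderate_def)
  obtain c0 where c0: "(SUP x\<in>{0<..}. ext_quotient (\<Phi> (\<beta> * x)) (\<Phi> x)) = ennreal c0" "0 \<le> c0"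
    using fin by (cases "(SUP x\<in>{0<..}. ext_quotient (\<Phi> (\<beta> * x)) (\<Phi> x))") auto
  define c where "c = max 1 c0"
  have step: "\<Phi> (\<beta> * x) \<le> c * \<Phi> x" if "0 \<le> x" for x
  proof (cases "x = 0")
    case False
    have "ext_quotient (\<Phi> (\<beta> * x)) (\<Phi> x) \<le> ennreal c0"
      unfolding c0(1)[symmetric] using that False by (intro SUP_upper) auto
    then have "\<Phi> (\<beta> * x) \<le> c0 * \<Phi> x"
      using \<Phi>(1)[OF that] c0(2) \<Phi>(1)[of "\<beta> * x"] that \<beta>
      by (auto simp: ext_quotient_def ennreal_le_iff divide_le_eq top_unique split: if_splits)
    also have "\<dots> \<le> c * \<Phi> x" using \<Phi>(1)[OF that] by (intro mult_right_mono) (auto simp: c_def)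
    finally show ?thesis .
  qed (simp add: \<Phi>)
  have iter: "\<Phi> (\<beta> ^ n * x) \<le> c ^ n * \<Phi> x" if "0 \<le> x" for n x
  proof (induction n)
    case (Suc n)
    have "\<Phi> (\<beta> ^ Suc n * x) = \<Phi> (\<beta> * (\<beta> ^ n * x))" by (simp add: mult_ac)
    also have "\<dots> \<le> c * \<Phi> (\<beta> ^ n * x)" using that \<beta> by (intro step) auto
    also have "\<dots> \<le> c * (c ^ n * \<Phi> x)" using Suc by (intro mult_left_mono) (auto simp: c_def)
    finally show ?case by (simp add: mult_ac)
  qed simp
  obtain n where n: "r < \<beta> ^ n" using real_arch_pow[OF \<beta>] by blast
  show thesis
  proof (rule that[of "c ^ n"])
    show "1 \<le> c ^ n" by (rule one_le_power) (simp add: c_def)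
    fix x :: real assume x: "0 \<le> x"
    have "\<Phi> (r * x) \<le> \<Phi> (\<beta> ^ n * x)"
      using n r x \<beta> by (intro mono_onD[OF \<Phi>(2)] mult_right_mono) auto
    then show "\<Phi> (r * x) \<le> c ^ n * \<Phi> x" using iter[OF x, of n] by simp
  qed
qed

lemma moderate_powr:
  assumes "0 < p"
  shows "moderate (\<lambda>x. x powr p)"
  unfolding moderate_def
proof (intro conjI allI impI exI[of _ 2])
  show "continuous_on {0..} (\<lambda>x. x powr p)"
    using assms by (intro continuous_intros continuous_on_powr') auto
  show "mono_on {0..} (\<lambda>x. x powr p)" using assms by (auto simp: mono_on_def intro!: powr_mono2)
  have "ext_quotient ((2 * x) powr p) (x powr p) \<le> ennreal (2 powr p)" if "0 < x" for x
    using that by (simp add: ext_quotient_def powr_mult)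
  then have "(SUP x\<in>{0<..}. ext_quotient ((2 * x) powr p) (x powr p)) \<le> ennreal (2 powr p)"
    by (intro SUP_least) auto
  then show "(SUP x\<in>{0<..}. ext_quotient ((2 * x) powr p) (x powr p)) < \<infinity>"
    by (rule le_less_trans) simp
qed auto

text \<open>The order of the choices makes the constant uniform over the family: \<open>\<Phi>\<close> and \<open>\<beta>\<close> determine
\<open>c\<close>, this determines \<open>\<epsilon>\<close> and hence \<open>\<delta>\<close>, and \<open>\<delta>\<close> determines \<open>c'\<close>.\<close>

lemma good_lambda_family:
  fixes \<Phi> :: "real \<Rightarrow> real" and U Z :: "'i \<Rightarrow> 'a \<Rightarrow> ennreal"
  assumes M: "prob_space M" and \<Phi>: "moderate \<Phi>" and \<beta>: "1 < \<beta>"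
    and meas: "\<And>i. i \<in> J \<Longrightarrow> U i \<in> borel_measurable M" "\<And>i. i \<in> J \<Longrightarrow> Z i \<in> borel_measurable M"
    and good: "\<And>\<epsilon>. 0 < \<epsilon> \<Longrightarrow> \<exists>\<delta>>0. \<forall>i l. i \<in> J \<longrightarrow> 0 < l \<longrightarrow>
      measure M {\<omega>\<in>space M. ennreal (\<beta> * l) \<le> U i \<omega> \<and> Z i \<omega> < ennreal (\<delta> * l)} \<le> \<epsilon> * measure M {\<omega>\<in>space M. ennreal l \<le> U i \<omega>}"
  shows "\<exists>C>0. \<forall>i\<in>J. (\<integral>\<^sup>+ \<omega>. at_ext \<Phi> (U i \<omega>) \<partial>M) \<le> ennreal C * (\<integral>\<^sup>+ \<omega>. at_ext \<Phi> (Z i \<omega>) \<partial>M)"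
proof -
  have F: "continuous_on {0..} \<Phi>" "mono_on {0..} \<Phi>" "\<Phi> 0 = 0" using \<Phi> by (auto simp: moderate_def)
  have b0: "0 < \<beta>" using \<beta> by simp
  obtain c where c: "1 \<le> c" "\<And>x. 0 \<le> x \<Longrightarrow> \<Phi> (\<beta> * x) \<le> c * \<Phi> x" using moderate_scale[OF \<Phi> b0] by metis
  have e: "0 < 1 / (2 * c)" "2 * (c * (1 / (2 * c))) \<le> 1" using c(1) by auto
  obtain \<delta> where d: "0 < \<delta>" and gd: "\<And>i l. i \<in> J \<Longrightarrow> 0 < l \<Longrightarrow>
      measure M {\<omega>\<in>space M. ennreal (\<beta> * l) \<le> U i \<omega> \<and> Z i \<omega> < ennreal (\<delta> * l)} \<le> 1 / (2 * c) * measure M {\<omega>\<in>space M. ennreal l \<le> U i \<omega>}"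
    using good[OF e(1)] by blast
  have d1: "0 < 1 / \<delta>" using d by simp
  obtain c' where c': "1 \<le> c'" "\<And>x. 0 \<le> x \<Longrightarrow> \<Phi> (1 / \<delta> * x) \<le> c' * \<Phi> x" using moderate_scale[OF \<Phi> d1] by metis
  show ?thesis
  proof (intro exI[of _ "2 * c * c'"] conjI ballI)
    show "0 < 2 * c * c'" using c(1) c'(1) by auto
    fix i assume i: "i \<in> J"
    show "(\<integral>\<^sup>+ \<omega>. at_ext \<Phi> (U i \<omega>) \<partial>M) \<le> ennreal (2 * c * c') * (\<integral>\<^sup>+ \<omega>. at_ext \<Phi> (Z i \<omega>) \<partial>M)"
      by (rule good_lambda[OF M meas(1)[OF i] meas(2)[OF i] F b0 d c(1) c'(1) less_imp_le[OF e(1)] e(2) c(2) c'(2) gd[OF i]])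
  qed
qed

section \<open>Running maxima and hitting times of continuous paths\<close>

text \<open>Capping rational times at \<open>t\<close> gives an index set that does not depend on \<open>t\<close>; the running maximum is
therefore measurable also at a random time.\<close>

lemma run_max_rationals:
  assumes "continuous_on {0..} w"
  shows "run_max w t = (SUP q\<in>\<rat> \<inter> {0..}. ennreal \<bar>w (enn2real (min (ennreal q) t))\<bar>)" (is "_ = ?R")
proof (rule antisym)
  have fin: "min (ennreal q) t < \<infinity>" for q :: real by (simp add: min_less_iff_disj)
  show "?R \<le> run_max w t"
    unfolding run_max_def
  proof (rule SUP_least)
    fix q :: real assume "q \<in> \<rat> \<inter> {0..}"
    show "ennreal \<bar>w (enn2real (min (ennreal q) t))\<bar> \<le> (SUP s\<in>{s. 0 \<le> s \<and> ennreal s \<le> t}. ennreal \<bar>w s\<bar>)"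
      using fin[of q] by (intro SUP_upper) (auto simp: ennreal_enn2real)
  qed
  define m where "m x = (if t = \<infinity> then x else min x (enn2real t))" for x
  have m: "enn2real (min (ennreal x) t) = m x" if "0 \<le> x" for x
    using that by (cases t) (auto simp: m_def min_def ennreal_le_iff2 split: if_splits)
  have cm: "continuous_on {0..} (\<lambda>x. \<bar>w (m x)\<bar>)"
    unfolding m_def
    by (cases "t = \<infinity>") (auto intro!: continuous_on_rabs continuous_intros continuous_on_compose2[OF assms])
  show "run_max w t \<le> ?R"
    unfolding run_max_def
  proof (rule SUP_least)
    fix s assume "s \<in> {s. 0 \<le> s \<and> ennreal s \<le> t}"
    then have s: "0 \<le> s" "ennreal s \<le> t" by auto
    then have ms: "m s = s" by (metis m enn2real_ennreal min.absorb1)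
    show "ennreal \<bar>w s\<bar> \<le> ?R"
    proof (rule ccontr)
      assume "\<not> ennreal \<bar>w s\<bar> \<le> ?R"
      then have lt: "?R < ennreal \<bar>w s\<bar>" by simp
      then obtain K where K: "?R = ennreal K" "0 \<le> K"
        by (cases ?R) auto
      then have "K < \<bar>w (m s)\<bar>" using lt ms by (simp add: ennreal_less_iff)
      then obtain d where d: "d > 0" "\<And>x. 0 \<le> x \<Longrightarrow> dist x s < d \<Longrightarrow> dist \<bar>w (m x)\<bar> \<bar>w (m s)\<bar> < \<bar>w (m s)\<bar> - K"
        using cm s unfolding continuous_on_iff by (metis atLeast_iff diff_gt_0_iff_gt)
      obtain q where q: "q \<in> \<rat>" "s < q" "q < s + d" using Rats_dense_in_real[of s "s + d"] d by auto
      then have "K < \<bar>w (m q)\<bar>" using d(2)[of q] s by (auto simp: dist_real_def)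
      moreover have "ennreal \<bar>w (m q)\<bar> \<le> ?R"
        using q s m[of q] by (intro SUP_upper2[of q]) auto
      ultimately show False using K by (simp add: ennreal_le_iff2)
    qed
  qed
qed

lemma run_max_measurable:
  assumes "\<And>\<omega>. \<omega> \<in> space N \<Longrightarrow> continuous_on {0..} (\<lambda>s. Y s \<omega>)"
    and "\<And>s. 0 \<le> s \<Longrightarrow> ennreal s \<le> t \<Longrightarrow> Y s \<in> borel_measurable N"
  shows "(\<lambda>\<omega>. run_max (\<lambda>s. Y s \<omega>) t) \<in> borel_measurable N"
proof -
  have fin: "min (ennreal q) t < \<infinity>" for q :: real by (simp add: min_less_iff_disj)
  have "(\<lambda>\<omega>. SUP q\<in>\<rat> \<inter> {0..}. ennreal \<bar>Y (enn2real (min (ennreal q) t)) \<omega>\<bar>) \<in> borel_measurable N"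
  proof (rule borel_measurable_SUP)
    show "countable (\<rat> \<inter> {0::real..})" using countable_rat by auto
    fix q :: real
    have "Y (enn2real (min (ennreal q) t)) \<in> borel_measurable N"
      using fin[of q] by (intro assms(2)) (auto simp: ennreal_enn2real)
    then show "(\<lambda>\<omega>. ennreal \<bar>Y (enn2real (min (ennreal q) t)) \<omega>\<bar>) \<in> borel_measurable N" by measurable
  qed
  then show ?thesis
    by (rule measurable_cong[THEN iffD1, rotated]) (simp add: run_max_rationals[OF assms(1)])
qed

lemma run_max_upper: "0 \<le> s \<Longrightarrow> ennreal s \<le> t \<Longrightarrow> ennreal \<bar>w s\<bar> \<le> run_max w t"
  unfolding run_max_def by (rule SUP_upper) auto

lemma run_max_le_iff:
  assumes "0 \<le> R" "0 \<le> t"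
  shows "run_max w (ennreal t) \<le> ennreal R \<longleftrightarrow> (\<forall>x\<in>{0..t}. \<bar>w x\<bar> \<le> R)"
  using assms by (auto simp: run_max_def SUP_le_iff ennreal_le_iff)

lemma run_max_cong: "(\<And>x. 0 \<le> x \<Longrightarrow> w x = w' x) \<Longrightarrow> run_max w t = run_max w' t"
  unfolding run_max_def by (intro SUP_cong) auto

lemma run_max_path_measurable: "(\<lambda>w. run_max w t) \<in> borel_measurable path_space"
proof (rule run_max_measurable[of path_space "\<lambda>s w. w s"])
  show "continuous_on {0..} (\<lambda>s. w s)" if "w \<in> space path_space" for w
    using that by (auto simp: path_space_def space_restrict_space)
  show "(\<lambda>w. w s) \<in> borel_measurable path_space" if "0 \<le> s" for s
    unfolding path_space_def using that by (intro measurable_restrict_space1 measurable_component_singleton) auto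
qed

lemma run_max_ge_iff:
  assumes w: "continuous_on {0..} w" and l: "0 < l" and t: "0 \<le> t"
  shows "ennreal l \<le> run_max w (ennreal t) \<longleftrightarrow> (\<exists>r\<in>{0..t}. l \<le> \<bar>w r\<bar>)"
proof
  assume "\<exists>r\<in>{0..t}. l \<le> \<bar>w r\<bar>"
  then obtain r where r: "0 \<le> r" "r \<le> t" "l \<le> \<bar>w r\<bar>" by auto
  have "ennreal l \<le> ennreal \<bar>w r\<bar>" using r by (intro ennreal_leI)
  also have "\<dots> \<le> run_max w (ennreal t)" using r by (intro run_max_upper ennreal_leI) auto
  finally show "ennreal l \<le> run_max w (ennreal t)" .
next
  assume le: "ennreal l \<le> run_max w (ennreal t)"
  have "continuous_on {0..t} (\<lambda>t. \<bar>w t\<bar>)" using w by (auto intro!: continuous_intros intro: continuous_on_subset)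
  then obtain x where x: "x \<in> {0..t}" "\<And>y. y \<in> {0..t} \<Longrightarrow> \<bar>w y\<bar> \<le> \<bar>w x\<bar>"
    using continuous_attains_sup[of "{0..t}" "\<lambda>t. \<bar>w t\<bar>"] t by auto
  have "run_max w (ennreal t) \<le> ennreal \<bar>w x\<bar>"
    using x t by (subst run_max_le_iff) auto
  with le have "ennreal l \<le> ennreal \<bar>w x\<bar>" by (rule order_trans)
  then have "l \<le> \<bar>w x\<bar>" by simp
  then show "\<exists>r\<in>{0..t}. l \<le> \<bar>w r\<bar>" using x(1) by blast
qed

definition hit_time :: "(real \<Rightarrow> real) \<Rightarrow> real \<Rightarrow> ennreal" where
  "hit_time w l = (INF t\<in>{t. 0 \<le> t \<and> l \<le> \<bar>w t\<bar>}. ennreal t)"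

lemma hit_time_lower: "0 \<le> t \<Longrightarrow> l \<le> \<bar>w t\<bar> \<Longrightarrow> hit_time w l \<le> ennreal t"
  unfolding hit_time_def by (rule INF_lower) auto

lemma hit_time_attained:
  assumes w: "continuous_on {0..} w" and fin: "hit_time w l < \<infinity>"
  obtains s where "0 \<le> s" "hit_time w l = ennreal s" "l \<le> \<bar>w s\<bar>"
proof -
  let ?T = "{t. 0 \<le> t \<and> l \<le> \<bar>w t\<bar>}"
  have "?T \<noteq> {}"
  proof
    assume "?T = {}"
    then have "hit_time w l = \<infinity>" unfolding hit_time_def by (simp only: image_empty Inf_empty) simp
    then show False using fin by simp
  qed
  moreover have bdd: "bdd_below ?T" by (rule bdd_belowI[of _ 0]) auto
  moreover have "closed ?T"
  proof -
    have "closed ({0..} \<inter> (\<lambda>t. \<bar>w t\<bar>) -` {l..})"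
      by (rule continuous_closed_preimage) (auto intro!: continuous_intros w)
    moreover have "{0..} \<inter> (\<lambda>t. \<bar>w t\<bar>) -` {l..} = ?T" by auto
    ultimately show ?thesis by simp
  qed
  ultimately have in_T: "Inf ?T \<in> ?T" by (rule closed_contains_Inf)
  have "hit_time w l = ennreal (Inf ?T)"
  proof (rule antisym)
    show "hit_time w l \<le> ennreal (Inf ?T)" using in_T by (intro hit_time_lower) auto
    show "ennreal (Inf ?T) \<le> hit_time w l"
      unfolding hit_time_def using bdd by (intro INF_greatest ennreal_leI cInf_lower) auto
  qed
  then show thesis using in_T that by auto
qed

text \<open>By the intermediate value theorem a path that starts below the level cannot jump over it.\<close>

lemma hit_time_value:
  assumes w: "continuous_on {0..} w" and s: "0 \<le> s" "hit_time w l = ennreal s" "l \<le> \<bar>w s\<bar>" and w0: "\<bar>w 0\<bar> \<le> l"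
  shows "\<bar>w s\<bar> = l"
proof (rule ccontr)
  assume "\<bar>w s\<bar> \<noteq> l"
  then have gt: "l < \<bar>w s\<bar>" using s by simp
  have "continuous_on {0..s} (\<lambda>t. \<bar>w t\<bar>)" using w by (auto intro!: continuous_intros intro: continuous_on_subset)
  then obtain r where r: "0 \<le> r" "r \<le> s" "\<bar>w r\<bar> = l"
    using IVT'[of "\<lambda>t. \<bar>w t\<bar>" 0 l s] w0 gt s by auto
  have "ennreal s \<le> ennreal r" using hit_time_lower[of r l w] r s by simp
  then have "r = s" using r s by (simp add: ennreal_le_iff)
  then show False using r gt by simp
qed

lemma hit_time_le_iff:
  assumes w: "continuous_on {0..} w" and l: "0 < l" and t: "0 \<le> t"
  shows "hit_time w l \<le> ennreal t \<longleftrightarrow> ennreal l \<le> run_max w (ennreal t)"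
proof -
  have "hit_time w l \<le> ennreal t \<longleftrightarrow> (\<exists>r\<in>{0..t}. l \<le> \<bar>w r\<bar>)"
  proof
    assume le: "hit_time w l \<le> ennreal t"
    then have "hit_time w l < \<infinity>" by (simp add: le_less_trans)
    then obtain s where s: "0 \<le> s" "hit_time w l = ennreal s" "l \<le> \<bar>w s\<bar>" by (rule hit_time_attained[OF w])
    then show "\<exists>r\<in>{0..t}. l \<le> \<bar>w r\<bar>" using le t by (auto simp: ennreal_le_iff)
  next
    assume "\<exists>r\<in>{0..t}. l \<le> \<bar>w r\<bar>"
    then obtain r where "0 \<le> r" "r \<le> t" "l \<le> \<bar>w r\<bar>" by auto
    then show "hit_time w l \<le> ennreal t" using order_trans[OF hit_time_lower[of r l w] ennreal_leI[of r t]] by simp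
  qed
  then show ?thesis using run_max_ge_iff[OF assms] by simp
qed

section \<open>The strong Markov property at a hitting time\<close>

text \<open>A process with continuous paths is the limit of the processes obtained by rounding the time down to a
multiple of \<open>1/n\<close>, each of which uses countably many times.\<close>

lemma borel_measurable_continuous_joint:
  fixes Y :: "real \<Rightarrow> 'b \<Rightarrow> real"
  assumes meas: "\<And>x. Y x \<in> borel_measurable N"
    and cont: "\<And>\<omega>. \<omega> \<in> space N \<Longrightarrow> continuous_on UNIV (\<lambda>x. Y x \<omega>)"
  shows "(\<lambda>(\<omega>, x). Y x \<omega>) \<in> borel_measurable (N \<Otimes>\<^sub>M lborel)"
proof -
  define g where "g n x = of_int \<lfloor>x * real (Suc n)\<rfloor> / real (Suc n)" for n x
  have "(\<lambda>p. Y (g n (snd p)) (fst p)) \<in> borel_measurable (N \<Otimes>\<^sub>M lborel)" for n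
  proof -
    have "(\<lambda>p. (\<lambda>k p. Y (of_int k / real (Suc n)) (fst p)) \<lfloor>snd p * real (Suc n)\<rfloor> p) \<in> borel_measurable (N \<Otimes>\<^sub>M lborel)"
      by (rule measurable_compose_countable) (use meas in measurable)
    then show ?thesis by (simp add: g_def)
  qed
  then show ?thesis
    unfolding case_prod_beta
  proof (rule borel_measurable_LIMSEQ_real[rotated])
    fix p :: "'b \<times> real" assume "p \<in> space (N \<Otimes>\<^sub>M lborel)"
    then have w: "fst p \<in> space N" by (auto simp: space_pair_measure)
    have "(\<lambda>n. g n (snd p)) \<longlonglongrightarrow> snd p"
    proof (rule tendsto_sandwich)
      show "\<forall>\<^sub>F n in sequentially. snd p - 1 / real (Suc n) \<le> g n (snd p)"
      proof (intro always_eventually allI)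
        fix n
        have "snd p * real (Suc n) - 1 \<le> of_int \<lfloor>snd p * real (Suc n)\<rfloor>" by linarith
        then have "(snd p * real (Suc n) - 1) / real (Suc n) \<le> g n (snd p)"
          unfolding g_def by (intro divide_right_mono) auto
        then show "snd p - 1 / real (Suc n) \<le> g n (snd p)"
          by (simp add: diff_divide_distrib del: of_nat_Suc)
      qed
      show "\<forall>\<^sub>F n in sequentially. g n (snd p) \<le> snd p"
        by (intro always_eventually allI) (simp add: g_def divide_le_eq del: of_nat_Suc)
      have "(\<lambda>n. snd p - 1 / real (Suc n)) \<longlonglongrightarrow> snd p - 0"
        by (intro tendsto_diff tendsto_const LIMSEQ_Suc[OF lim_1_over_n])
      then show "(\<lambda>n. snd p - 1 / real (Suc n)) \<longlonglongrightarrow> snd p" by simp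
    qed simp
    then show "(\<lambda>n. Y (g n (snd p)) (fst p)) \<longlonglongrightarrow> Y (snd p) (fst p)"
      using cont[OF w] by (intro continuous_on_tendsto_compose[of UNIV "\<lambda>x. Y x (fst p)"]) auto
  qed
qed

locale filtered_prob_space = prob_space M + filtration "space M" \<F>
  for M :: "'a measure" and \<F> :: "ennreal \<Rightarrow> 'a measure" +
  assumes sets_F_subset: "\<And>t. sets (\<F> t) \<subseteq> sets M"

begin

lemma measurable_F_M: "h \<in> borel_measurable (\<F> t) \<Longrightarrow> h \<in> borel_measurable M"
  using sets_F_subset[of t] space_F[of t] by (auto simp: measurable_def)

lemma measurable_F_mono: "h \<in> borel_measurable (\<F> s) \<Longrightarrow> s \<le> t \<Longrightarrow> h \<in> borel_measurable (\<F> t)"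
  using sets_F_mono[of s t] space_F by (auto simp: measurable_def)

lemma integrable_bounded:
  fixes h :: "'a \<Rightarrow> real"
  assumes "h \<in> borel_measurable M" "\<And>\<omega>. \<omega> \<in> space M \<Longrightarrow> \<bar>h \<omega>\<bar> \<le> K"
  shows "integrable M h"
  using assms by (intro integrable_const_bound[of _ K]) auto

lemma hit_time_stopping_time:
  assumes X: "continuous_adapted M \<F> X" and l: "0 < l"
  shows "stopping_time \<F> (\<lambda>\<omega>. hit_time (\<lambda>t. X t \<omega>) l)"
proof
  fix t :: ennreal
  show "Measurable.pred (\<F> t) (\<lambda>\<omega>. hit_time (\<lambda>t. X t \<omega>) l \<le> t)"
  proof (cases t)
    case (real r)
    have Xc: "continuous_on {0..} (\<lambda>t. X t \<omega>)" if "\<omega> \<in> space (\<F> t)" for \<omega>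
      using X that space_F by (auto simp: continuous_adapted_def)
    have "(\<lambda>\<omega>. run_max (\<lambda>t. X t \<omega>) t) \<in> borel_measurable (\<F> t)"
    proof (rule run_max_measurable[OF Xc])
      fix s :: real assume s: "0 \<le> s" "ennreal s \<le> t"
      then have "X s \<in> borel_measurable (\<F> (ennreal s))" using X by (auto simp: continuous_adapted_def)
      then show "X s \<in> borel_measurable (\<F> t)" using s(2) by (rule measurable_F_mono)
    qed
    then have "Measurable.pred (\<F> t) (\<lambda>\<omega>. ennreal l \<le> run_max (\<lambda>t. X t \<omega>) t)" by measurable
    then show ?thesis
      by (rule measurable_cong[THEN iffD2, rotated]) (use hit_time_le_iff[OF Xc l] real in auto)
  qed simp
qed

lemma path_joint:
  assumes X: "continuous_adapted M \<F> X"
  shows "(\<lambda>(\<omega>, x). X (max 0 x) \<omega>) \<in> borel_measurable (M \<Otimes>\<^sub>M lborel)"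
proof (rule borel_measurable_continuous_joint)
  fix x :: real
  have "0 \<le> max 0 x" by simp
  then have "X (max 0 x) \<in> borel_measurable (\<F> (ennreal (max 0 x)))"
    using X unfolding continuous_adapted_def by blast
  then show "X (max 0 x) \<in> borel_measurable M" by (rule measurable_F_M)
next
  fix \<omega> assume "\<omega> \<in> space M"
  then have "continuous_on {0..} (\<lambda>t. X t \<omega>)" using X by (auto simp: continuous_adapted_def)
  then show "continuous_on UNIV (\<lambda>x. X (max 0 x) \<omega>)"
    by (rule continuous_on_compose2) (auto intro!: continuous_intros)
qed

lemma random_time_value_measurable:
  assumes X: "continuous_adapted M \<F> X" and \<rho>: "\<rho> \<in> borel_measurable M" "\<And>\<omega>. 0 \<le> \<rho> \<omega>"
  shows "(\<lambda>\<omega>. X (\<rho> \<omega>) \<omega>) \<in> borel_measurable M"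
proof -
  have "(\<lambda>\<omega>. (\<omega>, \<rho> \<omega>)) \<in> M \<rightarrow>\<^sub>M (M \<Otimes>\<^sub>M lborel)" using \<rho>(1) by measurable
  from measurable_compose[OF this path_joint[OF X]] show ?thesis using \<rho>(2) by (simp add: max_absorb2)
qed

lemma run_max_random_time_measurable:
  assumes X: "continuous_adapted M \<F> X" and \<tau>[measurable]: "\<tau> \<in> borel_measurable M"
  shows "(\<lambda>\<omega>. run_max (\<lambda>t. X t \<omega>) (\<tau> \<omega>)) \<in> borel_measurable M"
proof -
  have "(\<lambda>\<omega>. SUP q\<in>\<rat> \<inter> {0..}. ennreal \<bar>X (enn2real (min (ennreal q) (\<tau> \<omega>))) \<omega>\<bar>) \<in> borel_measurable M"
  proof (rule borel_measurable_SUP)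
    show "countable (\<rat> \<inter> {0::real..})" using countable_rat by auto
    fix q :: real
    have "(\<lambda>\<omega>. X (enn2real (min (ennreal q) (\<tau> \<omega>))) \<omega>) \<in> borel_measurable M"
      by (rule random_time_value_measurable[OF X]) auto
    then show "(\<lambda>\<omega>. ennreal \<bar>X (enn2real (min (ennreal q) (\<tau> \<omega>))) \<omega>\<bar>) \<in> borel_measurable M" by measurable
  qed
  moreover have "(SUP q\<in>\<rat> \<inter> {0..}. ennreal \<bar>X (enn2real (min (ennreal q) (\<tau> \<omega>))) \<omega>\<bar>) = run_max (\<lambda>t. X t \<omega>) (\<tau> \<omega>)"
    if "\<omega> \<in> space M" for \<omega>
    using X that by (subst run_max_rationals) (auto simp: continuous_adapted_def)
  ultimately show ?thesis by (rule measurable_cong[THEN iffD1, rotated])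
qed

lemma path_from_in_path_space:
  assumes X: "continuous_adapted M \<F> X" and w: "\<omega> \<in> space M" and s: "0 \<le> s"
  shows "path_from X s \<omega> \<in> space path_space" "continuous_on {0..} (path_from X s \<omega>)"
proof -
  have "continuous_on {0..} (\<lambda>t. X t \<omega>)" using X w by (auto simp: continuous_adapted_def)
  then have "continuous_on {0..} (\<lambda>t. X (s + t) \<omega>)"
    by (rule continuous_on_compose2) (use s in \<open>auto intro!: continuous_intros\<close>)
  then show c: "continuous_on {0..} (path_from X s \<omega>)"
    unfolding path_from_def by (rule continuous_on_eq) auto
  show "path_from X s \<omega> \<in> space path_space"
    using c by (auto simp: path_space_def space_restrict_space space_PiM path_from_def)
qed

text \<open>The complement of \<open>S \<le> \<tau>\<close> within \<open>S \<le> t\<close> is detected at rational times \<open>q \<le> t\<close> with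
\<open>\<tau> \<le> q < S\<close>.\<close>

lemma stopping_time_le_pre_sigma:
  assumes S: "stopping_time \<F> S" and \<tau>: "stopping_time \<F> \<tau>"
  shows "{\<omega>\<in>space M. S \<omega> \<le> \<tau> \<omega> \<and> S \<omega> < \<infinity>} \<in> sets (pre_sigma S)"
proof (rule sets_pre_sigmaI[OF S])
  fix t :: ennreal
  have Sle: "{\<omega>\<in>space M. S \<omega> \<le> t} \<in> sets (\<F> t)"
    using stopping_timeD[OF S, of t] space_F by (simp add: pred_def)
  have Slt: "{\<omega>\<in>space M. S \<omega> < \<infinity>} \<in> sets (\<F> \<infinity>)"
    using stopping_time_less_const[OF S, of \<infinity>] space_F by (simp add: pred_def)
  have q: "{\<omega>\<in>space M. \<tau> \<omega> \<le> ennreal q} \<inter> {\<omega>\<in>space M. ennreal q < S \<omega>} \<in> sets (\<F> t)" if "ennreal q \<le> t" for q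
  proof (rule sets.Int)
    show "{\<omega>\<in>space M. \<tau> \<omega> \<le> ennreal q} \<in> sets (\<F> t)"
      using stopping_time_le_const[OF \<tau> that] space_F by (simp add: pred_def)
    have "{\<omega>\<in>space M. S \<omega> \<le> ennreal q} \<in> sets (\<F> t)"
      using stopping_time_le_const[OF S that] space_F by (simp add: pred_def)
    then have "space (\<F> t) - {\<omega>\<in>space M. S \<omega> \<le> ennreal q} \<in> sets (\<F> t)" by (rule sets.compl_sets)
    moreover have "space (\<F> t) - {\<omega>\<in>space M. S \<omega> \<le> ennreal q} = {\<omega>\<in>space M. ennreal q < S \<omega>}"
      by (auto simp: space_F)
    ultimately show "{\<omega>\<in>space M. ennreal q < S \<omega>} \<in> sets (\<F> t)" by simp
  qed
  let ?V = "\<Union>q\<in>{q\<in>\<rat>. 0 \<le> q \<and> ennreal q \<le> t}. {\<omega>\<in>space M. \<tau> \<omega> \<le> ennreal q} \<inter> {\<omega>\<in>space M. ennreal q < S \<omega>}"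
  have V: "?V \<in> sets (\<F> t)"
  proof (rule sets.countable_UN')
    show "countable {q\<in>\<rat>. 0 \<le> q \<and> ennreal q \<le> t}" by (rule countable_subset[OF _ countable_rat]) blast
    show "(\<lambda>q. {\<omega>\<in>space M. \<tau> \<omega> \<le> ennreal q} \<inter> {\<omega>\<in>space M. ennreal q < S \<omega>}) ` {q\<in>\<rat>. 0 \<le> q \<and> ennreal q \<le> t} \<subseteq> sets (\<F> t)"
      using q by blast
  qed
  have diff: "{\<omega>\<in>space M. S \<omega> \<le> t} - ?V = {\<omega>\<in>space M. S \<omega> \<le> \<tau> \<omega> \<and> S \<omega> \<le> t}"
  proof (intro set_eqI iffI)
    fix \<omega> assume "\<omega> \<in> {\<omega>\<in>space M. S \<omega> \<le> t} - ?V"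
    then have w: "\<omega> \<in> space M" "S \<omega> \<le> t" and nV: "\<omega> \<notin> ?V" by auto
    have "S \<omega> \<le> \<tau> \<omega>"
    proof (rule ccontr)
      assume "\<not> S \<omega> \<le> \<tau> \<omega>"
      then have "\<tau> \<omega> < S \<omega>" by (simp only: not_le)
      then obtain r where r: "\<tau> \<omega> < r" "r < S \<omega>" using dense[of "\<tau> \<omega>" "S \<omega>"] by blast
      then have "\<tau> \<omega> < \<infinity>" by (metis order.strict_trans2 infinity_ennreal_def top_greatest)
      then obtain a where a: "\<tau> \<omega> = ennreal a" "0 \<le> a" by (cases "\<tau> \<omega>") auto
      have "\<exists>q\<in>\<rat>. a < q \<and> ennreal q < S \<omega>"
      proof -
        obtain r' where r': "r = ennreal r'" "0 \<le> r'" using r by (cases r) auto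
        then have "a < r'" using r a by (simp add: ennreal_less_iff)
        then obtain q where "q \<in> \<rat>" "a < q" "q < r'" using Rats_dense_in_real by blast
        moreover then have "ennreal q < ennreal r'" using a by (simp add: ennreal_less_iff)
        ultimately show ?thesis using r r' by (metis less_trans)
      qed
      then obtain q where q: "q \<in> \<rat>" "a < q" "ennreal q < S \<omega>" by blast
      have q0: "0 \<le> q" "ennreal q \<le> t" "\<tau> \<omega> \<le> ennreal q"
        using q a w(2) less_imp_le[OF less_le_trans[OF q(3) w(2)]] by (auto intro!: ennreal_leI)
      then have "\<omega> \<in> ?V" using w(1) q by blast
      then show False using nV by blast
    qed
    then show "\<omega> \<in> {\<omega>\<in>space M. S \<omega> \<le> \<tau> \<omega> \<and> S \<omega> \<le> t}" using w by simp
  next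
    fix \<omega> assume "\<omega> \<in> {\<omega>\<in>space M. S \<omega> \<le> \<tau> \<omega> \<and> S \<omega> \<le> t}"
    then have w: "\<omega> \<in> space M" "S \<omega> \<le> \<tau> \<omega>" "S \<omega> \<le> t" by auto
    have "\<not> (\<tau> \<omega> \<le> ennreal q \<and> ennreal q < S \<omega>)" for q
      using w(2) by (meson leD order_trans)
    then show "\<omega> \<in> {\<omega>\<in>space M. S \<omega> \<le> t} - ?V" using w by blast
  qed
  have le: "{\<omega>\<in>space M. S \<omega> \<le> \<tau> \<omega> \<and> S \<omega> \<le> t} \<in> sets (\<F> t)" using sets.Diff[OF Sle V] by (simp only: diff)
  show "{\<omega> \<in> {\<omega>\<in>space M. S \<omega> \<le> \<tau> \<omega> \<and> S \<omega> < \<infinity>}. S \<omega> \<le> t} \<in> sets (\<F> t)"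
  proof (cases "t = \<infinity>")
    case True
    have eq: "{\<omega> \<in> {\<omega>\<in>space M. S \<omega> \<le> \<tau> \<omega> \<and> S \<omega> < \<infinity>}. S \<omega> \<le> t} = {\<omega>\<in>space M. S \<omega> \<le> \<tau> \<omega> \<and> S \<omega> \<le> t} \<inter> {\<omega>\<in>space M. S \<omega> < \<infinity>}" by blast
    show ?thesis unfolding eq using le Slt unfolding True by (rule sets.Int)
  next
    case False
    then have tlt: "t < \<infinity>"
      unfolding infinity_ennreal_def by (rule top.not_eq_extremum[THEN iffD1])
    have eq: "{\<omega> \<in> {\<omega>\<in>space M. S \<omega> \<le> \<tau> \<omega> \<and> S \<omega> < \<infinity>}. S \<omega> \<le> t} = {\<omega>\<in>space M. S \<omega> \<le> \<tau> \<omega> \<and> S \<omega> \<le> t}"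
    proof (intro set_eqI iffI)
      fix \<omega> assume w: "\<omega> \<in> {\<omega>\<in>space M. S \<omega> \<le> \<tau> \<omega> \<and> S \<omega> \<le> t}"
      then have "S \<omega> \<le> t" by simp
      then have "S \<omega> < \<infinity>" using tlt by (rule le_less_trans)
      with w show "\<omega> \<in> {\<omega> \<in> {\<omega>\<in>space M. S \<omega> \<le> \<tau> \<omega> \<and> S \<omega> < \<infinity>}. S \<omega> \<le> t}" by simp
    qed simp
    show ?thesis unfolding eq by (rule le)
  qed
qed

lemma pre_sigma_subalgebra:
  assumes S: "stopping_time \<F> S"
  shows "finite_measure_subalgebra M (pre_sigma S)"
proof -
  have "A \<in> sets M" if A: "A \<in> sets (pre_sigma S)" for A
  proof -
    have "{\<omega>\<in>A. S \<omega> \<le> \<top>} \<in> sets (\<F> \<top>)" by (rule sets_pre_sigmaD[OF S A])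
    then have "A \<in> sets (\<F> \<top>)" by simp
    then show ?thesis by (rule subsetD[OF sets_F_subset])
  qed
  then have "subalgebra M (pre_sigma S)"
    unfolding subalgebra_def using space_pre_sigma by blast
  then show ?thesis
    by (intro finite_measure_subalgebra.intro finite_measure_subalgebra_axioms.intro finite_measure_axioms)
qed

text \<open>Integrating the strong Markov property over an event \<open>A\<close> known at time \<open>S\<close> turns a uniform bound on the
transition laws into a bound on the joint probability.\<close>

lemma strong_markov_bound:
  assumes X: "continuous_adapted M \<F> X" and sm: "strong_markov P M \<F> X"
    and S: "stopping_time \<F> S" and \<Gamma>: "\<Gamma> \<in> sets path_space" and A: "A \<in> sets (pre_sigma S)"
    and Efin: "\<And>\<omega>. \<omega> \<in> A \<Longrightarrow> S \<omega> < \<infinity>"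
    and E: "{\<omega>\<in>space M. S \<omega> < \<infinity> \<and> path_from X (enn2real (S \<omega>)) \<omega> \<in> \<Gamma>} \<in> sets M"
  shows "AE \<omega> in M. \<omega> \<in> A \<longrightarrow> measure (P (X (enn2real (S \<omega>)) \<omega>)) \<Gamma> \<le> p \<Longrightarrow>
      measure M {\<omega>\<in>A. path_from X (enn2real (S \<omega>)) \<omega> \<in> \<Gamma>} \<le> p * measure M A"
    and "AE \<omega> in M. \<omega> \<in> A \<longrightarrow> p \<le> measure (P (X (enn2real (S \<omega>)) \<omega>)) \<Gamma> \<Longrightarrow>
      p * measure M A \<le> measure M {\<omega>\<in>A. path_from X (enn2real (S \<omega>)) \<omega> \<in> \<Gamma>}"
proof -
  interpret sub: finite_measure_subalgebra M "pre_sigma S" by (rule pre_sigma_subalgebra[OF S])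
  let ?E = "{\<omega>. S \<omega> < \<infinity> \<and> path_from X (enn2real (S \<omega>)) \<omega> \<in> \<Gamma>}"
  let ?c = "real_cond_exp M (pre_sigma S) (indicator ?E)"
  have AM: "A \<in> sets M" using A sub.subalg by (auto simp: subalgebra_def)
  have AX: "A \<subseteq> space M" using sets.sets_into_space[OF AM] .
  have EI: "?E \<inter> space M \<in> sets M"
  proof -
    have "?E \<inter> space M = {\<omega>\<in>space M. S \<omega> < \<infinity> \<and> path_from X (enn2real (S \<omega>)) \<omega> \<in> \<Gamma>}" by blast
    then show ?thesis using E by simp
  qed
  have i1: "integrable M (indicator ?E :: 'a \<Rightarrow> real)"
    using EI by (subst integrable_indicator_iff) (auto simp: emeasure_eq_measure)
  have ci: "integrable M ?c" by (rule sub.real_cond_exp_int(1)[OF i1])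
  have c1: "(\<integral>\<omega>\<in>A. indicator ?E \<omega> \<partial>M) = (\<integral>\<omega>\<in>A. ?c \<omega> \<partial>M)" by (rule sub.real_cond_exp_intA[OF i1 A])
  have c2: "(\<integral>\<omega>\<in>A. indicator ?E \<omega> \<partial>M) = measure M {\<omega>\<in>A. path_from X (enn2real (S \<omega>)) \<omega> \<in> \<Gamma>}"
  proof -
    have "(\<integral>\<omega>\<in>A. indicator ?E \<omega> \<partial>M) = (\<integral>\<omega>. indicator {\<omega>\<in>A. path_from X (enn2real (S \<omega>)) \<omega> \<in> \<Gamma>} \<omega> \<partial>M)"
      unfolding set_lebesgue_integral_def
      using Efin by (intro Bochner_Integration.integral_cong) (auto simp: indicator_def)
    also have "\<dots> = measure M ({\<omega>\<in>A. path_from X (enn2real (S \<omega>)) \<omega> \<in> \<Gamma>} \<inter> space M)" by simp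
    also have "{\<omega>\<in>A. path_from X (enn2real (S \<omega>)) \<omega> \<in> \<Gamma>} \<inter> space M = {\<omega>\<in>A. path_from X (enn2real (S \<omega>)) \<omega> \<in> \<Gamma>}"
      using AX by auto
    finally show ?thesis .
  qed
  have eq: "measure M {\<omega>\<in>A. path_from X (enn2real (S \<omega>)) \<omega> \<in> \<Gamma>} = (\<integral>\<omega>\<in>A. ?c \<omega> \<partial>M)"
    by (rule trans[OF c2[symmetric] c1])
  have si1: "set_integrable M A ?c"
    unfolding set_integrable_def by (rule integrable_mult_indicator[OF AM ci])
  have si2: "set_integrable M A (\<lambda>_. p)" for p :: real
    unfolding set_integrable_def using integrable_mult_indicator[OF AM, of "\<lambda>_. p"] by simp
  have const: "(\<integral>\<omega>\<in>A. p \<partial>M) = p * measure M A" for p :: real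
    using AM AX by (simp add: set_lebesgue_integral_def Int_absorb2)
  have mk: "AE \<omega> in M. S \<omega> < \<infinity> \<longrightarrow> ?c \<omega> = measure (P (X (enn2real (S \<omega>)) \<omega>)) \<Gamma>"
    by (rule sm[unfolded strong_markov_def, THEN spec, THEN mp, OF S, THEN bspec, OF \<Gamma>])
  show "measure M {\<omega>\<in>A. path_from X (enn2real (S \<omega>)) \<omega> \<in> \<Gamma>} \<le> p * measure M A"
    if "AE \<omega> in M. \<omega> \<in> A \<longrightarrow> measure (P (X (enn2real (S \<omega>)) \<omega>)) \<Gamma> \<le> p" for p
    unfolding eq const[symmetric]
  proof (rule set_integral_mono_AE[OF si1 si2])
    show "AE \<omega>\<in>A in M. ?c \<omega> \<le> p" using mk that by eventually_elim (use Efin in auto)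
  qed
  show "p * measure M A \<le> measure M {\<omega>\<in>A. path_from X (enn2real (S \<omega>)) \<omega> \<in> \<Gamma>}"
    if "AE \<omega> in M. \<omega> \<in> A \<longrightarrow> p \<le> measure (P (X (enn2real (S \<omega>)) \<omega>)) \<Gamma>" for p
    unfolding eq const[symmetric]
  proof (rule set_integral_mono_AE[OF si2 si1])
    show "AE \<omega>\<in>A in M. p \<le> ?c \<omega>" using mk that by eventually_elim (use Efin in auto)
  qed
qed

text \<open>At time 0 the strong Markov property identifies the law of \<open>X\<close> with \<open>P 0\<close>, because \<open>X\<close> starts
at 0 almost surely.\<close>

lemma run_max_law:
  assumes X: "continuous_adapted M \<F> X" and sm: "strong_markov P M \<F> X"
    and X0: "AE \<omega> in M. X 0 \<omega> = 0"
  shows "measure (P 0) {w\<in>space path_space. y \<le> run_max w (ennreal t)}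
    = measure M {\<omega>\<in>space M. y \<le> run_max (\<lambda>s. X s \<omega>) (ennreal t)}"
proof -
  let ?\<Gamma> = "{w\<in>space path_space. y \<le> run_max w (ennreal t)}"
  let ?E = "{\<omega>\<in>space M. y \<le> run_max (\<lambda>s. X s \<omega>) (ennreal t)}"
  have \<Gamma>: "?\<Gamma> \<in> sets path_space" using run_max_path_measurable by measurable
  have path: "path_from X 0 \<omega> \<in> ?\<Gamma> \<longleftrightarrow> y \<le> run_max (\<lambda>s. X s \<omega>) (ennreal t)" if "\<omega> \<in> space M" for \<omega>
  proof -
    have "run_max (path_from X 0 \<omega>) (ennreal t) = run_max (\<lambda>s. X s \<omega>) (ennreal t)"
      by (rule run_max_cong) (simp add: path_from_def)
    then show ?thesis using path_from_in_path_space(1)[OF X that order_refl] by simp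
  qed
  have EM: "?E \<in> sets M"
    using run_max_random_time_measurable[OF X, of "\<lambda>_. ennreal t"] by measurable
  have S: "stopping_time \<F> (\<lambda>_. 0)" by (rule stopping_time_const)
  have EE: "{\<omega>\<in>space M. (0::ennreal) < \<infinity> \<and> path_from X (enn2real 0) \<omega> \<in> ?\<Gamma>} = ?E"
    using path by auto
  have A: "space M \<in> sets (pre_sigma (\<lambda>_. 0))" using sets.top[of "pre_sigma (\<lambda>_. 0)"] by (simp add: space_pre_sigma)
  have ae: "AE \<omega> in M. measure (P (X (enn2real 0) \<omega>)) ?\<Gamma> = measure (P 0) ?\<Gamma>"
    using X0 by eventually_elim simp
  have "measure M {\<omega>\<in>space M. path_from X (enn2real 0) \<omega> \<in> ?\<Gamma>} \<le> measure (P 0) ?\<Gamma> * measure M (space M)"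
    by (rule strong_markov_bound(1)[OF X sm S \<Gamma> A]) (use EE EM ae in auto)
  moreover have "measure (P 0) ?\<Gamma> * measure M (space M) \<le> measure M {\<omega>\<in>space M. path_from X (enn2real 0) \<omega> \<in> ?\<Gamma>}"
    by (rule strong_markov_bound(2)[OF X sm S \<Gamma> A]) (use EE EM ae in auto)
  moreover have "{\<omega>\<in>space M. path_from X (enn2real 0) \<omega> \<in> ?\<Gamma>} = ?E" using path by auto
  ultimately show ?thesis by (simp add: prob_space)
qed

text \<open>If \<open>X\<close> reaches \<open>\<beta>l\<close> before \<open>\<tau> < T\<close>, then the hitting time \<open>S\<close> of \<open>l\<close> is at most \<open>\<tau>\<close>
and the path after \<open>S\<close> reaches \<open>\<beta>l\<close> within time \<open>T\<close>.  At \<open>S\<close> the process is at \<open>l\<close> or \<open>-l\<close>, which is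
why a bound on these two starting points suffices.\<close>

lemma maximum_good_lambda:
  assumes X: "continuous_adapted M \<F> X" and sm: "strong_markov P M \<F> X"
    and X0: "AE \<omega> in M. X 0 \<omega> = 0"
    and \<tau>: "stopping_time \<F> \<tau>" and l: "0 < l" and \<beta>: "1 < \<beta>"
    and p: "\<And>x. \<bar>x\<bar> = l \<Longrightarrow> measure (P x) {w\<in>space path_space. ennreal (\<beta> * l) \<le> run_max w (ennreal T)} \<le> p"
  shows "measure M {\<omega>\<in>space M. ennreal (\<beta> * l) \<le> run_max (\<lambda>t. X t \<omega>) (\<tau> \<omega>) \<and> \<tau> \<omega> < ennreal T}
    \<le> p * measure M {\<omega>\<in>space M. ennreal l \<le> run_max (\<lambda>t. X t \<omega>) (\<tau> \<omega>)}"
proof -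
  define S where "S \<omega> = hit_time (\<lambda>t. X t \<omega>) l" for \<omega>
  define \<Gamma> where "\<Gamma> = {w\<in>space path_space. ennreal (\<beta> * l) \<le> run_max w (ennreal T)}"
  define A where "A = {\<omega>\<in>space M. S \<omega> \<le> \<tau> \<omega> \<and> S \<omega> < \<infinity>}"
  have Xc: "continuous_on {0..} (\<lambda>t. X t \<omega>)" if "\<omega> \<in> space M" for \<omega>
    using X that by (auto simp: continuous_adapted_def)
  have S: "stopping_time \<F> S" unfolding S_def[abs_def] by (rule hit_time_stopping_time[OF X l])
  have [measurable]: "S \<in> borel_measurable M" "\<tau> \<in> borel_measurable M"
    by (rule measurable_stopping_time[OF S sets_F_subset space_F], rule measurable_stopping_time[OF \<tau> sets_F_subset space_F])
  have \<Gamma>: "\<Gamma> \<in> sets path_space" unfolding \<Gamma>_def using run_max_path_measurable by measurable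
  have A: "A \<in> sets (pre_sigma S)" unfolding A_def by (rule stopping_time_le_pre_sigma[OF S \<tau>])
  have AM: "A \<in> sets M" unfolding A_def by measurable
  have p0: "0 \<le> p" using order_trans[OF measure_nonneg p[of l]] l by simp
  have bl: "l \<le> \<beta> * l" "0 < \<beta> * l" using l \<beta> by (auto simp: mult_le_cancel_right1)
  have "(\<lambda>\<omega>. run_max (path_from X (enn2real (S \<omega>)) \<omega>) (ennreal T)) \<in> borel_measurable M"
  proof (rule run_max_measurable)
    show "continuous_on {0..} (\<lambda>s. path_from X (enn2real (S \<omega>)) \<omega> s)" if "\<omega> \<in> space M" for \<omega>
      using path_from_in_path_space(2)[OF X that, of "enn2real (S \<omega>)"] by simp
    show "(\<lambda>\<omega>. path_from X (enn2real (S \<omega>)) \<omega> s) \<in> borel_measurable M" if "0 \<le> s" for s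
      using random_time_value_measurable[OF X, of "\<lambda>\<omega>. enn2real (S \<omega>) + s"] that by (simp add: path_from_def)
  qed
  then have "{\<omega>\<in>space M. S \<omega> < \<infinity> \<and> ennreal (\<beta> * l) \<le> run_max (path_from X (enn2real (S \<omega>)) \<omega>) (ennreal T)} \<in> sets M"
    by measurable
  moreover have "{\<omega>\<in>space M. S \<omega> < \<infinity> \<and> ennreal (\<beta> * l) \<le> run_max (path_from X (enn2real (S \<omega>)) \<omega>) (ennreal T)}
      = {\<omega>\<in>space M. S \<omega> < \<infinity> \<and> path_from X (enn2real (S \<omega>)) \<omega> \<in> \<Gamma>}"
    unfolding \<Gamma>_def using path_from_in_path_space(1)[OF X] by auto
  ultimately have E: "{\<omega>\<in>space M. S \<omega> < \<infinity> \<and> path_from X (enn2real (S \<omega>)) \<omega> \<in> \<Gamma>} \<in> sets M" by simp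
  have ae: "AE \<omega> in M. \<omega> \<in> A \<longrightarrow> measure (P (X (enn2real (S \<omega>)) \<omega>)) \<Gamma> \<le> p"
    using X0 AE_space
  proof eventually_elim
    fix \<omega> assume x0: "X 0 \<omega> = 0" and w: "\<omega> \<in> space M"
    show "\<omega> \<in> A \<longrightarrow> measure (P (X (enn2real (S \<omega>)) \<omega>)) \<Gamma> \<le> p"
    proof
      assume "\<omega> \<in> A"
      then have "hit_time (\<lambda>t. X t \<omega>) l < \<infinity>" by (simp add: A_def S_def)
      then obtain s where s: "0 \<le> s" "hit_time (\<lambda>t. X t \<omega>) l = ennreal s" "l \<le> \<bar>X s \<omega>\<bar>"
        by (rule hit_time_attained[OF Xc[OF w]])
      then have "\<bar>X s \<omega>\<bar> = l" using hit_time_value[OF Xc[OF w] s] x0 l by simp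
      then show "measure (P (X (enn2real (S \<omega>)) \<omega>)) \<Gamma> \<le> p"
        unfolding \<Gamma>_def using p s by (simp add: S_def)
    qed
  qed
  have "measure M {\<omega>\<in>space M. ennreal (\<beta> * l) \<le> run_max (\<lambda>t. X t \<omega>) (\<tau> \<omega>) \<and> \<tau> \<omega> < ennreal T}
     \<le> measure M {\<omega>\<in>A. path_from X (enn2real (S \<omega>)) \<omega> \<in> \<Gamma>}"
  proof (rule finite_measure_mono)
    have "{\<omega>\<in>A. path_from X (enn2real (S \<omega>)) \<omega> \<in> \<Gamma>} = A \<inter> {\<omega>\<in>space M. S \<omega> < \<infinity> \<and> path_from X (enn2real (S \<omega>)) \<omega> \<in> \<Gamma>}"
      by (auto simp: A_def)
    then show "{\<omega>\<in>A. path_from X (enn2real (S \<omega>)) \<omega> \<in> \<Gamma>} \<in> sets M" using AM E by auto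
    show "{\<omega>\<in>space M. ennreal (\<beta> * l) \<le> run_max (\<lambda>t. X t \<omega>) (\<tau> \<omega>) \<and> \<tau> \<omega> < ennreal T}
      \<subseteq> {\<omega>\<in>A. path_from X (enn2real (S \<omega>)) \<omega> \<in> \<Gamma>}"
    proof
      fix \<omega> assume "\<omega> \<in> {\<omega>\<in>space M. ennreal (\<beta> * l) \<le> run_max (\<lambda>t. X t \<omega>) (\<tau> \<omega>) \<and> \<tau> \<omega> < ennreal T}"
      then have w: "\<omega> \<in> space M" and rm: "ennreal (\<beta> * l) \<le> run_max (\<lambda>t. X t \<omega>) (\<tau> \<omega>)" and lt: "\<tau> \<omega> < ennreal T" by auto
      obtain u where u: "\<tau> \<omega> = ennreal u" "0 \<le> u" using lt by (cases "\<tau> \<omega>") auto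
      have uT: "u < T" using lt u by (simp add: ennreal_less_iff)
      obtain r where r: "0 \<le> r" "r \<le> u" "\<beta> * l \<le> \<bar>X r \<omega>\<bar>"
        using run_max_ge_iff[OF Xc[OF w] bl(2) u(2)] rm u by auto
      have Sr: "S \<omega> \<le> ennreal r" unfolding S_def using r bl by (intro hit_time_lower) auto
      then have fin: "S \<omega> < \<infinity>" by (rule le_less_trans) simp
      then obtain s where s: "0 \<le> s" "S \<omega> = ennreal s"
        using hit_time_attained[OF Xc[OF w], of l] unfolding S_def by metis
      have sr: "s \<le> r" using Sr s r by (simp add: ennreal_le_iff)
      have "S \<omega> \<le> \<tau> \<omega>" using Sr r u by (auto intro: order_trans ennreal_leI)
      then have wA: "\<omega> \<in> A" using w fin by (simp add: A_def)
      have "ennreal (\<beta> * l) \<le> ennreal \<bar>path_from X s \<omega> (r - s)\<bar>"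
        using r sr by (intro ennreal_leI) (simp add: path_from_def)
      also have "\<dots> \<le> run_max (path_from X s \<omega>) (ennreal T)"
        using sr r s uT by (intro run_max_upper ennreal_leI) auto
      finally have "path_from X s \<omega> \<in> \<Gamma>"
        unfolding \<Gamma>_def using path_from_in_path_space(1)[OF X w s(1)] by simp
      then show "\<omega> \<in> {\<omega>\<in>A. path_from X (enn2real (S \<omega>)) \<omega> \<in> \<Gamma>}" using wA s by simp
    qed
  qed
  also have "\<dots> \<le> p * measure M A"
    by (rule strong_markov_bound(1)[OF X sm S \<Gamma> A _ E ae]) (simp add: A_def)
  also have "measure M A \<le> measure M {\<omega>\<in>space M. ennreal l \<le> run_max (\<lambda>t. X t \<omega>) (\<tau> \<omega>)}"
  proof (rule finite_measure_mono)
    show "{\<omega>\<in>space M. ennreal l \<le> run_max (\<lambda>t. X t \<omega>) (\<tau> \<omega>)} \<in> sets M"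
      using run_max_random_time_measurable[OF X, of \<tau>] by measurable
    show "A \<subseteq> {\<omega>\<in>space M. ennreal l \<le> run_max (\<lambda>t. X t \<omega>) (\<tau> \<omega>)}"
    proof
      fix \<omega> assume wA: "\<omega> \<in> A"
      then have w: "\<omega> \<in> space M" and "hit_time (\<lambda>t. X t \<omega>) l < \<infinity>" by (auto simp: A_def S_def)
      then obtain s where s: "0 \<le> s" "hit_time (\<lambda>t. X t \<omega>) l = ennreal s" "l \<le> \<bar>X s \<omega>\<bar>"
        by (metis hit_time_attained[OF Xc[OF w]])
      have "ennreal l \<le> ennreal \<bar>X s \<omega>\<bar>" using s by (intro ennreal_leI)
      also have "\<dots> \<le> run_max (\<lambda>t. X t \<omega>) (\<tau> \<omega>)"
        using s wA by (intro run_max_upper) (auto simp: A_def S_def)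
      finally show "\<omega> \<in> {\<omega>\<in>space M. ennreal l \<le> run_max (\<lambda>t. X t \<omega>) (\<tau> \<omega>)}" using w by simp
    qed
  qed
  finally show ?thesis by (simp add: p0 mult_left_mono)
qed

lemma maximum_tail:
  assumes X: "continuous_adapted M \<F> X" and q: "0 < q" and y: "0 < y" and t: "0 \<le> t" and v: "0 \<le> v"
    and moment: "(\<integral>\<^sup>+ \<omega>. at_ext (\<lambda>x. x powr q) (run_max (\<lambda>s. X s \<omega>) (ennreal t)) \<partial>M) \<le> ennreal v"
  shows "measure M {\<omega>\<in>space M. ennreal y \<le> run_max (\<lambda>s. X s \<omega>) (ennreal t)} \<le> v / y powr q"
proof -
  let ?E = "{\<omega>\<in>space M. ennreal y \<le> run_max (\<lambda>s. X s \<omega>) (ennreal t)}"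
  have EM: "?E \<in> sets M" using run_max_random_time_measurable[OF X, of "\<lambda>_. ennreal t"] by measurable
  have mono: "mono_on {0..} (\<lambda>x::real. x powr q)" using q by (auto simp: mono_on_def intro!: powr_mono2)
  have "(\<integral>\<^sup>+ \<omega>. ennreal (y powr q) * indicator ?E \<omega> \<partial>M) \<le> (\<integral>\<^sup>+ \<omega>. at_ext (\<lambda>x. x powr q) (run_max (\<lambda>s. X s \<omega>) (ennreal t)) \<partial>M)"
  proof (rule nn_integral_mono)
    fix \<omega>
    show "ennreal (y powr q) * indicator ?E \<omega> \<le> at_ext (\<lambda>x. x powr q) (run_max (\<lambda>s. X s \<omega>) (ennreal t))"
      using at_ext_mono[OF mono, of "ennreal y" "run_max (\<lambda>s. X s \<omega>) (ennreal t)"] y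
      by (cases "\<omega> \<in> ?E") (auto simp: at_ext_real)
  qed
  also have "\<dots> \<le> ennreal v" by (rule moment)
  finally have "ennreal (y powr q) * emeasure M ?E \<le> ennreal v"
    using EM by (simp add: nn_integral_cmult_indicator)
  then have "y powr q * measure M ?E \<le> v"
    using v by (simp add: emeasure_eq_measure ennreal_mult[symmetric])
  then show ?thesis using y by (simp add: field_simps)
qed

end

section \<open>The maximum dominated by the clock\<close>

text \<open>The function \<open>g\<close> is the clock that measures time in units of space; its inverse converts a level
into the time at which the clock shows that level.\<close>

locale scale_function =
  fixes g :: "real \<Rightarrow> real"
  assumes maps: "g ` {0..} = {0..}" and strict: "strict_mono_on {0..} g"

begin

definition "time_of = the_inv_into {0..} g"

lemma inj_on_clock: "inj_on g {0..}"
  using strict by (rule strict_mono_on_imp_inj_on)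

lemma g_time_of: "0 \<le> y \<Longrightarrow> g (time_of y) = y"
  unfolding time_of_def using maps by (intro f_the_inv_into_f inj_on_clock) auto

lemma time_of_nonneg: "0 \<le> y \<Longrightarrow> 0 \<le> time_of y"
  using the_inv_into_into[OF inj_on_clock, of y "{0..}"] maps unfolding time_of_def by auto

lemma g_less_iff: "0 \<le> x \<Longrightarrow> 0 \<le> y \<Longrightarrow> g x < g y \<longleftrightarrow> x < y"
  using strict unfolding strict_mono_on_def by (metis atLeast_iff less_asym not_less_iff_gr_or_eq)

lemma time_of_less: "0 \<le> x \<Longrightarrow> x < y \<Longrightarrow> time_of x < time_of y"
  using g_less_iff[of "time_of x" "time_of y"] time_of_nonneg g_time_of by simp

lemma at_ext_ge_iff:
  assumes y: "0 \<le> y"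
  shows "ennreal y \<le> at_ext g z \<longleftrightarrow> ennreal (time_of y) \<le> z"
proof (cases z)
  case (real x)
  have "g x < y \<longleftrightarrow> x < time_of y" using g_less_iff[of x "time_of y"] real time_of_nonneg[OF y] g_time_of[OF y] by simp
  then have le: "y \<le> g x \<longleftrightarrow> time_of y \<le> x" by linarith
  have gx: "0 \<le> g x" using maps real by auto
  have "ennreal y \<le> ennreal (g x) \<longleftrightarrow> ennreal (time_of y) \<le> ennreal x"
    unfolding ennreal_le_iff[OF gx] ennreal_le_iff[OF real(1)] by (rule le)
  then show ?thesis using real by (simp only: at_ext_real)
next
  case top
  have "ennreal y \<le> at_ext g \<infinity>"
    unfolding at_ext_def if_True simp_thms using g_time_of[OF y] time_of_nonneg[OF y]
    by (intro SUP_upper2[of "time_of y"]) auto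
  then show ?thesis using top by simp
qed

lemma at_ext_less_iff: "0 \<le> y \<Longrightarrow> at_ext g z < ennreal y \<longleftrightarrow> z < ennreal (time_of y)"
  using at_ext_ge_iff[of y z] by (simp only: not_le[symmetric])

end

context filtered_prob_space begin

text \<open>The number \<open>\<delta>\<close> solves \<open>C K (\<delta>/\<gamma>)\<^sup>q = \<epsilon>\<close>, where the left-hand side is the bound that
controllability and Markov's inequality give for the probability of reaching \<open>\<beta>l\<close> from \<open>\<plusminus>l\<close> within the
time at which the clock shows \<open>\<delta>l\<close>.\<close>

lemma controllable_maximum_good_lambda:
  assumes X: "continuous_adapted M \<F> X" and sm: "strong_markov P M \<F> X"
    and X0: "AE \<omega> in M. X 0 \<omega> = 0" and P1: "\<And>x. prob_space (P x)"
    and ctrl: "controllable P"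
    and scale: "scale_function g"
    and moment: "\<exists>q>0. \<exists>K>0. \<forall>t\<ge>0.
      (\<integral>\<^sup>+ \<omega>. at_ext (\<lambda>x. x powr q) (run_max (\<lambda>s. X s \<omega>) (ennreal t)) \<partial>M) \<le> ennreal (K * g t powr q)"
  obtains \<beta> where "1 < \<beta>" "\<And>\<epsilon>. 0 < \<epsilon> \<Longrightarrow> \<exists>\<delta>>0. \<forall>\<tau> l. stopping_time \<F> \<tau> \<longrightarrow> 0 < l \<longrightarrow>
    measure M {\<omega>\<in>space M. ennreal (\<beta> * l) \<le> run_max (\<lambda>s. X s \<omega>) (\<tau> \<omega>) \<and> at_ext g (\<tau> \<omega>) < ennreal (\<delta> * l)}
      \<le> \<epsilon> * measure M {\<omega>\<in>space M. ennreal l \<le> run_max (\<lambda>s. X s \<omega>) (\<tau> \<omega>)}"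
proof -
  interpret g: scale_function g by fact
  obtain \<gamma> C \<beta> where c: "0 < \<gamma>" "0 < C" "1 < \<beta>"
    and ctrl': "\<And>t l. 0 \<le> t \<Longrightarrow> 0 < l \<Longrightarrow>
        (SUP x\<in>{x. \<bar>x\<bar> = l}. measure (P x) {w\<in>space path_space. run_max w (ennreal t) \<ge> ennreal (\<beta> * l)})
        \<le> C * measure (P 0) {w\<in>space path_space. run_max w (ennreal t) \<ge> ennreal (\<gamma> * l)}"
    using ctrl unfolding controllable_def by blast
  obtain q K where q: "0 < q" "0 < K" and mom: "\<And>t. 0 \<le> t \<Longrightarrow>
      (\<integral>\<^sup>+ \<omega>. at_ext (\<lambda>x. x powr q) (run_max (\<lambda>s. X s \<omega>) (ennreal t)) \<partial>M) \<le> ennreal (K * g t powr q)"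
    using moment by blast
  show thesis
  proof (rule that[OF c(3)])
    fix \<epsilon> :: real assume e: "0 < \<epsilon>"
    define \<delta> where "\<delta> = \<gamma> * (\<epsilon> / (C * K)) powr (1 / q)"
    have d: "0 < \<delta>" using c q e by (simp add: \<delta>_def)
    have "(\<delta> / \<gamma>) powr q = \<epsilon> / (C * K)" using c q e by (simp add: \<delta>_def powr_powr)
    then have d_eq: "C * (K * (\<delta> / \<gamma>) powr q) = \<epsilon>" using c q by simp
    show "\<exists>\<delta>>0. \<forall>\<tau> l. stopping_time \<F> \<tau> \<longrightarrow> 0 < l \<longrightarrow>
      measure M {\<omega>\<in>space M. ennreal (\<beta> * l) \<le> run_max (\<lambda>s. X s \<omega>) (\<tau> \<omega>) \<and> at_ext g (\<tau> \<omega>) < ennreal (\<delta> * l)}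
      \<le> \<epsilon> * measure M {\<omega>\<in>space M. ennreal l \<le> run_max (\<lambda>s. X s \<omega>) (\<tau> \<omega>)}"
    proof (intro exI[of _ \<delta>] conjI d allI impI)
      fix \<tau> and l :: real assume \<tau>: "stopping_time \<F> \<tau>" and l: "0 < l"
      define T where "T = g.time_of (\<delta> * l)"
      have dl: "0 \<le> \<delta> * l" using d l by simp
      have T0: "0 \<le> T" unfolding T_def by (rule g.time_of_nonneg[OF dl])
      have gT: "g T = \<delta> * l" unfolding T_def by (rule g.g_time_of[OF dl])
      have "measure M {\<omega>\<in>space M. ennreal (\<gamma> * l) \<le> run_max (\<lambda>s. X s \<omega>) (ennreal T)} \<le> (K * g T powr q) / (\<gamma> * l) powr q"
        using c l q by (intro maximum_tail[OF X q(1) _ T0 _ mom[OF T0]]) auto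
      also have "\<dots> = K * (\<delta> / \<gamma>) powr q"
        using c l d by (simp add: gT powr_mult powr_divide)
      finally have tail: "C * measure M {\<omega>\<in>space M. ennreal (\<gamma> * l) \<le> run_max (\<lambda>s. X s \<omega>) (ennreal T)} \<le> \<epsilon>"
        using c d_eq by (metis mult_le_cancel_left_pos)
      have p: "measure (P x) {w\<in>space path_space. ennreal (\<beta> * l) \<le> run_max w (ennreal T)} \<le> \<epsilon>" if x: "\<bar>x\<bar> = l" for x
      proof -
        have "measure (P x) {w\<in>space path_space. ennreal (\<beta> * l) \<le> run_max w (ennreal T)}
          \<le> (SUP x\<in>{x. \<bar>x\<bar> = l}. measure (P x) {w\<in>space path_space. run_max w (ennreal T) \<ge> ennreal (\<beta> * l)})"
          using x by (intro cSUP_upper bdd_aboveI2[of _ _ 1] prob_space.prob_le_1[OF P1]) auto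
        also have "\<dots> \<le> C * measure (P 0) {w\<in>space path_space. run_max w (ennreal T) \<ge> ennreal (\<gamma> * l)}"
          by (rule ctrl'[OF T0 l])
        also have "\<dots> = C * measure M {\<omega>\<in>space M. ennreal (\<gamma> * l) \<le> run_max (\<lambda>s. X s \<omega>) (ennreal T)}"
          by (simp only: run_max_law[OF X sm X0])
        also have "\<dots> \<le> \<epsilon>" by (rule tail)
        finally show ?thesis .
      qed
      show "measure M {\<omega>\<in>space M. ennreal (\<beta> * l) \<le> run_max (\<lambda>s. X s \<omega>) (\<tau> \<omega>) \<and> at_ext g (\<tau> \<omega>) < ennreal (\<delta> * l)}
        \<le> \<epsilon> * measure M {\<omega>\<in>space M. ennreal l \<le> run_max (\<lambda>s. X s \<omega>) (\<tau> \<omega>)}"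
        unfolding g.at_ext_less_iff[OF dl] T_def[symmetric]
        by (rule maximum_good_lambda[OF X sm X0 \<tau> l c(3) p])
    qed
  qed
qed

end

section \<open>Moments of elementary stochastic integrals\<close>

lemma Int_stable_preimages: "Int_stable {h -` A \<inter> \<Omega> | A. A \<in> sets N}"
  unfolding Int_stable_def
proof safe
  fix A C assume "A \<in> sets N" "C \<in> sets N"
  then show "\<exists>D. h -` A \<inter> \<Omega> \<inter> (h -` C \<inter> \<Omega>) = h -` D \<inter> \<Omega> \<and> D \<in> sets N"
    by (intro exI[of _ "A \<inter> C"]) auto
qed

text \<open>The terms are added only as long as the running total, including the current term, does not exceed
\<open>\<eta>\<close>.  Because the test looks at the current term but at no later one, it is predictable when the terms are
the contributions of an integrand that is constant on each interval.\<close>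

lemma sum_stopped_le:
  fixes a :: "nat \<Rightarrow> real"
  assumes "\<And>i. 0 \<le> a i" "0 \<le> \<eta>"
  shows "(\<Sum>i<m. if (\<Sum>l\<le>i. a l) \<le> \<eta> then a i else 0) \<le> \<eta>"
proof -
  have "(\<Sum>i<m. if (\<Sum>l\<le>i. a l) \<le> \<eta> then a i else 0) \<le> min \<eta> (\<Sum>l<m. a l)"
  proof (induction m)
    case 0
    then show ?case using assms by simp
  next
    case (Suc m)
    have "(\<Sum>l\<le>m. a l) = (\<Sum>l<m. a l) + a m"
      by (simp add: lessThan_Suc_atMost[symmetric])
    then show ?case using Suc assms(1)[of m] by auto
  qed
  then show ?thesis by simp
qed

lemma integral_add5:
  fixes a0 a1 a2 a3 a4 :: "'b \<Rightarrow> real"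
  assumes "integrable N a0" "integrable N a1" "integrable N a2" "integrable N a3" "integrable N a4"
  shows "(\<integral>x. a0 x + (p * a1 x + (q * a2 x + (r * a3 x + a4 x))) \<partial>N)
    = integral\<^sup>L N a0 + (p * integral\<^sup>L N a1 + (q * integral\<^sup>L N a2 + (r * integral\<^sup>L N a3 + integral\<^sup>L N a4)))"
  using assms by simp

lemma integral_add3:
  fixes a0 a1 a2 :: "'b \<Rightarrow> real"
  assumes "integrable N a0" "integrable N a1" "integrable N a2"
  shows "(\<integral>x. a0 x + (p * a1 x + a2 x) \<partial>N)
    = integral\<^sup>L N a0 + (p * integral\<^sup>L N a1 + integral\<^sup>L N a2)"
  using assms by simp

locale brownian_filtration = filtered_prob_space M \<F>
  for M :: "'a measure" and \<F> :: "ennreal \<Rightarrow> 'a measure" +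
  fixes B :: "real \<Rightarrow> 'a \<Rightarrow> real"
  assumes bm: "brownian_motion M \<F> B"

begin

lemma B_measurable: "0 \<le> t \<Longrightarrow> B t \<in> borel_measurable (\<F> (ennreal t))"
  using bm by (auto simp: brownian_motion_def continuous_adapted_def)

lemma increment_indep_var:
  assumes st: "0 \<le> s" "s < t" and h: "h \<in> borel_measurable (\<F> (ennreal s))"
  shows "indep_var borel h borel (\<lambda>\<omega>. B t \<omega> - B s \<omega>)"
proof -
  let ?D = "\<lambda>\<omega>. B t \<omega> - B s \<omega>"
  let ?I = "{?D -` A \<inter> space M | A. A \<in> sets borel}"
  let ?H = "{h -` A \<inter> space M | A. A \<in> sets borel}"
  have indep: "indep_set (sets (\<F> (ennreal s))) ?I"
    using bm st by (auto simp: brownian_motion_def)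
  have "B t \<in> borel_measurable M" "B s \<in> borel_measurable M"
    using st by (auto intro!: measurable_F_M[OF B_measurable])
  then have D: "?D \<in> borel_measurable M" by measurable
  have sub: "?H \<subseteq> sets (\<F> (ennreal s))"
    using h space_F[of "ennreal s"] by (auto simp: measurable_def)
  have "indep_set ?H ?I"
  proof (rule indep_setI)
    show "?H \<subseteq> events" using sub sets_F_subset by blast
    show "?I \<subseteq> events" using D by (auto simp: measurable_def)
    fix a b assume "a \<in> ?H" "b \<in> ?I"
    then show "prob (a \<inter> b) = prob a * prob b"
      using sub by (intro indep_setD[OF indep]) auto
  qed
  moreover have "Int_stable ?H" "Int_stable ?I"
    by (rule Int_stable_preimages)+
  ultimately have "indep_set (sigma_sets (space M) ?H) (sigma_sets (space M) ?I)"
    by (intro indep_set_sigma_sets)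
  then show ?thesis
    unfolding indep_var_eq using measurable_F_M[OF h] D by auto
qed

text \<open>The four moments of a Gaussian increment that is independent of the past; the vanishing of the odd
ones removes the cross terms in the moment recursion below.\<close>

lemma increment_moments:
  assumes st: "0 \<le> s" "s \<le> t" and h: "h \<in> borel_measurable (\<F> (ennreal s))" "integrable M h"
  shows "integrable M (\<lambda>\<omega>. h \<omega> * (B t \<omega> - B s \<omega>) ^ k)" (is ?int)
    and "(\<integral>\<omega>. h \<omega> * (B t \<omega> - B s \<omega>) \<partial>M) = 0" (is ?m1)
    and "(\<integral>\<omega>. h \<omega> * (B t \<omega> - B s \<omega>)^2 \<partial>M) = (t - s) * (\<integral>\<omega>. h \<omega> \<partial>M)" (is ?m2)
    and "(\<integral>\<omega>. h \<omega> * (B t \<omega> - B s \<omega>)^3 \<partial>M) = 0" (is ?m3)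
    and "(\<integral>\<omega>. h \<omega> * (B t \<omega> - B s \<omega>)^4 \<partial>M) = 3 * (t - s)^2 * (\<integral>\<omega>. h \<omega> \<partial>M)" (is ?m4)
proof -
  have "?int \<and> ?m1 \<and> ?m2 \<and> ?m3 \<and> ?m4"
  proof (cases "s = t")
    case True
    then show ?thesis using h by (cases k) auto
  next
    case False
    then have lt: "s < t" using st by auto
    let ?D = "\<lambda>\<omega>. B t \<omega> - B s \<omega>"
    let ?n = "normal_density 0 (sqrt (t - s))"
    have pos: "0 < sqrt (t - s)" using lt by simp
    have dist: "distributed M lborel ?D (\<lambda>x. ennreal (?n x))"
      using bm st lt by (auto simp: brownian_motion_def)
    have iv: "indep_var borel h borel ?D"
      by (rule increment_indep_var[OF st(1) lt h(1)])
    have ivk: "indep_var borel h borel (\<lambda>\<omega>. ?D \<omega> ^ k)" for k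
      using indep_var_compose[OF iv, of "\<lambda>x. x" borel "\<lambda>x. x ^ k" borel] by (simp add: comp_def)
    have ik: "integrable M (\<lambda>\<omega>. ?D \<omega> ^ k)" for k
      using integrable_normal_moment[OF pos, of 0 k]
      by (subst distributed_integrable[OF dist, symmetric]) auto
    have Ek: "(\<integral>\<omega>. ?D \<omega> ^ k \<partial>M) = (\<integral>x. ?n x * x ^ k \<partial>lborel)" for k
      by (subst distributed_integral[OF dist, symmetric]) auto
    have mult: "(\<integral>\<omega>. h \<omega> * ?D \<omega> ^ k \<partial>M) = (\<integral>\<omega>. h \<omega> \<partial>M) * (\<integral>x. ?n x * x ^ k \<partial>lborel)" for k
      using indep_var_lebesgue_integral[OF ivk h(2) ik] Ek by simp
    have n1: "(\<integral>x. ?n x * x ^ 1 \<partial>lborel) = 0"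
      using integral_normal_moment_odd[OF pos, of 0 0] by simp
    have n3: "(\<integral>x. ?n x * x ^ 3 \<partial>lborel) = 0"
      using integral_normal_moment_odd[OF pos, of 0 1] by (simp add: eval_nat_numeral)
    have n2: "(\<integral>x. ?n x * x ^ 2 \<partial>lborel) = t - s"
      using integral_normal_moment_even[OF pos, of 0 1] lt by simp
    have n4: "(\<integral>x. ?n x * x ^ 4 \<partial>lborel) = 3 * (t - s)^2"
      using integral_normal_moment_even[OF pos, of 0 2] lt
      by (simp add: fact_numeral power_divide)
    have ?int by (rule indep_var_integrable[OF ivk h(2) ik])
    moreover have ?m1 using mult[of 1] n1 by simp
    moreover have ?m2 using mult[of 2] n2 by simp
    moreover have ?m3 using mult[of 3] n3 by simp
    moreover have ?m4 using mult[of 4] n4 by simp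
    ultimately show ?thesis by blast
  qed
  then show ?int ?m1 ?m2 ?m3 ?m4 by blast+
qed

lemma integrable_bounded_mult_power:
  fixes h S :: "'a \<Rightarrow> real"
  assumes h: "h \<in> borel_measurable M" "\<And>\<omega>. \<omega> \<in> space M \<Longrightarrow> \<bar>h \<omega>\<bar> \<le> K"
    and S: "S \<in> borel_measurable M" "integrable M (\<lambda>\<omega>. S \<omega> ^ 4)" and j: "j \<le> 4"
  shows "integrable M (\<lambda>\<omega>. h \<omega> * S \<omega> ^ j)"
proof (rule Bochner_Integration.integrable_bound)
  show "integrable M (\<lambda>\<omega>. K * (1 + S \<omega> ^ 4))" using S(2) by auto
  show "(\<lambda>\<omega>. h \<omega> * S \<omega> ^ j) \<in> borel_measurable M" using h S by measurable
  have *: "\<bar>x\<bar> ^ j \<le> 1 + x ^ 4" for x :: real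
  proof (cases "\<bar>x\<bar> \<le> 1")
    case True
    then have "\<bar>x\<bar> ^ j \<le> 1" by (simp add: power_le_one)
    then show ?thesis by (simp add: add_increasing2)
  next
    case False
    then have "\<bar>x\<bar> ^ j \<le> \<bar>x\<bar> ^ 4" using j by (intro power_increasing) auto
    then show ?thesis by simp
  qed
  show "AE \<omega> in M. norm (h \<omega> * S \<omega> ^ j) \<le> norm (K * (1 + S \<omega> ^ 4))"
  proof (rule AE_I2)
    fix \<omega> assume w: "\<omega> \<in> space M"
    have K: "0 \<le> K" using h(2)[OF w] by simp
    have "\<bar>h \<omega>\<bar> * \<bar>S \<omega>\<bar> ^ j \<le> K * (1 + S \<omega> ^ 4)"
      using h(2)[OF w] *[of "S \<omega>"] K by (intro mult_mono) auto
    also have "\<dots> \<le> \<bar>K * (1 + S \<omega> ^ 4)\<bar>" by simp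
    finally show "norm (h \<omega> * S \<omega> ^ j) \<le> norm (K * (1 + S \<omega> ^ 4))"
      by (simp add: abs_mult power_abs)
  qed
qed

text \<open>The elementary stochastic integral over the whole time range, without a cut-off time.\<close>

definition transform_sum :: "(nat \<Rightarrow> real) \<Rightarrow> (nat \<Rightarrow> 'a \<Rightarrow> real) \<Rightarrow> nat \<Rightarrow> 'a \<Rightarrow> real" where
  "transform_sum T \<xi> k \<omega> = (\<Sum>i<k. \<xi> i \<omega> * (B (T (Suc i)) \<omega> - B (T i) \<omega>))"

text \<open>By induction over the steps.  The fourth moment satisfies
\<open>E(S + \<xi>\<Delta>)\<^sup>4 = E S\<^sup>4 + 6 E(S\<^sup>2\<xi>\<^sup>2)d + 3 E(\<xi>\<^sup>4)d\<^sup>2\<close> for a step of length \<open>d\<close>, and with \<open>|\<xi>| \<le> c\<close> the bound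
\<open>3c\<^sup>4(a\<^sup>2 + 2ad + d\<^sup>2)\<close> with elapsed time \<open>a\<close> is a perfect square.\<close>

lemma transform_sum_moments:
  assumes T: "0 \<le> T 0" "\<And>i. i < m \<Longrightarrow> T i \<le> T (Suc i)"
    and \<xi>: "\<And>i. i < m \<Longrightarrow> \<xi> i \<in> borel_measurable (\<F> (ennreal (T i)))"
    and bd: "\<And>i \<omega>. i < m \<Longrightarrow> \<omega> \<in> space M \<Longrightarrow> \<bar>\<xi> i \<omega>\<bar> \<le> c" and c: "0 \<le> c"
    and k: "k \<le> m"
  shows "transform_sum T \<xi> k \<in> borel_measurable (\<F> (ennreal (T k)))" (is ?A)
    and "integrable M (\<lambda>\<omega>. transform_sum T \<xi> k \<omega> ^ 4)" (is ?I)
    and "(\<integral>\<omega>. transform_sum T \<xi> k \<omega> ^ 4 \<partial>M) \<le> 3 * c ^ 4 * (T k - T 0)\<^sup>2" (is ?F)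
    and "\<And>h K. h \<in> borel_measurable (\<F> (ennreal (T 0))) \<Longrightarrow>
        (\<And>\<omega>. \<omega> \<in> space M \<Longrightarrow> \<bar>h \<omega>\<bar> \<le> K) \<Longrightarrow>
        (\<integral>\<omega>. h \<omega> * transform_sum T \<xi> k \<omega> \<partial>M) = 0 \<and>
        (\<integral>\<omega>. h \<omega> * (transform_sum T \<xi> k \<omega>)\<^sup>2 \<partial>M)
          = (\<integral>\<omega>. h \<omega> * (\<Sum>i<k. (\<xi> i \<omega>)\<^sup>2 * (T (Suc i) - T i)) \<partial>M)"
proof -
  let ?S = "transform_sum T \<xi>"
  let ?P = "\<lambda>k h K. h \<in> borel_measurable (\<F> (ennreal (T 0))) \<longrightarrow>
        (\<forall>\<omega>\<in>space M. \<bar>h \<omega>\<bar> \<le> K) \<longrightarrow>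
        (\<integral>\<omega>. h \<omega> * ?S k \<omega> \<partial>M) = 0 \<and>
        (\<integral>\<omega>. h \<omega> * (?S k \<omega>)\<^sup>2 \<partial>M) = (\<integral>\<omega>. h \<omega> * (\<Sum>i<k. (\<xi> i \<omega>)\<^sup>2 * (T (Suc i) - T i)) \<partial>M)"
  have T0: "0 \<le> T i \<and> T 0 \<le> T i" if "i \<le> m" for i
    using that by (induction i) (use T in \<open>auto intro: order_trans\<close>)
  have "?A \<and> ?I \<and> ?F \<and> (\<forall>h K. ?P k h K)"
    using k
  proof (induction k)
    case 0
    then show ?case by (simp add: transform_sum_def)
  next
    case (Suc k)
    then have km: "k < m" "k \<le> m" by auto
    from Suc.IH[OF km(2)] have A: "?S k \<in> borel_measurable (\<F> (ennreal (T k)))"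
      and I: "integrable M (\<lambda>\<omega>. ?S k \<omega> ^ 4)"
      and F: "(\<integral>\<omega>. ?S k \<omega> ^ 4 \<partial>M) \<le> 3 * c ^ 4 * (T k - T 0)\<^sup>2"
      and P: "\<And>h K. ?P k h K" by blast+
    let ?D = "\<lambda>\<omega>. B (T (Suc k)) \<omega> - B (T k) \<omega>"
    let ?d = "T (Suc k) - T k"
    note [measurable] = A \<xi>[OF km(1)]
    have AM[measurable]: "?S k \<in> borel_measurable M" "\<xi> k \<in> borel_measurable M"
      using measurable_F_M A \<xi>[OF km(1)] by blast+
    have S_Suc: "?S (Suc k) \<omega> = ?S k \<omega> + \<xi> k \<omega> * ?D \<omega>" for \<omega>
      by (simp add: transform_sum_def)
    have T_le: "0 \<le> T k" "T k \<le> T (Suc k)" using T0[of k] km T(2)[of k] by auto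
    have B1: "B (T k) \<in> borel_measurable (\<F> (ennreal (T k)))"
      "B (T (Suc k)) \<in> borel_measurable (\<F> (ennreal (T (Suc k))))"
      using T_le by (auto intro!: B_measurable)
    have up: "h \<in> borel_measurable (\<F> (ennreal (T (Suc k))))" if "h \<in> borel_measurable (\<F> (ennreal (T k)))" for h
      using measurable_F_mono[OF that] T_le by (simp add: ennreal_leI)
    have A': "?S (Suc k) \<in> borel_measurable (\<F> (ennreal (T (Suc k))))"
      unfolding S_Suc[abs_def] using up[OF A] up[OF \<xi>[OF km(1)]] up[OF B1(1)] B1(2) by measurable
    note mom = increment_moments[OF T_le]
    have xi_pow: "\<bar>\<xi> k \<omega> ^ j\<bar> \<le> c ^ j" if "\<omega> \<in> space M" for \<omega> j
      using bd[OF km(1) that] by (simp add: power_abs power_mono)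
    have int: "integrable M (\<lambda>\<omega>. \<xi> k \<omega> ^ j * ?S k \<omega> ^ i)" if "i \<le> 4" for i j
      by (rule integrable_bounded_mult_power[OF _ xi_pow AM(1) I that]) auto
    have meas: "(\<lambda>\<omega>. \<xi> k \<omega> ^ j * ?S k \<omega> ^ i) \<in> borel_measurable (\<F> (ennreal (T k)))" for i j
      by measurable
    note m' = mom[OF meas int]
    have eq4: "?S (Suc k) \<omega> ^ 4 = ?S k \<omega> ^ 4 + (4 * ((\<xi> k \<omega> ^ 1 * ?S k \<omega> ^ 3) * ?D \<omega> ^ 1) +
       (6 * ((\<xi> k \<omega> ^ 2 * ?S k \<omega> ^ 2) * ?D \<omega> ^ 2) + (4 * ((\<xi> k \<omega> ^ 3 * ?S k \<omega> ^ 1) * ?D \<omega> ^ 3) +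
       (\<xi> k \<omega> ^ 4 * ?S k \<omega> ^ 0) * ?D \<omega> ^ 4)))" for \<omega>
      unfolding S_Suc by (simp add: power_mult_distrib algebra_simps eval_nat_numeral)
    have I': "integrable M (\<lambda>\<omega>. ?S (Suc k) \<omega> ^ 4)"
      unfolding eq4 by (intro Bochner_Integration.integrable_add integrable_mult_right I m'(1)) simp_all
    have E2: "(\<integral>\<omega>. ?S k \<omega> ^ 2 \<partial>M) \<le> c\<^sup>2 * (T k - T 0)"
    proof -
      have "(\<integral>\<omega>. ?S k \<omega> ^ 2 \<partial>M) = (\<integral>\<omega>. (\<Sum>i<k. (\<xi> i \<omega>)\<^sup>2 * (T (Suc i) - T i)) \<partial>M)"
        using P[of "\<lambda>_. 1" 1] by simp
      also have "\<dots> \<le> (\<integral>\<omega>. c\<^sup>2 * (T k - T 0) \<partial>M)"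
      proof (rule integral_mono)
        have b: "(\<Sum>i<k. (\<xi> i \<omega>)\<^sup>2 * (T (Suc i) - T i)) \<le> c\<^sup>2 * (T k - T 0)" if "\<omega> \<in> space M" for \<omega>
        proof -
          have "(\<Sum>i<k. (\<xi> i \<omega>)\<^sup>2 * (T (Suc i) - T i)) \<le> (\<Sum>i<k. c\<^sup>2 * (T (Suc i) - T i))"
            using bd[OF _ that] T(2) km
            by (intro sum_mono mult_right_mono) (auto simp: abs_le_square_iff[symmetric] c)
          also have "\<dots> = c\<^sup>2 * (T k - T 0)" by (simp add: sum_distrib_left[symmetric] sum_lessThan_telescope)
          finally show ?thesis .
        qed
        show "\<omega> \<in> space M \<Longrightarrow> (\<Sum>i<k. (\<xi> i \<omega>)\<^sup>2 * (T (Suc i) - T i)) \<le> c\<^sup>2 * (T k - T 0)" for \<omega>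
          by (rule b)
        have "(\<lambda>\<omega>. \<Sum>i<k. (\<xi> i \<omega>)\<^sup>2 * (T (Suc i) - T i)) \<in> borel_measurable M"
          using km measurable_F_M[OF \<xi>] by (intro borel_measurable_sum borel_measurable_times borel_measurable_power) auto
        then show "integrable M (\<lambda>\<omega>. \<Sum>i<k. (\<xi> i \<omega>)\<^sup>2 * (T (Suc i) - T i))"
        proof (rule integrable_bounded)
          fix \<omega> assume "\<omega> \<in> space M"
          moreover have "0 \<le> (\<Sum>i<k. (\<xi> i \<omega>)\<^sup>2 * (T (Suc i) - T i))"
            using T(2) km by (intro sum_nonneg mult_nonneg_nonneg) auto
          ultimately show "\<bar>\<Sum>i<k. (\<xi> i \<omega>)\<^sup>2 * (T (Suc i) - T i)\<bar> \<le> c\<^sup>2 * (T k - T 0)" using b by simp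
        qed
      qed auto
      finally show ?thesis by (simp add: prob_space)
    qed
    have E22: "(\<integral>\<omega>. \<xi> k \<omega> ^ 2 * ?S k \<omega> ^ 2 \<partial>M) \<le> c\<^sup>2 * (c\<^sup>2 * (T k - T 0))"
    proof -
      have "(\<integral>\<omega>. \<xi> k \<omega> ^ 2 * ?S k \<omega> ^ 2 \<partial>M) \<le> (\<integral>\<omega>. c\<^sup>2 * ?S k \<omega> ^ 2 \<partial>M)"
        using int[of 2 2] int[of 2 0] xi_pow[of _ 2] by (intro integral_mono integrable_mult_right mult_right_mono) auto
      also have "\<dots> \<le> c\<^sup>2 * (c\<^sup>2 * (T k - T 0))" using mult_left_mono[OF E2, of "c\<^sup>2"] by simp
      finally show ?thesis .
    qed
    have E40: "(\<integral>\<omega>. \<xi> k \<omega> ^ 4 * ?S k \<omega> ^ 0 \<partial>M) \<le> c ^ 4"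
    proof -
      have "(\<integral>\<omega>. \<xi> k \<omega> ^ 4 * ?S k \<omega> ^ 0 \<partial>M) \<le> (\<integral>\<omega>. c ^ 4 \<partial>M)"
        using int[of 0 4] xi_pow[of _ 4] by (intro integral_mono) auto
      then show ?thesis by (simp add: prob_space)
    qed
    have "(\<integral>\<omega>. ?S (Suc k) \<omega> ^ 4 \<partial>M) = (\<integral>\<omega>. ?S k \<omega> ^ 4 \<partial>M)
        + 6 * (?d * (\<integral>\<omega>. \<xi> k \<omega> ^ 2 * ?S k \<omega> ^ 2 \<partial>M)) + 3 * ?d\<^sup>2 * (\<integral>\<omega>. \<xi> k \<omega> ^ 4 * ?S k \<omega> ^ 0 \<partial>M)"
      unfolding eq4
      by (subst integral_add5, rule I, (rule m'(1), simp)+)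
        (use m'(2)[of 3 1] m'(3)[of 2 2] m'(4)[of 1 3] m'(5)[of 0 4] in simp)
    also have "\<dots> \<le> 3 * c ^ 4 * (T k - T 0)\<^sup>2 + 6 * (?d * (c\<^sup>2 * (c\<^sup>2 * (T k - T 0)))) + 3 * ?d\<^sup>2 * c ^ 4"
      using F E22 E40 T_le by (intro add_mono mult_left_mono) auto
    also have "\<dots> = 3 * c ^ 4 * (T (Suc k) - T 0)\<^sup>2"
      by (simp add: power2_eq_square eval_nat_numeral algebra_simps)
    finally have F': "(\<integral>\<omega>. ?S (Suc k) \<omega> ^ 4 \<partial>M) \<le> 3 * c ^ 4 * (T (Suc k) - T 0)\<^sup>2" .
    have P': "?P (Suc k) h K" for h K
    proof (intro impI)
      assume h: "h \<in> borel_measurable (\<F> (ennreal (T 0)))" and hK': "\<forall>\<omega>\<in>space M. \<bar>h \<omega>\<bar> \<le> K"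
      then have hK: "\<And>\<omega>. \<omega> \<in> space M \<Longrightarrow> \<bar>h \<omega>\<bar> \<le> K" by blast
      have hM[measurable]: "h \<in> borel_measurable M" by (rule measurable_F_M[OF h])
      have hk[measurable]: "h \<in> borel_measurable (\<F> (ennreal (T k)))"
        using measurable_F_mono[OF h] T0[OF km(2)] by (simp add: ennreal_leI)
      have hx: "\<bar>h \<omega> * \<xi> k \<omega> ^ j\<bar> \<le> K * c ^ j" if "\<omega> \<in> space M" for \<omega> j
        using hK[OF that] xi_pow[OF that, of j] by (auto simp: abs_mult intro!: mult_mono order_trans[OF abs_ge_zero hK[OF that]])
      have hint: "integrable M (\<lambda>\<omega>. (h \<omega> * \<xi> k \<omega> ^ j) * ?S k \<omega> ^ i)" if "i \<le> 4" for i j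
        by (rule integrable_bounded_mult_power[OF _ hx AM(1) I that]) auto
      have hmeas: "(\<lambda>\<omega>. (h \<omega> * \<xi> k \<omega> ^ j) * ?S k \<omega> ^ i) \<in> borel_measurable (\<F> (ennreal (T k)))" for i j
        by measurable
      note mh = mom[OF hmeas hint]
      have e1: "h \<omega> * ?S (Suc k) \<omega> = h \<omega> * ?S k \<omega> + ((h \<omega> * \<xi> k \<omega> ^ 1) * ?S k \<omega> ^ 0) * ?D \<omega> ^ 1" for \<omega>
        by (simp add: S_Suc algebra_simps)
      have e2: "h \<omega> * (?S (Suc k) \<omega>)\<^sup>2 = h \<omega> * (?S k \<omega>)\<^sup>2 + (2 * (((h \<omega> * \<xi> k \<omega> ^ 1) * ?S k \<omega> ^ 1) * ?D \<omega> ^ 1) +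
         ((h \<omega> * \<xi> k \<omega> ^ 2) * ?S k \<omega> ^ 0) * ?D \<omega> ^ 2)" for \<omega>
        by (simp add: S_Suc algebra_simps power2_eq_square)
      have i1: "integrable M (\<lambda>\<omega>. h \<omega> * ?S k \<omega>)" "integrable M (\<lambda>\<omega>. h \<omega> * (?S k \<omega>)\<^sup>2)"
        using hint[of 1 0] hint[of 2 0] by simp_all
      have r1: "(\<integral>\<omega>. h \<omega> * ?S (Suc k) \<omega> \<partial>M) = 0"
        unfolding e1
        apply (subst Bochner_Integration.integral_add, rule i1, rule mh(1), simp)
        using mh(2)[of 0 1] P[of h K] h hK' by simp
      have r2: "(\<integral>\<omega>. h \<omega> * (?S (Suc k) \<omega>)\<^sup>2 \<partial>M) = (\<integral>\<omega>. h \<omega> * (?S k \<omega>)\<^sup>2 \<partial>M) + ?d * (\<integral>\<omega>. h \<omega> * \<xi> k \<omega> ^ 2 \<partial>M)"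
        unfolding e2
        by (subst integral_add3, rule i1, (rule mh(1), simp)+)
          (use mh(2)[of 1 1] mh(3)[of 0 2] in simp)
      have ih: "integrable M (\<lambda>\<omega>. h \<omega> * ((\<xi> i \<omega>)\<^sup>2 * (T (Suc i) - T i)))" if "i < m" for i
      proof (rule integrable_bounded)
        show "(\<lambda>\<omega>. h \<omega> * ((\<xi> i \<omega>)\<^sup>2 * (T (Suc i) - T i))) \<in> borel_measurable M"
          using measurable_F_M[OF \<xi>[OF that]] by measurable
        fix \<omega> assume w: "\<omega> \<in> space M"
        show "\<bar>h \<omega> * ((\<xi> i \<omega>)\<^sup>2 * (T (Suc i) - T i))\<bar> \<le> K * (c\<^sup>2 * (T (Suc i) - T i))"
          unfolding abs_mult using hK[OF w] bd[OF that w] T(2)[OF that]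
          by (intro mult_mono) (auto simp: abs_le_square_iff[symmetric] c order_trans[OF abs_ge_zero hK[OF w]])
      qed
      have "(\<integral>\<omega>. h \<omega> * (?S k \<omega>)\<^sup>2 \<partial>M) + ?d * (\<integral>\<omega>. h \<omega> * \<xi> k \<omega> ^ 2 \<partial>M)
        = (\<integral>\<omega>. h \<omega> * (\<Sum>i<Suc k. (\<xi> i \<omega>)\<^sup>2 * (T (Suc i) - T i)) \<partial>M)"
      proof -
        have "(\<integral>\<omega>. h \<omega> * (\<Sum>i<Suc k. (\<xi> i \<omega>)\<^sup>2 * (T (Suc i) - T i)) \<partial>M)
          = (\<integral>\<omega>. (\<Sum>i<k. h \<omega> * ((\<xi> i \<omega>)\<^sup>2 * (T (Suc i) - T i))) + h \<omega> * ((\<xi> k \<omega>)\<^sup>2 * ?d) \<partial>M)"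
          by (simp add: sum_distrib_left distrib_left)
        also have "\<dots> = (\<integral>\<omega>. (\<Sum>i<k. h \<omega> * ((\<xi> i \<omega>)\<^sup>2 * (T (Suc i) - T i))) \<partial>M) + (\<integral>\<omega>. h \<omega> * ((\<xi> k \<omega>)\<^sup>2 * ?d) \<partial>M)"
          by (rule Bochner_Integration.integral_add) (use km in \<open>auto intro!: Bochner_Integration.integrable_sum ih\<close>)
        also have "(\<integral>\<omega>. h \<omega> * ((\<xi> k \<omega>)\<^sup>2 * ?d) \<partial>M) = (\<integral>\<omega>. ?d * (h \<omega> * (\<xi> k \<omega>)\<^sup>2) \<partial>M)"
          by (simp add: mult_ac)
        finally show ?thesis
          using P[of h K] h hK' by (simp add: sum_distrib_left)
      qed
      then show "(\<integral>\<omega>. h \<omega> * ?S (Suc k) \<omega> \<partial>M) = 0 \<and> (\<integral>\<omega>. h \<omega> * (?S (Suc k) \<omega>)\<^sup>2 \<partial>M)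
          = (\<integral>\<omega>. h \<omega> * (\<Sum>i<Suc k. (\<xi> i \<omega>)\<^sup>2 * (T (Suc i) - T i)) \<partial>M)"
        using r1 r2 by simp
    qed
    show ?case using A' I' F' P' by blast
  qed
  then show ?A ?I ?F "\<And>h K. h \<in> borel_measurable (\<F> (ennreal (T 0))) \<Longrightarrow>
        (\<And>\<omega>. \<omega> \<in> space M \<Longrightarrow> \<bar>h \<omega>\<bar> \<le> K) \<Longrightarrow>
        (\<integral>\<omega>. h \<omega> * transform_sum T \<xi> k \<omega> \<partial>M) = 0 \<and>
        (\<integral>\<omega>. h \<omega> * (transform_sum T \<xi> k \<omega>)\<^sup>2 \<partial>M)
          = (\<integral>\<omega>. h \<omega> * (\<Sum>i<k. (\<xi> i \<omega>)\<^sup>2 * (T (Suc i) - T i)) \<partial>M)"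
    by blast+
qed

text \<open>Stopping the integrand before its accumulated square exceeds \<open>\<eta>\<close> gives an integral with second moment at
most \<open>\<eta>\<close>, and on the event in question nothing has been stopped; Chebyshev's inequality concludes.  The point
is that the bound does not involve \<open>c\<close>.\<close>

lemma transform_sum_tail:
  assumes T: "0 \<le> T 0" "\<And>i. i < m \<Longrightarrow> T i \<le> T (Suc i)"
    and \<xi>: "\<And>i. i < m \<Longrightarrow> \<xi> i \<in> borel_measurable (\<F> (ennreal (T i)))"
    and bd: "\<And>i \<omega>. i < m \<Longrightarrow> \<omega> \<in> space M \<Longrightarrow> \<bar>\<xi> i \<omega>\<bar> \<le> c" and c: "0 \<le> c"
    and \<eta>: "0 \<le> \<eta>" and \<epsilon>: "0 < \<epsilon>"
  shows "measure M {\<omega>\<in>space M. (\<Sum>i<m. (\<xi> i \<omega>)\<^sup>2 * (T (Suc i) - T i)) \<le> \<eta>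
      \<and> \<epsilon> \<le> \<bar>transform_sum T \<xi> m \<omega>\<bar>} \<le> \<eta> / \<epsilon>\<^sup>2"
proof -
  define a where "a i \<omega> = (if i < m then (\<xi> i \<omega>)\<^sup>2 * (T (Suc i) - T i) else 0)" for i \<omega>
  \<comment> \<open>The test at step \<open>i\<close> involves only coefficients up to
    \<open>i\<close>, so \<open>\<zeta> i\<close> is known at time \<open>T i\<close>.\<close>
  define \<zeta> where "\<zeta> i \<omega> = (if (\<Sum>l\<le>i. a l \<omega>) \<le> \<eta> then \<xi> i \<omega> else 0)" for i \<omega>
  have a0: "0 \<le> a i \<omega>" for i \<omega> using T(2) by (auto simp: a_def)
  have Tmono: "j \<le> m \<Longrightarrow> i \<le> j \<Longrightarrow> T i \<le> T j" for i j
  proof (induction j)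
    case (Suc j)
    then show ?case using T(2)[of j] by (cases "i = Suc j") auto
  qed simp
  have \<zeta>_meas: "\<zeta> i \<in> borel_measurable (\<F> (ennreal (T i)))" if "i < m" for i
  proof -
    have "a l \<in> borel_measurable (\<F> (ennreal (T i)))" if "l \<le> i" for l
    proof -
      have "l < m" using that \<open>i < m\<close> by simp
      then have "\<xi> l \<in> borel_measurable (\<F> (ennreal (T i)))"
        using measurable_F_mono[OF \<xi>[of l]] Tmono[of i l] that \<open>i < m\<close> by (auto simp: ennreal_leI)
      then show ?thesis using \<open>l < m\<close> unfolding a_def by simp
    qed
    then have "(\<lambda>\<omega>. \<Sum>l\<le>i. a l \<omega>) \<in> borel_measurable (\<F> (ennreal (T i)))" by (intro borel_measurable_sum) auto
    then show ?thesis using \<xi>[OF that] unfolding \<zeta>_def by measurable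
  qed
  have \<zeta>_bd: "\<bar>\<zeta> i \<omega>\<bar> \<le> c" if "i < m" "\<omega> \<in> space M" for i \<omega>
    using bd[OF that] c by (auto simp: \<zeta>_def)
  note mom = transform_sum_moments[OF T \<zeta>_meas \<zeta>_bd c order_refl]
  let ?Z = "transform_sum T \<zeta> m"
  have Zm[measurable]: "?Z \<in> borel_measurable M" using measurable_F_M[OF mom(1)] by simp
  have Zi: "integrable M (\<lambda>\<omega>. (?Z \<omega>)\<^sup>2)"
    using integrable_bounded_mult_power[of "\<lambda>_. 1" 1 ?Z 2] mom(2) Zm by simp
  have sumle: "(\<Sum>i<m. (\<zeta> i \<omega>)\<^sup>2 * (T (Suc i) - T i)) \<le> \<eta>" for \<omega>
  proof -
    have "(\<Sum>i<m. (\<zeta> i \<omega>)\<^sup>2 * (T (Suc i) - T i)) = (\<Sum>i<m. if (\<Sum>l\<le>i. a l \<omega>) \<le> \<eta> then a i \<omega> else 0)"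
      by (intro sum.cong) (auto simp: \<zeta>_def a_def)
    then show ?thesis using sum_stopped_le[of "\<lambda>i. a i \<omega>" \<eta>, OF a0 \<eta>] by simp
  qed
  have "(\<integral>\<omega>. (?Z \<omega>)\<^sup>2 \<partial>M) = (\<integral>\<omega>. (\<Sum>i<m. (\<zeta> i \<omega>)\<^sup>2 * (T (Suc i) - T i)) \<partial>M)"
    using mom(4)[where h="\<lambda>_. 1" and K=1] by simp
  also have "\<dots> \<le> \<eta>"
  proof -
    have nn: "0 \<le> (\<Sum>i<m. (\<zeta> i \<omega>)\<^sup>2 * (T (Suc i) - T i))" for \<omega>
      using T(2) by (intro sum_nonneg) auto
    have "integrable M (\<lambda>\<omega>. \<Sum>i<m. (\<zeta> i \<omega>)\<^sup>2 * (T (Suc i) - T i))"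
    proof (rule integrable_bounded)
      show "(\<lambda>\<omega>. \<Sum>i<m. (\<zeta> i \<omega>)\<^sup>2 * (T (Suc i) - T i)) \<in> borel_measurable M"
        using measurable_F_M[OF \<zeta>_meas] by (intro borel_measurable_sum borel_measurable_times borel_measurable_power) auto
      show "\<bar>\<Sum>i<m. (\<zeta> i \<omega>)\<^sup>2 * (T (Suc i) - T i)\<bar> \<le> \<eta>" for \<omega> using nn sumle by simp
    qed
    then have "(\<integral>\<omega>. (\<Sum>i<m. (\<zeta> i \<omega>)\<^sup>2 * (T (Suc i) - T i)) \<partial>M) \<le> (\<integral>\<omega>. \<eta> \<partial>M)"
      using sumle by (intro integral_mono) auto
    then show ?thesis by (simp add: prob_space)
  qed
  finally have E: "(\<integral>\<omega>. (?Z \<omega>)\<^sup>2 \<partial>M) \<le> \<eta>" .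
  have "{\<omega>\<in>space M. (\<Sum>i<m. (\<xi> i \<omega>)\<^sup>2 * (T (Suc i) - T i)) \<le> \<eta> \<and> \<epsilon> \<le> \<bar>transform_sum T \<xi> m \<omega>\<bar>}
      \<subseteq> {\<omega>\<in>space M. \<epsilon>\<^sup>2 \<le> (?Z \<omega>)\<^sup>2}"
  proof safe
    fix \<omega> assume le: "(\<Sum>i<m. (\<xi> i \<omega>)\<^sup>2 * (T (Suc i) - T i)) \<le> \<eta>" and ge: "\<epsilon> \<le> \<bar>transform_sum T \<xi> m \<omega>\<bar>"
    have "\<zeta> i \<omega> = \<xi> i \<omega>" if "i < m" for i
    proof -
      have "(\<Sum>l\<le>i. a l \<omega>) \<le> (\<Sum>l<m. a l \<omega>)"
        using that a0 by (intro sum_mono2) auto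
      also have "\<dots> \<le> \<eta>" using le by (simp add: a_def)
      finally show ?thesis by (simp add: \<zeta>_def)
    qed
    then have "?Z \<omega> = transform_sum T \<xi> m \<omega>" by (simp add: transform_sum_def)
    then show "\<epsilon>\<^sup>2 \<le> (?Z \<omega>)\<^sup>2" using ge \<epsilon> by (simp add: abs_le_square_iff[symmetric])
  qed
  then have "measure M {\<omega>\<in>space M. (\<Sum>i<m. (\<xi> i \<omega>)\<^sup>2 * (T (Suc i) - T i)) \<le> \<eta> \<and> \<epsilon> \<le> \<bar>transform_sum T \<xi> m \<omega>\<bar>}
     \<le> measure M {\<omega>\<in>space M. \<epsilon>\<^sup>2 \<le> (?Z \<omega>)\<^sup>2}"
    by (intro finite_measure_mono) auto
  also have "\<dots> \<le> (\<integral>\<omega>. (?Z \<omega>)\<^sup>2 \<partial>M) / \<epsilon>\<^sup>2"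
    using integral_Markov_inequality_measure[OF Zi, of "space M" "\<epsilon>\<^sup>2"] \<epsilon> by simp
  also have "\<dots> \<le> \<eta> / \<epsilon>\<^sup>2" using E by (simp add: divide_right_mono)
  finally show ?thesis .
qed

text \<open>Clamping the partition points to \<open>[u,v]\<close> turns the increment into an elementary integral of its own.\<close>

lemma simple_integral_increment:
  assumes "u \<le> v"
  shows "simple_integral m T \<xi> B v \<omega> - simple_integral m T \<xi> B u \<omega>
    = transform_sum (\<lambda>i. max u (min v (T i))) \<xi> m \<omega>"
proof -
  have *: "B (min v a) \<omega> - B (min u a) \<omega> = B (max u (min v a)) \<omega> - B u \<omega>" for a
    using assms by (cases "a \<le> u"; cases "a \<le> v") (auto simp: min_def max_def)
  have "simple_integral m T \<xi> B v \<omega> - simple_integral m T \<xi> B u \<omega>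
     = (\<Sum>i<m. \<xi> i \<omega> * ((B (min v (T (Suc i))) \<omega> - B (min u (T (Suc i))) \<omega>)
          - (B (min v (T i)) \<omega> - B (min u (T i)) \<omega>)))"
    by (simp add: simple_integral_def algebra_simps flip: sum_subtractf)
  then show ?thesis by (simp add: * transform_sum_def)
qed

end

section \<open>Increments of the Ito integral\<close>

definition clip :: "real \<Rightarrow> real \<Rightarrow> real" where
  "clip c x = max (- c) (min c x)"

lemma clip_bound: "0 \<le> c \<Longrightarrow> \<bar>clip c x\<bar> \<le> c" by (auto simp: clip_def)

lemma clip_lipschitz: "\<bar>clip c x - clip c y\<bar> \<le> \<bar>x - y\<bar>" by (auto simp: clip_def)

lemma clip_id: "\<bar>x\<bar> \<le> c \<Longrightarrow> clip c x = x" by (auto simp: clip_def)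

lemma clip_0: "0 \<le> c \<Longrightarrow> clip c 0 = 0" by (auto simp: clip_def)

lemma clip_measurable[measurable]: "clip c \<in> borel_measurable borel" unfolding clip_def by measurable

text \<open>Where the target \<open>y\<close> needs no clipping, clipping moves an approximation \<open>x\<close> by no more than its distance to the
target.\<close>

lemma clip_diff_bound: "\<bar>y\<bar> \<le> c \<Longrightarrow> (x - clip c x)\<^sup>2 \<le> (x - y)\<^sup>2"
  by (auto simp: clip_def abs_le_square_iff[symmetric])

text \<open>At each time at most one of the intervals is active, so a function that fixes 0 may be applied to the
coefficients.\<close>

lemma simple_process_compose:
  fixes h :: "real \<Rightarrow> real"
  assumes T: "\<And>i. i < m \<Longrightarrow> T i \<le> T (Suc i)" and h: "h 0 = 0"
  shows "h (simple_process m T \<xi> s \<omega>) = (\<Sum>i<m. h (\<xi> i \<omega>) * indicator {T i<..T (Suc i)} (s::real))"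
  using T
proof (induction m)
  case 0
  then show ?case by (simp add: simple_process_def h)
next
  case (Suc m)
  have mono: "T i \<le> T m" if "i \<le> m" for i
    using that
  proof (induction rule: inc_induct)
    case (step n)
    then show ?case using Suc.prems[of n] by simp
  qed simp
  have le: "T (Suc i) \<le> T m" if "i < m" for i using mono[of "Suc i"] that by simp
  show ?case
  proof (cases "T m < s")
    case True
    then have z: "indicator {T i<..T (Suc i)} s = (0::real)" if "i < m" for i
      using le[OF that] by (auto simp: indicator_def)
    have "(\<Sum>i<m. \<xi> i \<omega> * indicator {T i<..T (Suc i)} s) = 0"
      "(\<Sum>i<m. h (\<xi> i \<omega>) * indicator {T i<..T (Suc i)} s) = 0"
      using z by (intro sum.neutral; simp)+
    then show ?thesis using h
      unfolding simple_process_def sum.lessThan_Suc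
      by (cases "s \<in> {T m<..T (Suc m)}") (simp_all del: greaterThanAtMost_iff)
  next
    case False
    then have "indicator {T m<..T (Suc m)} s = (0::real)" by simp
    moreover have "h (simple_process m T \<xi> s \<omega>) = (\<Sum>i<m. h (\<xi> i \<omega>) * indicator {T i<..T (Suc i)} s)"
      using Suc by simp
    ultimately show ?thesis unfolding simple_process_def sum.lessThan_Suc by simp
  qed
qed

lemma integral_interval_indicator:
  fixes a b u v :: real
  assumes "u \<le> v" "a \<le> b"
  shows "set_integrable lborel {u..v} (indicator {a<..b} :: real \<Rightarrow> real)"
    and "(LBINT s:{u..v}. indicator {a<..b} s) = max u (min v b) - max u (min v a)"
proof -
  have eq: "(\<lambda>s. indicator {u..v} s *\<^sub>R (indicator {a<..b} s :: real)) = indicator ({u..v} \<inter> {a<..b})"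
    by (auto simp: indicator_def)
  have fin: "emeasure lborel ({u..v} \<inter> {a<..b}) < \<infinity>"
    by (rule le_less_trans[OF emeasure_mono[of _ "{u..v}"]]) (use assms in auto)
  then show "set_integrable lborel {u..v} (indicator {a<..b} :: real \<Rightarrow> real)"
    unfolding set_integrable_def eq by (intro integrable_real_indicator) auto
  have "{u..v} \<inter> {a<..b} = (if u \<le> a then {a<..min v b} else {u..min v b})"
    by auto
  then have "measure lborel ({u..v} \<inter> {a<..b}) = max u (min v b) - max u (min v a)"
    using assms by (auto simp: measure_def min_def max_def)
  then show "(LBINT s:{u..v}. indicator {a<..b} s) = max u (min v b) - max u (min v a)"
    unfolding set_lebesgue_integral_def eq by simp
qed

lemma simple_process_integral:
  fixes u v :: real and h :: "real \<Rightarrow> real"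
  assumes uv: "u \<le> v" and T: "\<And>i. i < m \<Longrightarrow> T i \<le> T (Suc i)" and h: "h 0 = 0"
  shows "set_integrable lborel {u..v} (\<lambda>s. h (simple_process m T \<xi> s \<omega>))"
    and "(LBINT s:{u..v}. h (simple_process m T \<xi> s \<omega>))
      = (\<Sum>i<m. h (\<xi> i \<omega>) * (max u (min v (T (Suc i))) - max u (min v (T i))))"
proof -
  have i: "set_integrable lborel {u..v} (\<lambda>s. h (\<xi> i \<omega>) * indicator {T i<..T (Suc i)} s)" if "i < m" for i
    using integral_interval_indicator(1)[OF uv T[OF that]] by (intro set_integrable_mult_right) auto
  then have "set_integrable lborel {u..v} (\<lambda>s. \<Sum>i<m. h (\<xi> i \<omega>) * indicator {T i<..T (Suc i)} s)"
    unfolding set_integrable_def scaleR_sum_right by (intro Bochner_Integration.integrable_sum) auto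
  then show "set_integrable lborel {u..v} (\<lambda>s. h (simple_process m T \<xi> s \<omega>))"
    using simple_process_compose[of m T h \<xi> _ \<omega>] T h by simp
  have "(LBINT s:{u..v}. h (simple_process m T \<xi> s \<omega>))
      = (LBINT s:{u..v}. \<Sum>i<m. h (\<xi> i \<omega>) * indicator {T i<..T (Suc i)} s)"
    using simple_process_compose[of m T h \<xi> _ \<omega>] T h by simp
  also have "\<dots> = (\<Sum>i<m. LBINT s:{u..v}. h (\<xi> i \<omega>) * indicator {T i<..T (Suc i)} s)"
    using i unfolding set_lebesgue_integral_def set_integrable_def scaleR_sum_right
    by (intro Bochner_Integration.integral_sum) auto
  also have "\<dots> = (\<Sum>i<m. h (\<xi> i \<omega>) * (max u (min v (T (Suc i))) - max u (min v (T i))))"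
    using integral_interval_indicator(2)[OF uv T] by (intro sum.cong) (auto simp: set_integral_mult_right)
  finally show "(LBINT s:{u..v}. h (simple_process m T \<xi> s \<omega>))
      = (\<Sum>i<m. h (\<xi> i \<omega>) * (max u (min v (T (Suc i))) - max u (min v (T i))))" .
qed

lemma set_integrable_bounded_interval:
  fixes f :: "real \<Rightarrow> real"
  assumes "f \<in> borel_measurable borel" "\<And>s. s \<in> {u..v} \<Longrightarrow> \<bar>f s\<bar> \<le> K"
  shows "set_integrable lborel {u..v} f"
proof -
  have "integrable lborel (indicator {u..v} :: real \<Rightarrow> real)"
    by (rule integrable_real_indicator) (auto simp: emeasure_lborel_Icc_eq)
  then have "set_integrable lborel {u..v} (\<lambda>_. K)"
    unfolding set_integrable_def by simp
  then show ?thesis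
  proof (rule set_integrable_bound)
    show "set_borel_measurable lborel {u..v} f"
      using assms(1) by (auto simp: set_borel_measurable_def)
    show "AE x in lborel. x \<in> {u..v} \<longrightarrow> norm (f x) \<le> norm K"
    proof (intro AE_I2 impI)
      fix x assume "x \<in> {u..v}"
      then have "\<bar>f x\<bar> \<le> K" by (rule assms(2))
      then show "norm (f x) \<le> norm K" by simp
    qed
  qed
qed

lemma clipped_square_integral:
  fixes h :: "real \<Rightarrow> real"
  assumes h: "h \<in> borel_measurable borel" and c: "0 \<le> c"
  shows "set_integrable lborel {u..v} (\<lambda>s. (clip c (h s))\<^sup>2)"
    and "0 \<le> (LBINT s:{u..v}. (clip c (h s))\<^sup>2)"
    and "u \<le> v \<Longrightarrow> (LBINT s:{u..v}. (clip c (h s))\<^sup>2) \<le> c\<^sup>2 * (v - u)"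
proof -
  have sq: "(clip c x)\<^sup>2 \<le> c\<^sup>2" for x
    using clip_bound[OF c, of x] c by (simp add: abs_le_square_iff[symmetric])
  show int: "set_integrable lborel {u..v} (\<lambda>s. (clip c (h s))\<^sup>2)"
    using h sq by (intro set_integrable_bounded_interval[where K="c\<^sup>2"]) auto
  show "0 \<le> (LBINT s:{u..v}. (clip c (h s))\<^sup>2)"
    unfolding set_lebesgue_integral_def by (auto intro!: Bochner_Integration.integral_nonneg)
  assume "u \<le> v"
  have "(LBINT s:{u..v}. (clip c (h s))\<^sup>2) \<le> (LBINT s:{u..v}. c\<^sup>2)"
    by (rule set_integral_mono[OF int set_integrable_bounded_interval[where K="c\<^sup>2"]]) (use sq in auto)
  then show "(LBINT s:{u..v}. (clip c (h s))\<^sup>2) \<le> c\<^sup>2 * (v - u)"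
    using \<open>u \<le> v\<close> by (simp add: set_lebesgue_integral_def mult.commute)
qed

text \<open>The difference of the squares is at most \<open>2c|x - y|\<close>, and \<open>|x - y| \<le> \<surd>\<theta> + (x - y)\<^sup>2/\<surd>\<theta>\<close>.\<close>

lemma clipped_square_integral_diff:
  fixes x y :: "real \<Rightarrow> real"
  assumes x[measurable]: "x \<in> borel_measurable borel" and y[measurable]: "y \<in> borel_measurable borel"
    and uv: "u \<le> v" and c: "0 \<le> c" and th: "0 < \<theta>"
    and close: "(\<integral>\<^sup>+ s\<in>{u..v}. ennreal ((x s - y s)\<^sup>2) \<partial>lborel) \<le> ennreal \<theta>"
  shows "\<bar>(LBINT s:{u..v}. (clip c (x s))\<^sup>2) - (LBINT s:{u..v}. (clip c (y s))\<^sup>2)\<bar> \<le> 2 * c * sqrt \<theta> * (v - u + 1)"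
    and "(\<And>s. s \<in> {u..v} \<Longrightarrow> \<bar>y s\<bar> \<le> c) \<Longrightarrow> (LBINT s:{u..v}. (x s - clip c (x s))\<^sup>2) \<le> \<theta>"
proof -
  have nn: "(\<integral>\<^sup>+ s. ennreal (indicator {u..v} s *\<^sub>R (x s - y s)\<^sup>2) \<partial>lborel) \<le> ennreal \<theta>"
  proof -
    have "(\<integral>\<^sup>+ s. ennreal (indicator {u..v} s *\<^sub>R (x s - y s)\<^sup>2) \<partial>lborel) = (\<integral>\<^sup>+ s\<in>{u..v}. ennreal ((x s - y s)\<^sup>2) \<partial>lborel)"
      by (intro nn_integral_cong) (simp add: indicator_def)
    then show ?thesis using close by simp
  qed
  have int: "set_integrable lborel {u..v} (\<lambda>s. (x s - y s)\<^sup>2)"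
    unfolding set_integrable_def
    by (rule integrableI_nonneg) (use le_less_trans[OF nn] in auto)
  have le: "(LBINT s:{u..v}. (x s - y s)\<^sup>2) \<le> \<theta>"
    unfolding set_lebesgue_integral_def
    using nn th by (subst integral_eq_nn_integral) (auto intro!: enn2real_leI)
  note ci = clipped_square_integral(1)[OF _ c, of _ u v]
  have const: "set_integrable lborel {u..v} (\<lambda>s. a)" for a :: real
    by (rule set_integrable_bounded_interval[where K="\<bar>a\<bar>"]) auto
  have LBc: "(LBINT s:{u..v}. a) = a * (v - u)" for a :: real
    using uv by (simp add: set_lebesgue_integral_def)
  have rt: "0 < sqrt \<theta>" using th by simp
  let ?g = "\<lambda>s. 2 * c * (sqrt \<theta> + (x s - y s)\<^sup>2 / sqrt \<theta>)"
  have time_of: "set_integrable lborel {u..v} ?g"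
    using int const by (intro set_integrable_mult_right set_integral_add set_integrable_divide) auto
  have pt: "\<bar>(clip c (x s))\<^sup>2 - (clip c (y s))\<^sup>2\<bar> \<le> ?g s" for s
  proof -
    have "\<bar>(clip c (x s))\<^sup>2 - (clip c (y s))\<^sup>2\<bar> = \<bar>clip c (x s) + clip c (y s)\<bar> * \<bar>clip c (x s) - clip c (y s)\<bar>"
      by (simp add: power2_eq_square abs_mult[symmetric] algebra_simps)
    also have "\<dots> \<le> (2 * c) * \<bar>x s - y s\<bar>"
      using clip_bound[OF c, of "x s"] clip_bound[OF c, of "y s"] clip_lipschitz
      by (intro mult_mono) auto
    also have "\<bar>x s - y s\<bar> \<le> sqrt \<theta> + (x s - y s)\<^sup>2 / sqrt \<theta>"
    proof -
      have "\<bar>x s - y s\<bar> * sqrt \<theta> \<le> \<theta> + (x s - y s)\<^sup>2"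
      proof -
        have "0 \<le> \<bar>x s - y s\<bar> * sqrt \<theta>" using rt by simp
        then show ?thesis
          using sum_squares_bound[of "\<bar>x s - y s\<bar>" "sqrt \<theta>"] th unfolding power2_abs real_sqrt_pow2[OF less_imp_le[OF th]]
          by linarith
      qed
      then show ?thesis using rt th by (simp add: field_simps)
    qed
    finally show ?thesis using c by (simp add: mult_left_mono)
  qed
  have "\<bar>(LBINT s:{u..v}. (clip c (x s))\<^sup>2) - (LBINT s:{u..v}. (clip c (y s))\<^sup>2)\<bar>
      = \<bar>LBINT s:{u..v}. (clip c (x s))\<^sup>2 - (clip c (y s))\<^sup>2\<bar>"
    using ci[OF x] ci[OF y] by (simp add: set_integral_diff)
  also have "\<dots> \<le> (LBINT s:{u..v}. \<bar>(clip c (x s))\<^sup>2 - (clip c (y s))\<^sup>2\<bar>)"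
    using set_integral_norm_bound[OF set_integral_diff(1)[OF ci[OF x] ci[OF y]]] by simp
  also have "\<dots> \<le> (LBINT s:{u..v}. ?g s)"
    using set_integral_diff(1)[OF ci[OF x] ci[OF y]] time_of pt
    by (intro set_integral_mono set_integrable_abs) auto
  also have "\<dots> = 2 * c * (sqrt \<theta> * (v - u) + (LBINT s:{u..v}. (x s - y s)\<^sup>2) / sqrt \<theta>)"
    by (subst set_integral_mult_right, subst set_integral_add(2))
      (use int const set_integrable_divide[of "sqrt \<theta>" lborel "{u..v}" "\<lambda>s. (x s - y s)\<^sup>2"] in \<open>simp_all add: LBc\<close>)
  also have "\<dots> \<le> 2 * c * (sqrt \<theta> * (v - u) + \<theta> / sqrt \<theta>)"
    using le c rt by (intro mult_left_mono add_left_mono divide_right_mono) auto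
  also have "\<theta> / sqrt \<theta> = sqrt \<theta>" using th by (simp add: real_div_sqrt)
  finally show "\<bar>(LBINT s:{u..v}. (clip c (x s))\<^sup>2) - (LBINT s:{u..v}. (clip c (y s))\<^sup>2)\<bar> \<le> 2 * c * sqrt \<theta> * (v - u + 1)"
    by (simp add: algebra_simps)
  assume yc: "\<And>s. s \<in> {u..v} \<Longrightarrow> \<bar>y s\<bar> \<le> c"
  have "(LBINT s:{u..v}. (x s - clip c (x s))\<^sup>2) \<le> (LBINT s:{u..v}. (x s - y s)\<^sup>2)"
  proof (rule set_integral_mono[OF _ int])
    show "set_integrable lborel {u..v} (\<lambda>s. (x s - clip c (x s))\<^sup>2)"
      using int by (rule set_integrable_bound) (use yc clip_diff_bound in \<open>auto simp: set_borel_measurable_def\<close>)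
  qed (use yc clip_diff_bound in auto)
  then show "(LBINT s:{u..v}. (x s - clip c (x s))\<^sup>2) \<le> \<theta>" using le by simp
qed

context filtered_prob_space begin

text \<open>Clamping the time makes the process jointly measurable on the whole line without changing it on
\<open>[0,v]\<close>.\<close>

lemma progressive_joint:
  assumes "progressive \<F> H" "0 \<le> v"
  shows "(\<lambda>(\<omega>, s). H (max 0 (min s v)) \<omega>) \<in> borel_measurable (M \<Otimes>\<^sub>M lborel)"
proof -
  have H: "(\<lambda>(s, \<omega>). H s \<omega>) \<in> borel_measurable (restrict_space borel {0..v} \<Otimes>\<^sub>M \<F> (ennreal v))"
    using assms by (auto simp: progressive_def)
  have id: "(\<lambda>\<omega>. \<omega>) \<in> M \<rightarrow>\<^sub>M \<F> (ennreal v)"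
    using sets_F_subset[of "ennreal v"] space_F[of "ennreal v"] by (auto simp: measurable_def sets.sets_into_space Int_absorb2)
  have cl: "(\<lambda>s. max 0 (min s v)) \<in> lborel \<rightarrow>\<^sub>M restrict_space borel {0..v}"
    using assms(2) by (intro measurable_restrict_space2) auto
  have "(\<lambda>x. (max 0 (min (snd x) v), fst x)) \<in> (M \<Otimes>\<^sub>M lborel) \<rightarrow>\<^sub>M (restrict_space borel {0..v} \<Otimes>\<^sub>M \<F> (ennreal v))"
    by (intro measurable_Pair measurable_compose[OF measurable_snd cl] measurable_compose[OF measurable_fst id])
  from measurable_compose[OF this H] show ?thesis by (simp add: case_prod_beta)
qed

lemma progressive_clipped_square_integral:
  assumes H: "progressive \<F> H" and uv: "0 \<le> u" "u \<le> v" and c: "0 \<le> c"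
  shows "(\<lambda>\<omega>. LBINT s:{u..v}. (clip c (H s \<omega>))\<^sup>2) \<in> borel_measurable M"
    and "\<omega> \<in> space M \<Longrightarrow> 0 \<le> (LBINT s:{u..v}. (clip c (H s \<omega>))\<^sup>2) \<and> (LBINT s:{u..v}. (clip c (H s \<omega>))\<^sup>2) \<le> c\<^sup>2 * (v - u)"
proof -
  let ?H = "\<lambda>\<omega> s. H (max 0 (min s v)) \<omega>"
  have v0: "0 \<le> v" using uv by simp
  have eq: "(LBINT s:{u..v}. (clip c (H s \<omega>))\<^sup>2) = (LBINT s:{u..v}. (clip c (?H \<omega> s))\<^sup>2)" for \<omega>
    using uv by (intro set_lebesgue_integral_cong) auto
  note joint = progressive_joint[OF H v0]
  show "(\<lambda>\<omega>. LBINT s:{u..v}. (clip c (H s \<omega>))\<^sup>2) \<in> borel_measurable M"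
    unfolding eq unfolding set_lebesgue_integral_def
    by (rule lborel.borel_measurable_lebesgue_integral) (use joint in measurable)
  assume "\<omega> \<in> space M"
  then have "?H \<omega> \<in> borel_measurable borel" using measurable_Pair2[OF joint] by simp
  from clipped_square_integral(2,3)[OF this c] uv(2)
  show "0 \<le> (LBINT s:{u..v}. (clip c (H s \<omega>))\<^sup>2) \<and> (LBINT s:{u..v}. (clip c (H s \<omega>))\<^sup>2) \<le> c\<^sup>2 * (v - u)"
    unfolding eq by blast
qed

end

context brownian_filtration begin

text \<open>This is all that the proof uses of the Ito integral.  The random variable \<open>S\<close> is the integral over
\<open>[u,v]\<close> of an approximating simple process clipped at \<open>c\<close>; clipping gives it the bounded moments.  The variable \<open>q\<close> is
the integral of the square of the clipped simple process, hence close to that of the clipped \<open>H\<close>.  On an event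
\<open>G\<close> where \<open>|H| \<le> c\<close> on \<open>[u,v]\<close>, the part that was clipped off has small square integral, so \<open>S\<close> is close in
probability to the increment of the Ito integral.  Such an event typically depends on
the path up to time \<open>v\<close>, whereas the test variables \<open>h\<close> are known at time \<open>u\<close>.\<close>

lemma ito_increment_approx:
  assumes ito: "ito_integral M \<F> B H I" and uv: "0 \<le> u" "u \<le> v" and c: "0 \<le> c" and th: "0 < \<theta>"
  obtains S q where
    "S \<in> borel_measurable M" "q \<in> borel_measurable M"
    "\<And>\<omega>. \<omega> \<in> space M \<Longrightarrow> 0 \<le> q \<omega> \<and> q \<omega> \<le> c\<^sup>2 * (v - u)"
    "\<And>h K. h \<in> borel_measurable (\<F> (ennreal u)) \<Longrightarrow> (\<And>\<omega>. \<omega> \<in> space M \<Longrightarrow> \<bar>h \<omega>\<bar> \<le> K) \<Longrightarrow>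
        (\<integral>\<omega>. h \<omega> * S \<omega> \<partial>M) = 0 \<and> (\<integral>\<omega>. h \<omega> * (S \<omega>)\<^sup>2 \<partial>M) = (\<integral>\<omega>. h \<omega> * q \<omega> \<partial>M)"
    "integrable M (\<lambda>\<omega>. S \<omega> ^ 4)" "(\<integral>\<omega>. S \<omega> ^ 4 \<partial>M) \<le> 3 * c ^ 4 * (v - u)\<^sup>2"
    "(\<integral>\<omega>. \<bar>q \<omega> - (LBINT s:{u..v}. (clip c (H s \<omega>))\<^sup>2)\<bar> \<partial>M) \<le> \<theta>"
    "\<And>G. G \<in> sets M \<Longrightarrow> (\<And>\<omega> s. \<omega> \<in> G \<Longrightarrow> s \<in> {u..v} \<Longrightarrow> \<bar>H s \<omega>\<bar> \<le> c) \<Longrightarrow>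
        measure M {\<omega>\<in>G. \<theta> \<le> \<bar>I v \<omega> - I u \<omega> - S \<omega>\<bar>} \<le> \<theta>"
proof -
  have v0: "0 \<le> v" using uv by simp
  from ito have "\<exists>m T \<xi>. (\<forall>n. simple_data M \<F> (m n) (T n) (\<xi> n)) \<and>
        (\<forall>t\<ge>0.
           null_in_prob M (\<lambda>n \<omega>. \<integral>\<^sup>+ s\<in>{0..t}.
             ennreal ((simple_process (m n) (T n) (\<xi> n) s \<omega> - H s \<omega>)\<^sup>2) \<partial>lborel) \<and>
           null_in_prob M (\<lambda>n \<omega>.
             run_max (\<lambda>s. simple_integral (m n) (T n) (\<xi> n) B s \<omega> - I s \<omega>) (ennreal t)))"
    unfolding ito_integral_def by (elim conjE)
  then obtain mm TT \<Xi> where sd': "\<forall>n. simple_data M \<F> (mm n) (TT n) (\<Xi> n)"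
    and nn: "\<forall>t\<ge>0. null_in_prob M (\<lambda>n \<omega>. \<integral>\<^sup>+ s\<in>{0..t}.
             ennreal ((simple_process (mm n) (TT n) (\<Xi> n) s \<omega> - H s \<omega>)\<^sup>2) \<partial>lborel) \<and>
           null_in_prob M (\<lambda>n \<omega>.
             run_max (\<lambda>s. simple_integral (mm n) (TT n) (\<Xi> n) B s \<omega> - I s \<omega>) (ennreal t))"
    by (elim exE conjE) (rule that, assumption+)
  note sd = sd'[rule_format]
  have n1: "null_in_prob M (\<lambda>n \<omega>. \<integral>\<^sup>+ s\<in>{0..v}. ennreal ((simple_process (mm n) (TT n) (\<Xi> n) s \<omega> - H s \<omega>)\<^sup>2) \<partial>lborel)"
    and n2: "null_in_prob M (\<lambda>n \<omega>. run_max (\<lambda>s. simple_integral (mm n) (TT n) (\<Xi> n) B s \<omega> - I s \<omega>) (ennreal v))"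
    by (rule conjunct1[OF nn[rule_format, OF v0]], rule conjunct2[OF nn[rule_format, OF v0]])
  have prog: "progressive \<F> H" and Ica: "continuous_adapted M \<F> I" using ito by (auto simp: ito_integral_def)
  have Bca: "continuous_adapted M \<F> B" using bm by (simp add: brownian_motion_def)
  \<comment> \<open>The level \<open>\<eta>\<close> of the square distance is chosen so that the
    three error bounds below are at most \<open>\<theta>\<close>.\<close>
  have "((\<lambda>x. 2 * c * sqrt x * (v - u + 1) + c\<^sup>2 * (v - u) * x) \<longlongrightarrow> 2 * c * sqrt 0 * (v - u + 1) + c\<^sup>2 * (v - u) * 0) (at_right 0)"
    by (intro tendsto_intros)
  then have "\<forall>\<^sub>F x in at_right 0. 2 * c * sqrt x * (v - u + 1) + c\<^sup>2 * (v - u) * x < \<theta>"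
    using th by (intro order_tendstoD) auto
  moreover have "\<forall>\<^sub>F x in at_right 0. x < min (\<theta> / 4) (\<theta> ^ 3 / 8)"
    using th by (intro order_tendstoD(2)[OF tendsto_ident_at]) auto
  moreover have "\<forall>\<^sub>F x in at_right 0. (0::real) < x" by (simp add: eventually_at_right_less)
  ultimately have "\<forall>\<^sub>F x in at_right 0. 2 * c * sqrt x * (v - u + 1) + c\<^sup>2 * (v - u) * x < \<theta>
       \<and> x < min (\<theta> / 4) (\<theta> ^ 3 / 8) \<and> 0 < x" by eventually_elim auto
  then obtain \<eta> where eta: "2 * c * sqrt \<eta> * (v - u + 1) + c\<^sup>2 * (v - u) * \<eta> < \<theta>" "\<eta> < \<theta> / 4" "\<eta> < \<theta> ^ 3 / 8" "0 < \<eta>"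
    using eventually_happens'[OF trivial_limit_at_right_real] by (metis (no_types, lifting) min_less_iff_conj)
  have "\<forall>\<^sub>F n in sequentially. measure M {\<omega>\<in>space M. ennreal \<eta> \<le> (\<integral>\<^sup>+ s\<in>{0..v}. ennreal ((simple_process (mm n) (TT n) (\<Xi> n) s \<omega> - H s \<omega>)\<^sup>2) \<partial>lborel)} < \<eta>"
    using n1 eta(4) unfolding null_in_prob_def by (intro order_tendstoD(2)[where y=0]) auto
  moreover have "\<forall>\<^sub>F n in sequentially. measure M {\<omega>\<in>space M. ennreal (\<theta>/4) \<le> run_max (\<lambda>s. simple_integral (mm n) (TT n) (\<Xi> n) B s \<omega> - I s \<omega>) (ennreal v)} < \<theta> / 4"
    using n2 th unfolding null_in_prob_def by (intro order_tendstoD(2)[where y=0]) auto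
  ultimately obtain n where
    E1: "measure M {\<omega>\<in>space M. ennreal \<eta> \<le> (\<integral>\<^sup>+ s\<in>{0..v}. ennreal ((simple_process (mm n) (TT n) (\<Xi> n) s \<omega> - H s \<omega>)\<^sup>2) \<partial>lborel)} < \<eta>"
    and E2: "measure M {\<omega>\<in>space M. ennreal (\<theta>/4) \<le> run_max (\<lambda>s. simple_integral (mm n) (TT n) (\<Xi> n) B s \<omega> - I s \<omega>) (ennreal v)} < \<theta> / 4"
    using eventually_happens'[OF sequentially_bot eventually_conj] by blast
  define m T \<xi> where "m = mm n" and "T = TT n" and "\<xi> = \<Xi> n"
  note [folded m_def T_def \<xi>_def] = E1 E2 sd
  define sp where "sp = (\<lambda>s \<omega>. simple_process m T \<xi> s \<omega>)"
  define J where "J = simple_integral m T \<xi> B"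
  have sd': "simple_data M \<F> m T \<xi>" unfolding m_def T_def \<xi>_def by (rule sd)
  have T0: "0 \<le> T 0" and T: "\<And>i. i < m \<Longrightarrow> T i \<le> T (Suc i)"
    and \<xi>m: "\<And>i. i < m \<Longrightarrow> \<xi> i \<in> borel_measurable (\<F> (ennreal (T i)))"
    and \<xi>b: "\<And>i. i < m \<Longrightarrow> \<exists>c. \<forall>\<omega>\<in>space M. \<bar>\<xi> i \<omega>\<bar> \<le> c"
    using sd' by (auto simp: simple_data_def)
  have Tpos: "0 \<le> T i" if "i \<le> m" for i
    using that by (induction i) (use T0 T in \<open>auto intro: order_trans\<close>)
  \<comment> \<open>The two exceptional events: a large square distance of the integrands, and a
    large distance of the integrals.\<close>
  define E1s where "E1s = {\<omega>\<in>space M. ennreal \<eta> \<le> (\<integral>\<^sup>+ s\<in>{0..v}. ennreal ((sp s \<omega> - H s \<omega>)\<^sup>2) \<partial>lborel)}"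
  define E2s where "E2s = {\<omega>\<in>space M. ennreal (\<theta>/4) \<le> run_max (\<lambda>s. J s \<omega> - I s \<omega>) (ennreal v)}"
  have E1: "measure M E1s < \<eta>" and E2: "measure M E2s < \<theta> / 4"
    using E1 E2 unfolding E1s_def E2s_def sp_def J_def m_def T_def \<xi>_def by auto
  have \<xi>M: "\<xi> i \<in> borel_measurable M" if "i < m" for i using measurable_F_M[OF \<xi>m[OF that]] .
  have H': "(\<lambda>(\<omega>, s). H (max 0 (min s v)) \<omega>) \<in> borel_measurable (M \<Otimes>\<^sub>M lborel)"
    by (rule progressive_joint[OF prog v0])
  define H' where "H' s \<omega> = H (max 0 (min s v)) \<omega>" for s \<omega>
  have H'_eq: "s \<in> {0..v} \<Longrightarrow> H' s \<omega> = H s \<omega>" for s \<omega> by (simp add: H'_def)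
  have H'm[measurable]: "(\<lambda>(\<omega>, s). H' s \<omega>) \<in> borel_measurable (M \<Otimes>\<^sub>M lborel)" using H' by (simp add: H'_def)
  have spm[measurable]: "(\<lambda>(\<omega>, s). sp s \<omega>) \<in> borel_measurable (M \<Otimes>\<^sub>M lborel)"
    unfolding sp_def simple_process_def case_prod_beta
  proof (intro borel_measurable_sum borel_measurable_times)
    fix i assume "i \<in> {..<m}"
    then show "(\<lambda>x. \<xi> i (fst x)) \<in> borel_measurable (M \<Otimes>\<^sub>M lborel)"
      using measurable_compose[OF measurable_fst \<xi>M] by auto
    show "(\<lambda>x. indicator {T i<..T (Suc i)} (snd x)) \<in> borel_measurable (M \<Otimes>\<^sub>M lborel)" by measurable
  qed
  have H's: "(\<lambda>s. H' s \<omega>) \<in> borel_measurable borel" and sps: "(\<lambda>s. sp s \<omega>) \<in> borel_measurable borel" if "\<omega> \<in> space M" for \<omega>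
    using measurable_Pair2[OF H'm that] measurable_Pair2[OF spm that] by simp_all
  have Ym: "(\<lambda>\<omega>. \<integral>\<^sup>+ s. ennreal ((sp s \<omega> - H' s \<omega>)\<^sup>2) * indicator {0..v} s \<partial>lborel) \<in> borel_measurable M"
    by (rule lborel.borel_measurable_nn_integral) measurable
  have Yeq: "(\<integral>\<^sup>+ s\<in>{0..v}. ennreal ((sp s \<omega> - H s \<omega>)\<^sup>2) \<partial>lborel) = (\<integral>\<^sup>+ s. ennreal ((sp s \<omega> - H' s \<omega>)\<^sup>2) * indicator {0..v} s \<partial>lborel)" for \<omega>
    by (intro nn_integral_cong) (auto simp: indicator_def H'_eq)
  have E1m[measurable]: "E1s \<in> sets M" unfolding E1s_def Yeq using Ym by measurable
  have JM: "J s \<in> borel_measurable M" if "0 \<le> s" for s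
    unfolding J_def simple_integral_def
  proof (intro borel_measurable_sum borel_measurable_times borel_measurable_diff)
    fix i assume i: "i \<in> {..<m}"
    show "\<xi> i \<in> borel_measurable M" using \<xi>M i by auto
    show "B (min s (T (Suc i))) \<in> borel_measurable M" "B (min s (T i)) \<in> borel_measurable M"
      using Tpos[of i] Tpos[of "Suc i"] i that by (auto intro!: measurable_F_M[OF B_measurable])
  qed
  have IM: "I s \<in> borel_measurable M" if "0 \<le> s" for s
    using Ica that measurable_F_M by (auto simp: continuous_adapted_def)
  have "(\<lambda>\<omega>. run_max (\<lambda>s. J s \<omega> - I s \<omega>) (ennreal v)) \<in> borel_measurable M"
  proof (rule run_max_measurable)
    fix \<omega> assume w: "\<omega> \<in> space M"
    have cB: "continuous_on {0..} (\<lambda>t. B t \<omega>)" and cI: "continuous_on {0..} (\<lambda>t. I t \<omega>)"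
      using Bca Ica w by (auto simp: continuous_adapted_def)
    have "continuous_on {0..} (\<lambda>t. B (min t a) \<omega>)" if "0 \<le> a" for a
      by (rule continuous_on_compose2[OF cB]) (use that in \<open>auto intro!: continuous_intros\<close>)
    then show "continuous_on {0..} (\<lambda>s. J s \<omega> - I s \<omega>)"
      unfolding J_def simple_integral_def using Tpos cI
      by (intro continuous_intros) auto
  qed (use JM IM in auto)
  then have E2m[measurable]: "E2s \<in> sets M" unfolding E2s_def by measurable
  define T' where "T' i = max u (min v (T i))" for i
  \<comment> \<open>Coefficients of intervals beyond \<open>v\<close> multiply a zero increment; they
    are set to 0 because they are not known at time \<open>v\<close>.\<close>
  define \<xi>' where "\<xi>' i = (if T i < v then \<xi> i else (\<lambda>_. 0))" for i
  have T'0: "0 \<le> T' 0" using uv by (auto simp: T'_def)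
  have T'mono: "T' i \<le> T' (Suc i)" if "i < m" for i using T[OF that] by (auto simp: T'_def)
  have uT': "u \<le> T' i" "T' i \<le> v" for i using uv by (auto simp: T'_def)
  have \<xi>'m: "\<xi>' i \<in> borel_measurable (\<F> (ennreal (T' i)))" if "i < m" for i
  proof (cases "T i < v")
    case True
    then have "T i \<le> T' i" by (auto simp: T'_def)
    then show ?thesis using measurable_F_mono[OF \<xi>m[OF that]] True by (auto simp: \<xi>'_def ennreal_leI)
  qed (simp add: \<xi>'_def)
  have zero: "\<not> T i < v \<Longrightarrow> i < m \<Longrightarrow> T' (Suc i) = T' i" for i
    using T[of i] uv by (auto simp: T'_def)
  have drop: "(\<Sum>i<m. h (\<xi>' i \<omega>) * (a (T' (Suc i)) - a (T' i))) = (\<Sum>i<m. h (\<xi> i \<omega>) * (a (T' (Suc i)) - a (T' i)))"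
    for h a :: "real \<Rightarrow> real" and \<omega>
    by (intro sum.cong) (auto simp: \<xi>'_def zero)
  have sq: "(LBINT s:{u..v}. h (sp s \<omega>)) = (\<Sum>i<m. h (\<xi>' i \<omega>) * (T' (Suc i) - T' i))" if "h 0 = 0" for h \<omega>
    unfolding sp_def using simple_process_integral(2)[where m=m and T=T and h=h and u=u and v=v and \<xi>=\<xi> and \<omega>=\<omega>, OF uv(2) T that] drop[of h \<omega> "\<lambda>x. x"] by (simp add: T'_def)
  define S where "S = transform_sum T' (\<lambda>i \<omega>. clip c (\<xi>' i \<omega>)) m"
  define q where "q \<omega> = (\<Sum>i<m. (clip c (\<xi>' i \<omega>))\<^sup>2 * (T' (Suc i) - T' i))" for \<omega>
  have clm: "(\<lambda>\<omega>. clip c (\<xi>' i \<omega>)) \<in> borel_measurable (\<F> (ennreal (T' i)))" if "i < m" for i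
    using \<xi>'m[OF that] by measurable
  have clb: "\<bar>clip c (\<xi>' i \<omega>)\<bar> \<le> c" for i \<omega> by (rule clip_bound[OF c])
  note mom = transform_sum_moments[where m=m and k=m and T=T' and c=c and \<xi>="\<lambda>i \<omega>. clip c (\<xi>' i \<omega>)", OF T'0 T'mono clm clb c order_refl, folded S_def]
  have qm: "q \<in> borel_measurable M"
    unfolding q_def[abs_def] using measurable_F_M[OF clm]
    by (intro borel_measurable_sum borel_measurable_times borel_measurable_power) auto
  have qb: "0 \<le> q \<omega> \<and> q \<omega> \<le> c\<^sup>2 * (v - u)" for \<omega>
  proof
    show "0 \<le> q \<omega>" unfolding q_def using T'mono by (intro sum_nonneg) auto
    have "q \<omega> \<le> (\<Sum>i<m. c\<^sup>2 * (T' (Suc i) - T' i))"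
      unfolding q_def using T'mono clb c by (intro sum_mono mult_right_mono) (auto simp: abs_le_square_iff[symmetric])
    also have "\<dots> = c\<^sup>2 * (T' m - T' 0)" by (simp add: sum_distrib_left[symmetric] sum_lessThan_telescope)
    also have "\<dots> \<le> c\<^sup>2 * (v - u)" using uT'[of m] uT'[of 0] by (intro mult_left_mono) auto
    finally show "q \<omega> \<le> c\<^sup>2 * (v - u)" .
  qed
  have mart: "(\<integral>\<omega>. h \<omega> * S \<omega> \<partial>M) = 0 \<and> (\<integral>\<omega>. h \<omega> * (S \<omega>)\<^sup>2 \<partial>M) = (\<integral>\<omega>. h \<omega> * q \<omega> \<partial>M)"
    if "h \<in> borel_measurable (\<F> (ennreal u))" "\<And>\<omega>. \<omega> \<in> space M \<Longrightarrow> \<bar>h \<omega>\<bar> \<le> K" for h K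
    using mom(4)[where h=h and K=K] measurable_F_mono[OF that(1)] uT'(1)[of 0] that(2) by (simp add: ennreal_leI q_def)
  have SM: "S \<in> borel_measurable M" using measurable_F_M[OF mom(1)] .
  have S4: "(\<integral>\<omega>. S \<omega> ^ 4 \<partial>M) \<le> 3 * c ^ 4 * (v - u)\<^sup>2"
  proof -
    have "(T' m - T' 0)\<^sup>2 \<le> (v - u)\<^sup>2"
    proof (rule power_mono)
      have "0 \<le> (\<Sum>i<m. T' (Suc i) - T' i)" using T'mono by (intro sum_nonneg) auto
      then show "0 \<le> T' m - T' 0" by (simp add: sum_lessThan_telescope)
      show "T' m - T' 0 \<le> v - u" using uT'[of m] uT'[of 0] by simp
    qed
    then show ?thesis using mom(3) c by (meson mult_left_mono order_trans mult_nonneg_nonneg zero_le_numeral zero_le_power)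
  qed
  define Q where "Q \<omega> = (LBINT s:{u..v}. (clip c (H s \<omega>))\<^sup>2)" for \<omega>
  have Q': "Q \<omega> = (LBINT s:{u..v}. (clip c (H' s \<omega>))\<^sup>2)" for \<omega>
    unfolding Q_def using uv by (intro set_lebesgue_integral_cong) (auto simp: H'_eq)
  have Qm: "Q \<in> borel_measurable M" and Qb: "\<And>\<omega>. \<omega> \<in> space M \<Longrightarrow> 0 \<le> Q \<omega> \<and> Q \<omega> \<le> c\<^sup>2 * (v - u)"
    unfolding Q_def[abs_def] by (rule progressive_clipped_square_integral[OF prog uv c]; assumption?)+
  have off: "(\<integral>\<^sup>+ s\<in>{u..v}. ennreal ((sp s \<omega> - H' s \<omega>)\<^sup>2) \<partial>lborel) \<le> ennreal \<eta>" if "\<omega> \<in> space M - E1s" for \<omega>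
  proof -
    have "(\<integral>\<^sup>+ s\<in>{u..v}. ennreal ((sp s \<omega> - H' s \<omega>)\<^sup>2) \<partial>lborel) \<le> (\<integral>\<^sup>+ s. ennreal ((sp s \<omega> - H' s \<omega>)\<^sup>2) * indicator {0..v} s \<partial>lborel)"
      using uv by (intro nn_integral_mono) (auto simp: indicator_def)
    then show ?thesis using that by (auto simp: E1s_def Yeq)
  qed
  have qsp: "q \<omega> = (LBINT s:{u..v}. (clip c (sp s \<omega>))\<^sup>2)" for \<omega>
    unfolding q_def by (subst sq) (auto simp: clip_0 c)
  have qQ: "(\<integral>\<omega>. \<bar>q \<omega> - Q \<omega>\<bar> \<partial>M) \<le> \<theta>"
  proof -
    have pt: "\<bar>q \<omega> - Q \<omega>\<bar> \<le> 2 * c * sqrt \<eta> * (v - u + 1) + c\<^sup>2 * (v - u) * indicator E1s \<omega>" if w: "\<omega> \<in> space M" for \<omega>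
    proof (cases "\<omega> \<in> E1s")
      case True
      have "\<bar>q \<omega> - Q \<omega>\<bar> \<le> c\<^sup>2 * (v - u)" using qb[of \<omega>] Qb[OF w] by auto
      moreover have "0 \<le> 2 * c * sqrt \<eta> * (v - u + 1)" using c uv eta by simp
      ultimately show ?thesis using True by simp
    next
      case False
      then show ?thesis
        using clipped_square_integral_diff(1)[OF sps[OF w] H's[OF w] uv(2) c eta(4) off] w by (simp add: qsp Q')
    qed
    have "(\<integral>\<omega>. \<bar>q \<omega> - Q \<omega>\<bar> \<partial>M) \<le> (\<integral>\<omega>. 2 * c * sqrt \<eta> * (v - u + 1) + c\<^sup>2 * (v - u) * indicator E1s \<omega> \<partial>M)"
    proof (rule integral_mono)
      show "integrable M (\<lambda>\<omega>. \<bar>q \<omega> - Q \<omega>\<bar>)"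
        using integrable_bounded[OF qm, of "c\<^sup>2 * (v - u)"] integrable_bounded[OF Qm, of "c\<^sup>2 * (v - u)"] qb Qb by auto
      show "integrable M (\<lambda>\<omega>. 2 * c * sqrt \<eta> * (v - u + 1) + c\<^sup>2 * (v - u) * indicator E1s \<omega>)"
        by (intro Bochner_Integration.integrable_add integrable_mult_right integrable_real_indicator) (auto simp: emeasure_eq_measure)
    qed (use pt in auto)
    also have "\<dots> = 2 * c * sqrt \<eta> * (v - u + 1) + c\<^sup>2 * (v - u) * measure M E1s"
      by (subst Bochner_Integration.integral_add) (auto simp: prob_space emeasure_eq_measure sets.Int_space_eq2)
    also have "\<dots> \<le> 2 * c * sqrt \<eta> * (v - u + 1) + c\<^sup>2 * (v - u) * \<eta>"
      using E1 uv by (intro add_left_mono mult_left_mono) auto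
    finally show ?thesis using eta by simp
  qed
  have tail: "measure M {\<omega>\<in>G. \<theta> \<le> \<bar>I v \<omega> - I u \<omega> - S \<omega>\<bar>} \<le> \<theta>"
    if G: "G \<in> sets M" and GH: "\<And>\<omega> s. \<omega> \<in> G \<Longrightarrow> s \<in> {u..v} \<Longrightarrow> \<bar>H s \<omega>\<bar> \<le> c" for G
  proof -
    define \<kappa> where "\<kappa> i \<omega> = \<xi>' i \<omega> - clip c (\<xi>' i \<omega>)" for i \<omega>
    have \<kappa>m: "\<kappa> i \<in> borel_measurable (\<F> (ennreal (T' i)))" if "i < m" for i
      using \<xi>'m[OF that] unfolding \<kappa>_def[abs_def] by measurable
    obtain cc where cc: "\<And>i \<omega>. i < m \<Longrightarrow> \<omega> \<in> space M \<Longrightarrow> \<bar>\<xi> i \<omega>\<bar> \<le> cc i"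
      using \<xi>b by metis
    define C where "C = (\<Sum>i<m. \<bar>cc i\<bar>) + c"
    have \<kappa>b: "\<bar>\<kappa> i \<omega>\<bar> \<le> C" if "i < m" "\<omega> \<in> space M" for i \<omega>
    proof -
      have "\<bar>cc i\<bar> \<le> (\<Sum>i<m. \<bar>cc i\<bar>)" using that by (intro member_le_sum) auto
      then have "\<bar>\<xi>' i \<omega>\<bar> \<le> (\<Sum>i<m. \<bar>cc i\<bar>)" using cc[OF that] by (auto simp: \<xi>'_def)
      then show ?thesis using clb[of i \<omega>] by (simp add: \<kappa>_def C_def)
    qed
    have C0: "0 \<le> C" unfolding C_def using c by (auto intro!: add_nonneg_nonneg sum_nonneg)
    define E3 where "E3 = {\<omega>\<in>space M. (\<Sum>i<m. (\<kappa> i \<omega>)\<^sup>2 * (T' (Suc i) - T' i)) \<le> \<eta> \<and> \<theta>/2 \<le> \<bar>transform_sum T' \<kappa> m \<omega>\<bar>}"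
    have P3: "measure M E3 \<le> \<eta> / (\<theta>/2)\<^sup>2"
      unfolding E3_def using th eta(4) by (intro transform_sum_tail[OF T'0 T'mono \<kappa>m \<kappa>b C0]) auto
    have E3m: "E3 \<in> sets M"
    proof -
      have [measurable]: "transform_sum T' \<kappa> m \<in> borel_measurable M"
        using measurable_F_M[OF transform_sum_moments(1)[where m=m and k=m and T=T' and c=C and \<xi>=\<kappa>, OF T'0 T'mono \<kappa>m \<kappa>b C0 order_refl]] by simp
      have [measurable]: "(\<lambda>\<omega>. \<Sum>i<m. (\<kappa> i \<omega>)\<^sup>2 * (T' (Suc i) - T' i)) \<in> borel_measurable M"
        using measurable_F_M[OF \<kappa>m] by (intro borel_measurable_sum borel_measurable_times borel_measurable_power) auto
      show ?thesis unfolding E3_def by measurable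
    qed
    have "{\<omega>\<in>G. \<theta> \<le> \<bar>I v \<omega> - I u \<omega> - S \<omega>\<bar>} \<subseteq> E1s \<union> (E2s \<union> E3)"
    proof (rule subsetI, rule ccontr)
      fix \<omega> assume "\<omega> \<in> {\<omega>\<in>G. \<theta> \<le> \<bar>I v \<omega> - I u \<omega> - S \<omega>\<bar>}" and n: "\<omega> \<notin> E1s \<union> (E2s \<union> E3)"
      then have wG: "\<omega> \<in> G" and ge: "\<theta> \<le> \<bar>I v \<omega> - I u \<omega> - S \<omega>\<bar>" by auto
      have w: "\<omega> \<in> space M" using wG G sets.sets_into_space by auto
      have rm: "run_max (\<lambda>s. J s \<omega> - I s \<omega>) (ennreal v) < ennreal (\<theta>/4)" using n w by (auto simp: E2s_def not_le)
      have JI: "\<bar>J s \<omega> - I s \<omega>\<bar> < \<theta> / 4" if "0 \<le> s" "s \<le> v" for s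
      proof -
        have "ennreal \<bar>J s \<omega> - I s \<omega>\<bar> < ennreal (\<theta>/4)"
          using le_less_trans[OF run_max_upper rm] that by (auto simp: ennreal_leI)
        then show ?thesis by (simp add: ennreal_less_iff)
      qed
      have "(LBINT s:{u..v}. (sp s \<omega> - clip c (sp s \<omega>))\<^sup>2) \<le> \<eta>"
        using clipped_square_integral_diff(2)[OF sps[OF w] H's[OF w] uv(2) c eta(4) off] n w GH[OF wG] uv
        by (auto simp: H'_eq)
      then have "(\<Sum>i<m. (\<kappa> i \<omega>)\<^sup>2 * (T' (Suc i) - T' i)) \<le> \<eta>"
        using sq[of "\<lambda>x. (x - clip c x)\<^sup>2" \<omega>] by (simp add: \<kappa>_def clip_0 c)
      then have t: "\<bar>transform_sum T' \<kappa> m \<omega>\<bar> < \<theta> / 2" using n w by (auto simp: E3_def)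
      have "J v \<omega> - J u \<omega> = transform_sum T' \<xi> m \<omega>"
        unfolding J_def T'_def[abs_def] by (rule simple_integral_increment[OF uv(2)])
      also have "\<dots> = transform_sum T' \<xi>' m \<omega>"
        unfolding transform_sum_def using drop[of "\<lambda>x. x" \<omega> "\<lambda>t. B t \<omega>"] by simp
      also have "\<dots> = S \<omega> + transform_sum T' \<kappa> m \<omega>"
        unfolding transform_sum_def S_def \<kappa>_def by (simp add: algebra_simps flip: sum.distrib)
      finally have "I v \<omega> - I u \<omega> - S \<omega> = (I v \<omega> - J v \<omega>) + (J u \<omega> - I u \<omega>) + transform_sum T' \<kappa> m \<omega>" by simp
      moreover have "\<bar>J u \<omega> - I u \<omega>\<bar> < \<theta> / 4" "\<bar>J v \<omega> - I v \<omega>\<bar> < \<theta> / 4" using JI uv by auto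
      ultimately show False using ge t by linarith
    qed
    then have "measure M {\<omega>\<in>G. \<theta> \<le> \<bar>I v \<omega> - I u \<omega> - S \<omega>\<bar>} \<le> measure M (E1s \<union> (E2s \<union> E3))"
      using E3m by (intro finite_measure_mono) auto
    also have "\<dots> \<le> measure M E1s + (measure M E2s + measure M E3)"
      using E3m by (intro order_trans[OF measure_Un_le] add_left_mono measure_Un_le) auto
    also have "\<dots> \<le> \<theta>/4 + (\<theta>/4 + \<theta>/2)"
    proof -
      have "\<eta> / (\<theta>/2)\<^sup>2 \<le> \<theta>/2"
        using eta(3) th by (simp add: field_simps power2_eq_square power3_eq_cube)
      then show ?thesis using E1 E2 P3 eta(2) by simp
    qed
    finally show ?thesis by simp
  qed
  show thesis
    by (rule that[OF SM qm qb mart mom(2) S4 _ tail]) (use qQ in \<open>auto simp: Q_def\<close>)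
qed

end

section \<open>Second-order Taylor bounds\<close>

lemma C2_DERIV:
  assumes "C2 f"
  shows "(f has_real_derivative deriv f x) (at x)" "(deriv f has_real_derivative deriv (deriv f) x) (at x)"
  using assms unfolding C2_def by (auto intro: DERIV_deriv_iff_real_differentiable[THEN iffD2])

lemma C2_continuous:
  assumes "C2 f"
  shows "continuous_on S f" "continuous_on S (deriv f)" "continuous_on S (deriv (deriv f))"
proof -
  have "isCont f x" "isCont (deriv f) x" for x using C2_DERIV[OF assms] DERIV_isCont by blast+
  then show "continuous_on S f" "continuous_on S (deriv f)"
    by (auto intro: continuous_at_imp_continuous_on)
  show "continuous_on S (deriv (deriv f))"
    using assms unfolding C2_def by (auto intro: continuous_on_subset)
qed

lemma continuous_bounded_interval:
  fixes f :: "real \<Rightarrow> real"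
  assumes "continuous_on {-R..R} f"
  obtains K where "0 \<le> K" "\<And>x. \<bar>x\<bar> \<le> R \<Longrightarrow> \<bar>f x\<bar> \<le> K"
proof -
  have "bounded (f ` {-R..R})" using assms by (intro compact_imp_bounded compact_continuous_image) auto
  then obtain K where K: "\<And>y. y \<in> f ` {-R..R} \<Longrightarrow> norm y \<le> K" by (auto simp: bounded_iff)
  have "\<bar>f x\<bar> \<le> \<bar>K\<bar>" if "\<bar>x\<bar> \<le> R" for x using K[of "f x"] that by force
  then show thesis by (intro that[of "\<bar>K\<bar>"]) auto
qed

text \<open>Composing with the clipping map gives a bounded Lipschitz function on the line that agrees with \<open>f\<close> on the
interval.\<close>

lemma clipped_C2_bounds:
  assumes f: "C2 f" and R: "0 \<le> R"
  obtains K where "0 \<le> K" "\<And>y. \<bar>f (clip R y)\<bar> \<le> K" "\<And>y z. \<bar>f (clip R y) - f (clip R z)\<bar> \<le> K * \<bar>y - z\<bar>"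
    "\<And>x. \<bar>x\<bar> \<le> R \<Longrightarrow> \<bar>deriv f x\<bar> \<le> K" "\<And>x. \<bar>x\<bar> \<le> R \<Longrightarrow> \<bar>deriv (deriv f) x\<bar> \<le> K"
proof -
  obtain K0 where K0: "0 \<le> K0" "\<And>x. \<bar>x\<bar> \<le> R \<Longrightarrow> \<bar>f x\<bar> \<le> K0"
    using continuous_bounded_interval[OF C2_continuous(1)[OF f]] by metis
  obtain K1 where K1: "0 \<le> K1" "\<And>x. \<bar>x\<bar> \<le> R \<Longrightarrow> \<bar>deriv f x\<bar> \<le> K1"
    using continuous_bounded_interval[OF C2_continuous(2)[OF f]] by metis
  obtain K2 where K2: "0 \<le> K2" "\<And>x. \<bar>x\<bar> \<le> R \<Longrightarrow> \<bar>deriv (deriv f) x\<bar> \<le> K2"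
    using continuous_bounded_interval[OF C2_continuous(3)[OF f]] by metis
  have lip: "\<bar>f x - f y\<bar> \<le> K1 * \<bar>x - y\<bar>" if "\<bar>x\<bar> \<le> R" "\<bar>y\<bar> \<le> R" for x y
  proof -
    have "norm (f x - f y) \<le> K1 * norm (x - y)"
      by (rule field_differentiable_bound[of "{-R..R}" f "deriv f"])
        (use that K1 C2_DERIV(1)[OF f] in \<open>auto intro: has_field_derivative_at_within\<close>)
    then show ?thesis by simp
  qed
  show thesis
  proof (rule that[of "K0 + K1 + K2"])
    fix y z
    show "\<bar>f (clip R y)\<bar> \<le> K0 + K1 + K2" using K0(2)[OF clip_bound[OF R]] K1 K2 by (simp add: add_increasing2)
    have "\<bar>f (clip R y) - f (clip R z)\<bar> \<le> K1 * \<bar>clip R y - clip R z\<bar>"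
      by (rule lip) (auto intro: clip_bound[OF R])
    also have "\<dots> \<le> K1 * \<bar>y - z\<bar>" using K1 clip_lipschitz by (intro mult_left_mono) auto
    also have "\<dots> \<le> (K0 + K1 + K2) * \<bar>y - z\<bar>" using K0 K2 by (intro mult_right_mono) auto
    finally show "\<bar>f (clip R y) - f (clip R z)\<bar> \<le> (K0 + K1 + K2) * \<bar>y - z\<bar>" .
  next
    fix x assume "\<bar>x\<bar> \<le> R"
    then show "\<bar>deriv f x\<bar> \<le> K0 + K1 + K2" "\<bar>deriv (deriv f) x\<bar> \<le> K0 + K1 + K2"
      using K0(1) K1(1) K2(1) K1(2)[of x] K2(2)[of x] by auto
  qed (use K0 K1 K2 in auto)
qed

text \<open>For small \<open>h\<close> the remainder is at most \<open>\<epsilon>h\<^sup>2\<close> by uniform continuity of the second derivative; for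
large \<open>h\<close> all terms are bounded by a multiple of \<open>h\<^sup>4\<close>.  Clipping at \<open>R + 1\<close> leaves room for the small \<open>h\<close>.\<close>

lemma taylor_quartic_remainder:
  assumes f: "C2 f" and R: "0 \<le> R" and e: "0 < \<epsilon>"
  obtains C where "0 \<le> C" "\<And>x h. \<bar>x\<bar> \<le> R \<Longrightarrow>
    \<bar>f (clip (R + 1) (x + h)) - f x - deriv f x * h - 1/2 * deriv (deriv f) x * h\<^sup>2\<bar> \<le> \<epsilon> * h\<^sup>2 + C * h ^ 4"
proof -
  obtain K where K: "0 \<le> K" "\<And>y. \<bar>f (clip (R+1) y)\<bar> \<le> K"
    "\<And>x. \<bar>x\<bar> \<le> R+1 \<Longrightarrow> \<bar>deriv f x\<bar> \<le> K" "\<And>x. \<bar>x\<bar> \<le> R+1 \<Longrightarrow> \<bar>deriv (deriv f) x\<bar> \<le> K"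
    using clipped_C2_bounds[OF f, of "R+1"] R by (metis add_nonneg_nonneg zero_le_one)
  have "uniformly_continuous_on {-(R+1)..R+1} (deriv (deriv f))"
    by (intro compact_uniformly_continuous C2_continuous[OF f]) auto
  then obtain d where d: "d > 0" "\<And>x y. \<bar>x\<bar> \<le> R+1 \<Longrightarrow> \<bar>y\<bar> \<le> R+1 \<Longrightarrow> \<bar>y - x\<bar> < d \<Longrightarrow> \<bar>deriv (deriv f) y - deriv (deriv f) x\<bar> < \<epsilon>"
    unfolding uniformly_continuous_on_def dist_real_def using e by (auto simp: abs_le_iff)
  define \<rho> where "\<rho> = min d 1"
  have \<rho>: "0 < \<rho>" "\<rho> \<le> 1" "\<rho> \<le> d" using d by (auto simp: \<rho>_def)
  define C where "C = (2 * K + K + K) / \<rho> ^ 4"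
  have C0: "0 \<le> C" using K \<rho> by (simp add: C_def)
  show thesis
  proof (rule that[OF C0])
    fix x h :: real assume x: "\<bar>x\<bar> \<le> R"
    have nn: "0 \<le> \<epsilon> * h\<^sup>2" "0 \<le> C * h ^ 4" using e C0 by auto
    show "\<bar>f (clip (R + 1) (x + h)) - f x - deriv f x * h - 1/2 * deriv (deriv f) x * h\<^sup>2\<bar> \<le> \<epsilon> * h\<^sup>2 + C * h ^ 4"
    proof (cases "\<bar>h\<bar> < \<rho>")
      case True
      then have xh: "\<bar>x + h\<bar> \<le> R + 1" using x \<rho> by auto
      have "\<exists>t. \<bar>t - x\<bar> \<le> \<bar>h\<bar> \<and> f (x + h) = f x + deriv f x * h + 1/2 * deriv (deriv f) t * h\<^sup>2"
      proof (cases "h = 0")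
        case False
        let ?diff = "\<lambda>m. (deriv ^^ m) f"
        have D: "\<forall>m t. m < 2 \<and> x - 1 \<le> t \<and> t \<le> x + 1 \<longrightarrow> DERIV (?diff m) t :> ?diff (Suc m) t"
        proof (intro allI impI)
          fix m :: nat and t assume "m < 2 \<and> x - 1 \<le> t \<and> t \<le> x + 1"
          then have "m = 0 \<or> m = 1" by auto
          then show "DERIV (?diff m) t :> ?diff (Suc m) t" using C2_DERIV[OF f] by auto
        qed
        have "\<exists>t. (if x + h < x then x + h < t \<and> t < x else x < t \<and> t < x + h) \<and>
          f (x + h) = (\<Sum>m<2. ?diff m x / fact m * (x + h - x) ^ m) + ?diff 2 t / fact 2 * (x + h - x)\<^sup>2"
          by (rule Taylor[OF _ _ D]) (use True \<rho> False in auto)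
        then obtain t where t: "if x + h < x then x + h < t \<and> t < x else x < t \<and> t < x + h"
          "f (x + h) = (\<Sum>m<2. ?diff m x / fact m * (x + h - x) ^ m) + ?diff 2 t / fact 2 * (x + h - x)\<^sup>2" by blast
        have "\<bar>t - x\<bar> \<le> \<bar>h\<bar>" using t(1) by (auto split: if_splits)
        moreover have "f (x + h) = f x + deriv f x * h + 1/2 * deriv (deriv f) t * h\<^sup>2"
          using t(2) by (simp add: numeral_2_eq_2)
        ultimately show ?thesis by blast
      qed (auto intro: exI[of _ x])
      then obtain t where t: "\<bar>t - x\<bar> \<le> \<bar>h\<bar>" "f (x + h) = f x + deriv f x * h + 1/2 * deriv (deriv f) t * h\<^sup>2" by blast
      have "\<bar>deriv (deriv f) t - deriv (deriv f) x\<bar> < \<epsilon>"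
        using t(1) x True \<rho> by (intro d(2)) auto
      moreover have "f (clip (R+1) (x + h)) - f x - deriv f x * h - 1/2 * deriv (deriv f) x * h\<^sup>2
         = 1/2 * (deriv (deriv f) t - deriv (deriv f) x) * h\<^sup>2"
        using t(2) clip_id[OF xh] by (simp add: algebra_simps)
      ultimately have "\<bar>f (clip (R + 1) (x + h)) - f x - deriv f x * h - 1/2 * deriv (deriv f) x * h\<^sup>2\<bar> \<le> 1/2 * \<epsilon> * h\<^sup>2"
        by (simp only: abs_mult) (auto intro!: mult_right_mono mult_mono)
      also have "\<dots> \<le> \<epsilon> * h\<^sup>2" using e by (intro mult_right_mono) auto
      finally show ?thesis using nn by linarith
    next
      case False
      then have h: "\<rho> \<le> \<bar>h\<bar>" by simp
      \<comment> \<open>Here \<open>C h\<^sup>4 = 4 K z\<^sup>4\<close>, and each of the four terms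
        is at most \<open>K z\<^sup>4\<close>.\<close>
      define z where "z = \<bar>h\<bar> / \<rho>"
      have z: "1 \<le> z" using h \<rho> by (simp add: z_def)
      have hz: "\<bar>h\<bar> \<le> z" using h \<rho> mult_right_le_one_le[of "\<bar>h\<bar>" \<rho>] by (simp add: z_def field_simps)
      have z4: "1 \<le> z ^ 4" "z \<le> z ^ 4" "z\<^sup>2 \<le> z ^ 4"
        using z power_increasing[of 1 4 z] power_increasing[of 2 4 z] by auto
      have fx: "\<bar>f x\<bar> \<le> K" using K(2)[of x] clip_id[of x "R+1"] x by simp
      have "h\<^sup>2 \<le> z\<^sup>2" using hz z by (simp add: abs_le_square_iff[symmetric])
      then have b2: "\<bar>1/2 * deriv (deriv f) x * h\<^sup>2\<bar> \<le> K * z ^ 4"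
        unfolding abs_mult using K(1) K(4)[of x] x z4 by (intro mult_mono) auto
      have b1: "\<bar>deriv f x * h\<bar> \<le> K * z ^ 4"
        unfolding abs_mult using K(1) K(3)[of x] x z4 hz by (intro mult_mono) auto
      have b0: "K \<le> K * z ^ 4" using K(1) z4 by (simp add: mult_le_cancel_left1)
      have "C * h ^ 4 = 2 * (K * z ^ 4) + K * z ^ 4 + K * z ^ 4"
        by (simp add: C_def z_def power_divide field_simps)
      then show ?thesis using b0 b1 b2 fx K(2)[of "x + h"] nn by linarith
    qed
  qed
qed

text \<open>The increment is split into a drift part \<open>a\<close> and a martingale part \<open>S\<close>.  The term \<open>\<epsilon>S\<^sup>2\<close> has expectation of the order
of \<open>\<epsilon>\<close> times the length of the time interval; the terms in \<open>a\<^sup>2\<close> and \<open>S\<^sup>4\<close> vanish in the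
limit of fine partitions.  The second bound is for the one interval during which a path is stopped: there it is enough that
the increment is at most \<open>\<epsilon>\<close> up to a term in \<open>S\<^sup>4\<close>.\<close>

lemma increment_quartic_bounds:
  assumes f: "C2 f" and R: "0 \<le> R" and m: "0 \<le> m" and e: "0 < \<epsilon>"
  obtains C where "0 \<le> C"
    "\<And>x a S. \<bar>x\<bar> \<le> R \<Longrightarrow> \<bar>a\<bar> \<le> m \<Longrightarrow> deriv f x * a + deriv f x * S + 1/2 * deriv (deriv f) x * S\<^sup>2
      \<le> f (clip (R+1) (x + a + S)) - f x + \<epsilon> * S\<^sup>2 + C * a\<^sup>2 + C * S ^ 4"
    "\<And>x S. \<bar>x\<bar> \<le> R \<Longrightarrow> f (clip (R+1) (x + S)) - f x \<le> \<epsilon> + C * S ^ 4"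
proof -
  obtain K where K: "0 \<le> K" "\<And>x. \<bar>x\<bar> \<le> R \<Longrightarrow> \<bar>deriv f x\<bar> \<le> K" "\<And>x. \<bar>x\<bar> \<le> R \<Longrightarrow> \<bar>deriv (deriv f) x\<bar> \<le> K"
    using clipped_C2_bounds[OF f R] by metis
  obtain C0 where C0: "0 \<le> C0" "\<And>x h. \<bar>x\<bar> \<le> R \<Longrightarrow>
    \<bar>f (clip (R + 1) (x + h)) - f x - deriv f x * h - 1/2 * deriv (deriv f) x * h\<^sup>2\<bar> \<le> \<epsilon>/4 * h\<^sup>2 + C0 * h ^ 4"
    using taylor_quartic_remainder[OF f R, of "\<epsilon>/4"] e by auto
  define \<kappa> where "\<kappa> = \<epsilon> / (2 * (K + 1))"
  have l0: "0 < \<kappa>" "K * \<kappa> \<le> \<epsilon> / 2" using e K by (auto simp: \<kappa>_def field_simps)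
  define \<mu> where "\<mu> = \<epsilon> / (2 * K + \<epsilon> / 4 + 1)"
  have mu: "0 < \<mu>" "(K + (K + \<epsilon>/4)) * \<mu> \<le> \<epsilon>" using e K
    by (auto simp: \<mu>_def field_simps add_pos_nonneg)
  define C1 where "C1 = K / \<kappa> + K + \<epsilon> + 8 * C0 * m\<^sup>2"
  define C2' where "C2' = K / \<mu> ^ 3 + (K + \<epsilon> / 4) / \<mu> + C0"
  define C where "C = C1 + C2' + 8 * C0"
  have nn: "0 \<le> C1" "0 \<le> C2'" unfolding C1_def C2'_def using e K C0 l0 mu by (auto intro!: add_nonneg_nonneg divide_nonneg_nonneg)
  show thesis
  proof (rule that[of C])
    show "0 \<le> C" unfolding C_def using nn C0 by auto
  next
    fix x a S :: real assume x: "\<bar>x\<bar> \<le> R" and a: "\<bar>a\<bar> \<le> m"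
    let ?h = "a + S" and ?d = "deriv f x" and ?dd = "deriv (deriv f) x"
    have T: "?d * ?h + 1/2 * ?dd * ?h\<^sup>2 \<le> f (clip (R + 1) (x + ?h)) - f x + (\<epsilon>/4 * ?h\<^sup>2 + C0 * ?h ^ 4)"
      using C0(2)[OF x, of ?h] by linarith
    have eq: "1/2 * ?dd * ?h\<^sup>2 = 1/2 * ?dd * S\<^sup>2 + ?dd * (a * S) + 1/2 * ?dd * a\<^sup>2"
      by (simp add: power2_eq_square algebra_simps)
    have h2: "?h\<^sup>2 \<le> 2 * a\<^sup>2 + 2 * S\<^sup>2" using sum_squares_bound[of a S] by (simp add: power2_sum)
    have "?h ^ 4 = (?h\<^sup>2)\<^sup>2" by simp
    also have "\<dots> \<le> (2 * a\<^sup>2 + 2 * S\<^sup>2)\<^sup>2" using h2 by (intro power_mono) auto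
    also have "\<dots> \<le> 2 * (2 * a\<^sup>2)\<^sup>2 + 2 * (2 * S\<^sup>2)\<^sup>2"
      using sum_squares_bound[of "2 * a\<^sup>2" "2 * S\<^sup>2"] by (simp add: power2_sum)
    also have "\<dots> = 8 * (a\<^sup>2 * a\<^sup>2) + 8 * S ^ 4" by (simp add: power2_eq_square eval_nat_numeral)
    also have "\<dots> \<le> 8 * (m\<^sup>2 * a\<^sup>2) + 8 * S ^ 4"
      using a m by (intro add_mono mult_left_mono mult_right_mono) (auto simp: abs_le_square_iff[symmetric])
    finally have h4: "?h ^ 4 \<le> 8 * (m\<^sup>2 * a\<^sup>2) + 8 * S ^ 4" .
    have aS: "\<bar>a * S\<bar> \<le> \<kappa> * S\<^sup>2 + 1/2 * (a\<^sup>2 / \<kappa>)"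
    proof -
      have "2 * (\<bar>a\<bar> * (\<kappa> * \<bar>S\<bar>)) \<le> a\<^sup>2 + (\<kappa> * \<bar>S\<bar>)\<^sup>2"
        using sum_squares_bound[of "\<bar>a\<bar>" "\<kappa> * \<bar>S\<bar>"] by (simp add: mult_ac)
      then have "\<kappa> * (2 * \<bar>a * S\<bar>) \<le> \<kappa> * (a\<^sup>2 / \<kappa> + \<kappa> * S\<^sup>2)"
        using l0 by (simp add: abs_mult power_mult_distrib power2_eq_square algebra_simps)
      then have "2 * \<bar>a * S\<bar> \<le> a\<^sup>2 / \<kappa> + \<kappa> * S\<^sup>2" using l0 by (simp add: mult_le_cancel_left_pos)
      moreover have "0 \<le> \<kappa> * S\<^sup>2" using l0 by simp
      ultimately show ?thesis by linarith
    qed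
    have "\<bar>?dd * (a * S)\<bar> \<le> K * (\<kappa> * S\<^sup>2 + 1/2 * (a\<^sup>2 / \<kappa>))"
      unfolding abs_mult[of ?dd] using K(3)[OF x] aS K(1) by (intro mult_mono) auto
    also have "\<dots> = (K * \<kappa>) * S\<^sup>2 + K / \<kappa> / 2 * a\<^sup>2" by (simp add: algebra_simps)
    also have "\<dots> \<le> \<epsilon> / 2 * S\<^sup>2 + K / \<kappa> * a\<^sup>2"
      using l0 K by (intro add_mono mult_right_mono) (auto simp: field_simps)
    finally have t1: "\<bar>?dd * (a * S)\<bar> \<le> \<epsilon> / 2 * S\<^sup>2 + K / \<kappa> * a\<^sup>2" .
    have t2: "\<bar>1/2 * ?dd * a\<^sup>2\<bar> \<le> K * a\<^sup>2"
      unfolding abs_mult using K(3)[OF x] by (intro mult_mono) auto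
    have t3: "\<epsilon>/4 * ?h\<^sup>2 \<le> \<epsilon>/4 * (2 * a\<^sup>2 + 2 * S\<^sup>2)" using h2 e by (intro mult_left_mono) auto
    have t4: "C0 * ?h ^ 4 \<le> C0 * (8 * (m\<^sup>2 * a\<^sup>2) + 8 * S ^ 4)" using h4 C0 by (intro mult_left_mono) auto
    have "?d * a + ?d * S + 1/2 * ?dd * S\<^sup>2
       \<le> f (clip (R + 1) (x + ?h)) - f x + (\<epsilon>/4 * (2 * a\<^sup>2 + 2 * S\<^sup>2)) + C0 * (8 * (m\<^sup>2 * a\<^sup>2) + 8 * S ^ 4)
         + (\<epsilon> / 2 * S\<^sup>2 + K / \<kappa> * a\<^sup>2) + K * a\<^sup>2"
      using T eq t1 t2 t3 t4 by (simp only: distrib_left)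
    also have "\<dots> \<le> f (clip (R + 1) (x + ?h)) - f x + \<epsilon> * S\<^sup>2 + C1 * a\<^sup>2 + 8 * C0 * S ^ 4"
      using e by (simp add: C1_def algebra_simps)
    also have "\<dots> \<le> f (clip (R + 1) (x + ?h)) - f x + \<epsilon> * S\<^sup>2 + C * a\<^sup>2 + C * S ^ 4"
      using nn C0 by (intro add_mono mult_right_mono) (auto simp: C_def)
    finally show "?d * a + ?d * S + 1/2 * ?dd * S\<^sup>2
      \<le> f (clip (R+1) (x + a + S)) - f x + \<epsilon> * S\<^sup>2 + C * a\<^sup>2 + C * S ^ 4" by (simp add: add.assoc)
  next
    fix x S :: real assume x: "\<bar>x\<bar> \<le> R"
    let ?d = "deriv f x" and ?dd = "deriv (deriv f) x"
    have S2: "S\<^sup>2 \<le> \<mu> + S ^ 4 / \<mu>"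
    proof -
      have "2 * (\<mu> * S\<^sup>2) \<le> \<mu>\<^sup>2 + S ^ 4" using sum_squares_bound[of \<mu> "S\<^sup>2"] by simp
      moreover have "0 \<le> \<mu> * S\<^sup>2" using mu by simp
      ultimately have "\<mu> * S\<^sup>2 \<le> \<mu>\<^sup>2 + S ^ 4" by linarith
      then have "\<mu> * S\<^sup>2 \<le> \<mu> * (\<mu> + S ^ 4 / \<mu>)" using mu by (simp add: power2_eq_square algebra_simps)
      then show ?thesis using mu by (simp add: mult_le_cancel_left_pos)
    qed
    have S1: "\<bar>S\<bar> \<le> \<mu> + S ^ 4 / \<mu> ^ 3"
    proof (cases "\<bar>S\<bar> \<le> \<mu>")
      case True
      then show ?thesis using mu by (simp add: add_increasing2)
    next
      case False
      then have "\<mu> ^ 3 * \<bar>S\<bar> \<le> \<bar>S\<bar> ^ 3 * \<bar>S\<bar>" using mu by (intro mult_right_mono power_mono) auto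
      also have "\<dots> = S ^ 4" by (metis abs_ge_zero power_Suc2 power_even_abs eval_nat_numeral(2,3) even_numeral semiring_norm(26) semiring_norm(27) eval_nat_numeral(1))
      finally have "\<bar>S\<bar> \<le> S ^ 4 / \<mu> ^ 3" using mu by (simp add: field_simps)
      then show ?thesis using mu by simp
    qed
    have "\<bar>f (clip (R+1) (x + S)) - f x\<bar> \<le> \<bar>?d * S\<bar> + \<bar>1/2 * ?dd * S\<^sup>2\<bar> + (\<epsilon>/4 * S\<^sup>2 + C0 * S ^ 4)"
      using C0(2)[OF x, of S] by linarith
    also have "\<dots> \<le> K * (\<mu> + S ^ 4 / \<mu> ^ 3) + K * S\<^sup>2 + (\<epsilon>/4 * S\<^sup>2 + C0 * S ^ 4)"
      unfolding abs_mult using K(1) K(2)[OF x] K(3)[OF x] S1 by (intro add_mono mult_mono order_refl) auto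
    also have "\<dots> = K * \<mu> + K * (S ^ 4 / \<mu> ^ 3) + (K + \<epsilon>/4) * S\<^sup>2 + C0 * S ^ 4" by (simp add: algebra_simps)
    also have "\<dots> \<le> K * \<mu> + K * (S ^ 4 / \<mu> ^ 3) + (K + \<epsilon>/4) * (\<mu> + S ^ 4 / \<mu>) + C0 * S ^ 4"
      using S2 K(1) e C0(1) by (intro add_mono mult_left_mono) auto
    also have "\<dots> = (K + (K + \<epsilon>/4)) * \<mu> + C2' * S ^ 4" by (simp add: C2'_def algebra_simps)
    also have "\<dots> \<le> \<epsilon> + C * S ^ 4"
      using mu(2) nn C0 by (intro add_mono mult_right_mono) (auto simp: C_def)
    finally show "f (clip (R+1) (x + S)) - f x \<le> \<epsilon> + C * S ^ 4" by linarith
  qed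
qed

section \<open>The Ito inequality over one short interval\<close>

context brownian_filtration begin

text \<open>Ito's formula in expectation over one interval, with the errors made explicit.  Here \<open>Gu\<close> is the
event that the path has not been stopped by time \<open>u\<close>, and \<open>Gv\<close> that it has not been stopped by time \<open>v\<close>.  The
increment of \<open>f(X)\<close> is taken only on \<open>Gv\<close>, where \<open>X\<close> has stayed in the interval and the
approximation of the Ito integral is valid.  The martingale terms need an event known at time \<open>u\<close>, namely \<open>Gu\<close>;
the difference between the two events costs \<open>\<epsilon> P(Gu - Gv)\<close>, and these probabilities add up to at most 1.\<close>

lemma drift_increment_inequality:
  fixes x y a :: "'a \<Rightarrow> real"
  assumes ito: "ito_integral M \<F> B H I" and uv: "0 \<le> u" "u \<le> v" and c: "0 \<le> c"
    and f: "C2 f" and R: "0 \<le> R" and e: "0 < \<epsilon>" and C: "0 \<le> C"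
    and step1: "\<And>x a S. \<bar>x\<bar> \<le> R \<Longrightarrow> \<bar>a\<bar> \<le> m \<Longrightarrow> deriv f x * a + deriv f x * S + 1/2 * deriv (deriv f) x * S\<^sup>2
      \<le> f (clip (R+1) (x + a + S)) - f x + \<epsilon> * S\<^sup>2 + C * a\<^sup>2 + C * S ^ 4"
    and step2: "\<And>x S. \<bar>x\<bar> \<le> R \<Longrightarrow> f (clip (R+1) (x + S)) - f x \<le> \<epsilon> + C * S ^ 4"
    and x: "x \<in> borel_measurable (\<F> (ennreal u))" and y: "y \<in> borel_measurable M"
    and Gu: "Gu \<in> sets (\<F> (ennreal u))" and Gv: "Gv \<in> sets M" "Gv \<subseteq> Gu"
    and xR: "\<And>\<omega>. \<omega> \<in> Gu \<Longrightarrow> \<bar>x \<omega>\<bar> \<le> R" and yR: "\<And>\<omega>. \<omega> \<in> Gv \<Longrightarrow> \<bar>y \<omega>\<bar> \<le> R"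
    and HR: "\<And>\<omega> s. \<omega> \<in> Gv \<Longrightarrow> s \<in> {u..v} \<Longrightarrow> \<bar>H s \<omega>\<bar> \<le> c"
    and am: "a \<in> borel_measurable M" "\<And>\<omega>. \<omega> \<in> space M \<Longrightarrow> \<bar>a \<omega>\<bar> \<le> m"
    and a0: "\<And>\<omega>. \<omega> \<in> space M - Gv \<Longrightarrow> a \<omega> = 0"
    and sde: "AE \<omega> in M. \<omega> \<in> Gv \<longrightarrow> y \<omega> = x \<omega> + a \<omega> + (I v \<omega> - I u \<omega>)"
  shows "(\<integral>\<omega>. indicator Gu \<omega> * (deriv f (x \<omega>) * a \<omega> + 1/2 * deriv (deriv f) (x \<omega>) * (LBINT s:{u..v}. (clip c (H s \<omega>))\<^sup>2)) \<partial>M)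
    \<le> (\<integral>\<omega>. indicator Gv \<omega> * (f (y \<omega>) - f (x \<omega>)) \<partial>M) + \<epsilon> * measure M (Gu - Gv)
      + \<epsilon> * (c\<^sup>2 * (v - u)) + C * (\<integral>\<omega>. (a \<omega>)\<^sup>2 \<partial>M) + 6 * C * c ^ 4 * (v - u)\<^sup>2"
    (is "?L \<le> ?R")
proof -
  obtain K where K: "0 \<le> K" "\<And>y. \<bar>f (clip (R+1) y)\<bar> \<le> K"
    "\<And>y z. \<bar>f (clip (R+1) y) - f (clip (R+1) z)\<bar> \<le> K * \<bar>y - z\<bar>"
    "\<And>x. \<bar>x\<bar> \<le> R+1 \<Longrightarrow> \<bar>deriv f x\<bar> \<le> K" "\<And>x. \<bar>x\<bar> \<le> R+1 \<Longrightarrow> \<bar>deriv (deriv f) x\<bar> \<le> K"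
    using clipped_C2_bounds[OF f, of "R+1"] R by (metis add_nonneg_nonneg zero_le_one)
  define Q where "Q \<omega> = (LBINT s:{u..v}. (clip c (H s \<omega>))\<^sup>2)" for \<omega>
  have v0: "0 \<le> v" using uv by simp
  have prog: "progressive \<F> H" and Ica: "continuous_adapted M \<F> I" using ito by (auto simp: ito_integral_def)
  have [measurable]: "f \<in> borel_measurable borel" "deriv f \<in> borel_measurable borel" "deriv (deriv f) \<in> borel_measurable borel"
    using C2_continuous[OF f] by (auto intro: borel_measurable_continuous_onI)
  have xM[measurable]: "x \<in> borel_measurable M" by (rule measurable_F_M[OF x])
  have GuM[measurable]: "Gu \<in> sets M" using Gu sets_F_subset by blast
  have [measurable]: "I u \<in> borel_measurable M" "I v \<in> borel_measurable M"
    using Ica uv(1) v0 unfolding continuous_adapted_def by (blast intro: measurable_F_M)+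
  note [measurable] = y Gv(1) am(1)
  have Qm[measurable]: "Q \<in> borel_measurable M" and Qb: "\<And>\<omega>. \<omega> \<in> space M \<Longrightarrow> 0 \<le> Q \<omega> \<and> Q \<omega> \<le> c\<^sup>2 * (v - u)"
    unfolding Q_def[abs_def] by (rule progressive_clipped_square_integral[OF prog uv c]; assumption?)+
  define p where "p \<omega> = indicator Gu \<omega> * deriv f (x \<omega>)" for \<omega>
  define r where "r \<omega> = 1/2 * (indicator Gu \<omega> * deriv (deriv f) (x \<omega>))" for \<omega>
  have p: "p \<in> borel_measurable (\<F> (ennreal u))" and r: "r \<in> borel_measurable (\<F> (ennreal u))"
    unfolding p_def[abs_def] r_def[abs_def] using x Gu by measurable
  have pK: "\<bar>p \<omega>\<bar> \<le> K" and rK: "\<bar>r \<omega>\<bar> \<le> K" for \<omega>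
    using xR[of \<omega>] K(1) K(4)[of "x \<omega>"] K(5)[of "x \<omega>"] by (auto simp: p_def r_def indicator_def abs_mult)
  have [measurable]: "p \<in> borel_measurable M" "r \<in> borel_measurable M" using p r measurable_F_M by auto
  have ipa: "integrable M (\<lambda>\<omega>. p \<omega> * a \<omega>)"
    using pK am(2) K(1) by (intro integrable_bounded[where K="K * m"]) (auto simp: abs_mult intro!: mult_mono)
  have irQ: "integrable M (\<lambda>\<omega>. r \<omega> * Q \<omega>)"
    using rK Qb K(1) by (intro integrable_bounded[where K="K * (c\<^sup>2 * (v - u))"]) (auto simp: abs_mult intro!: mult_mono)
  have ia2: "integrable M (\<lambda>\<omega>. (a \<omega>)\<^sup>2)"
    using am(2) by (intro integrable_bounded[where K="m\<^sup>2"]) (auto simp: abs_le_square_iff[symmetric] intro: order_trans[OF _ abs_ge_self])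
  have ify: "integrable M (\<lambda>\<omega>. indicator Gv \<omega> * (f (y \<omega>) - f (x \<omega>)))"
  proof (rule integrable_bounded[where K="2 * K"])
    fix \<omega>
    show "\<bar>indicator Gv \<omega> * (f (y \<omega>) - f (x \<omega>))\<bar> \<le> 2 * K"
    proof (cases "\<omega> \<in> Gv")
      case True
      then have "\<bar>x \<omega>\<bar> \<le> R+1" "\<bar>y \<omega>\<bar> \<le> R+1" using xR[of \<omega>] yR[of \<omega>] Gv by auto
      then show ?thesis using True K(2)[of "x \<omega>"] K(2)[of "y \<omega>"] by (simp add: clip_id)
    qed (use K in simp)
  qed measurable
  \<comment> \<open>The approximation of the Ito integral costs a multiple of
    \<open>\<theta>\<close>, which is removed at the end.\<close>
  have main: "?L \<le> ?R + 4 * K * \<theta>" if th: "0 < \<theta>" for \<theta>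
  proof -
    obtain S q where
      SM[measurable]: "S \<in> borel_measurable M" and qM[measurable]: "q \<in> borel_measurable M"
      and qb: "\<And>\<omega>. \<omega> \<in> space M \<Longrightarrow> 0 \<le> q \<omega> \<and> q \<omega> \<le> c\<^sup>2 * (v - u)"
      and mart: "\<And>h K. h \<in> borel_measurable (\<F> (ennreal u)) \<Longrightarrow> (\<And>\<omega>. \<omega> \<in> space M \<Longrightarrow> \<bar>h \<omega>\<bar> \<le> K) \<Longrightarrow>
        (\<integral>\<omega>. h \<omega> * S \<omega> \<partial>M) = 0 \<and> (\<integral>\<omega>. h \<omega> * (S \<omega>)\<^sup>2 \<partial>M) = (\<integral>\<omega>. h \<omega> * q \<omega> \<partial>M)"
      and S4: "integrable M (\<lambda>\<omega>. S \<omega> ^ 4)" "(\<integral>\<omega>. S \<omega> ^ 4 \<partial>M) \<le> 3 * c ^ 4 * (v - u)\<^sup>2"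
      and qQ: "(\<integral>\<omega>. \<bar>q \<omega> - Q \<omega>\<bar> \<partial>M) \<le> \<theta>"
      and tail: "\<And>G. G \<in> sets M \<Longrightarrow> (\<And>\<omega> s. \<omega> \<in> G \<Longrightarrow> s \<in> {u..v} \<Longrightarrow> \<bar>H s \<omega>\<bar> \<le> c) \<Longrightarrow>
        measure M {\<omega>\<in>G. \<theta> \<le> \<bar>I v \<omega> - I u \<omega> - S \<omega>\<bar>} \<le> \<theta>"
      unfolding Q_def by (rule ito_increment_approx[OF ito uv c th]) blast
    \<comment> \<open>The part of \<open>Gv\<close> on which the approximation of the increment
      fails.\<close>
    define bad where "bad = {\<omega>\<in>Gv. \<theta> \<le> \<bar>I v \<omega> - I u \<omega> - S \<omega>\<bar>}"
    have badM[measurable]: "bad \<in> sets M"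
    proof -
      have "bad = Gv \<inter> {\<omega>\<in>space M. \<theta> \<le> \<bar>I v \<omega> - I u \<omega> - S \<omega>\<bar>}"
        using sets.sets_into_space[OF Gv(1)] by (auto simp: bad_def)
      then show ?thesis by simp
    qed
    have Pbad: "measure M bad \<le> \<theta>" unfolding bad_def by (rule tail[OF Gv(1) HR])
    have S2i: "integrable M (\<lambda>\<omega>. (S \<omega>)\<^sup>2)"
      using integrable_bounded_mult_power[of "\<lambda>_. 1" 1 S 2] S4(1) by simp
    have pS: "integrable M (\<lambda>\<omega>. p \<omega> * S \<omega>)" and rS: "integrable M (\<lambda>\<omega>. r \<omega> * (S \<omega>)\<^sup>2)"
      using integrable_bounded_mult_power[of p K S 1] integrable_bounded_mult_power[of r K S 2] S4(1) pK rK by simp_all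
    have iq: "integrable M q" using qb by (intro integrable_bounded[where K="c\<^sup>2 * (v-u)"]) auto
    have rq: "integrable M (\<lambda>\<omega>. r \<omega> * q \<omega>)"
      using rK qb K(1) by (intro integrable_bounded[where K="K * (c\<^sup>2 * (v - u))"]) (auto simp: abs_mult intro!: mult_mono)
    have iqQ: "integrable M (\<lambda>\<omega>. \<bar>q \<omega> - Q \<omega>\<bar>)"
      using qb Qb by (intro integrable_bounded[where K="2 * (c\<^sup>2 * (v - u))"]) fastforce+
    have ES2: "(\<integral>\<omega>. (S \<omega>)\<^sup>2 \<partial>M) \<le> c\<^sup>2 * (v - u)"
    proof -
      have "(\<integral>\<omega>. (S \<omega>)\<^sup>2 \<partial>M) = (\<integral>\<omega>. q \<omega> \<partial>M)" using mart[of "\<lambda>_. 1" 1] by simp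
      also have "\<dots> \<le> (\<integral>\<omega>. c\<^sup>2 * (v - u) \<partial>M)" using iq qb by (intro integral_mono) auto
      finally show ?thesis by (simp add: prob_space)
    qed
    have "(\<integral>\<omega>. r \<omega> * Q \<omega> \<partial>M) - (\<integral>\<omega>. r \<omega> * q \<omega> \<partial>M) = (\<integral>\<omega>. r \<omega> * Q \<omega> - r \<omega> * q \<omega> \<partial>M)"
      using irQ rq by simp
    also have "\<dots> \<le> (\<integral>\<omega>. K * \<bar>q \<omega> - Q \<omega>\<bar> \<partial>M)"
    proof (rule integral_mono)
      fix \<omega>
      have "r \<omega> * Q \<omega> - r \<omega> * q \<omega> \<le> \<bar>r \<omega> * (Q \<omega> - q \<omega>)\<bar>" by (simp add: algebra_simps)
      also have "\<dots> \<le> K * \<bar>q \<omega> - Q \<omega>\<bar>"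
        unfolding abs_mult using rK K(1) by (intro mult_mono) auto
      finally show "r \<omega> * Q \<omega> - r \<omega> * q \<omega> \<le> K * \<bar>q \<omega> - Q \<omega>\<bar>" .
    qed (use irQ rq iqQ in auto)
    also have "\<dots> \<le> K * \<theta>" using qQ K(1) by (simp add: mult_left_mono)
    finally have rQq: "(\<integral>\<omega>. r \<omega> * Q \<omega> \<partial>M) \<le> (\<integral>\<omega>. r \<omega> * q \<omega> \<partial>M) + K * \<theta>" by simp
    have ineq: "AE \<omega> in M. p \<omega> * a \<omega> + (p \<omega> * S \<omega> + r \<omega> * (S \<omega>)\<^sup>2)
      \<le> indicator Gv \<omega> * (f (y \<omega>) - f (x \<omega>)) + (K * \<theta> + (2 * K * indicator bad \<omega> + (\<epsilon> * indicator (Gu - Gv) \<omega>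
        + (2 * C * S \<omega> ^ 4 + (\<epsilon> * (S \<omega>)\<^sup>2 + C * (a \<omega>)\<^sup>2)))))"
      using sde AE_space
    proof eventually_elim
      fix \<omega> assume sde: "\<omega> \<in> Gv \<longrightarrow> y \<omega> = x \<omega> + a \<omega> + (I v \<omega> - I u \<omega>)" and w: "\<omega> \<in> space M"
      have nn: "0 \<le> C * S \<omega> ^ 4" "0 \<le> \<epsilon> * (S \<omega>)\<^sup>2" "0 \<le> C * (a \<omega>)\<^sup>2" "0 \<le> K * \<theta>" "0 \<le> 2 * K"
        using C e K(1) th by auto
      show "p \<omega> * a \<omega> + (p \<omega> * S \<omega> + r \<omega> * (S \<omega>)\<^sup>2)
      \<le> indicator Gv \<omega> * (f (y \<omega>) - f (x \<omega>)) + (K * \<theta> + (2 * K * indicator bad \<omega> + (\<epsilon> * indicator (Gu - Gv) \<omega>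
        + (2 * C * S \<omega> ^ 4 + (\<epsilon> * (S \<omega>)\<^sup>2 + C * (a \<omega>)\<^sup>2)))))"
      proof (cases "\<omega> \<in> Gu")
        case False
        then have "\<omega> \<notin> Gv" "\<omega> \<notin> bad" using Gv by (auto simp: bad_def)
        then show ?thesis using False nn by (simp add: p_def r_def)
      next
        case True
        have s1: "p \<omega> * a \<omega> + (p \<omega> * S \<omega> + r \<omega> * (S \<omega>)\<^sup>2)
          \<le> f (clip (R+1) (x \<omega> + a \<omega> + S \<omega>)) - f (x \<omega>) + \<epsilon> * (S \<omega>)\<^sup>2 + C * (a \<omega>)\<^sup>2 + C * S \<omega> ^ 4"
          using step1[OF xR[OF True] am(2)[OF w], of "S \<omega>"] True by (simp add: p_def r_def)
        show ?thesis
        proof (cases "\<omega> \<in> Gv")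
          case False
          have az: "a \<omega> = 0" using a0 False w by simp
          have "\<omega> \<notin> bad" using False by (simp add: bad_def)
          then show ?thesis
            using s1 step2[OF xR[OF True], of "S \<omega>"] False True nn az by simp
        next
          case Gvw: True
          have yy: "f (y \<omega>) = f (clip (R+1) (y \<omega>))" using yR[OF Gvw] by (simp add: clip_id)
          have "f (clip (R+1) (x \<omega> + a \<omega> + S \<omega>)) - f (y \<omega>) \<le> K * \<theta> + 2 * K * indicator bad \<omega>"
          proof (cases "\<omega> \<in> bad")
            case True
            then show ?thesis using K(2)[of "x \<omega> + a \<omega> + S \<omega>"] K(2)[of "y \<omega>"] yy nn by simp
          next
            case False
            then have "\<bar>I v \<omega> - I u \<omega> - S \<omega>\<bar> \<le> \<theta>" using Gvw by (auto simp: bad_def)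
            then have "\<bar>x \<omega> + a \<omega> + S \<omega> - y \<omega>\<bar> \<le> \<theta>" using sde Gvw by auto
            then have "K * \<bar>x \<omega> + a \<omega> + S \<omega> - y \<omega>\<bar> \<le> K * \<theta>" using K(1) by (rule mult_left_mono)
            then show ?thesis using K(3)[of "x \<omega> + a \<omega> + S \<omega>" "y \<omega>"] yy False by simp
          qed
          then show ?thesis using s1 Gvw nn by simp
        qed
      qed
    qed
    have i0: "integrable M (\<lambda>\<omega>. indicator bad \<omega> :: real)" "integrable M (\<lambda>\<omega>. indicator (Gu - Gv) \<omega> :: real)"
      by (auto intro!: integrable_real_indicator simp: emeasure_eq_measure)
    have "(\<integral>\<omega>. p \<omega> * a \<omega> + (p \<omega> * S \<omega> + r \<omega> * (S \<omega>)\<^sup>2) \<partial>M)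
      \<le> (\<integral>\<omega>. indicator Gv \<omega> * (f (y \<omega>) - f (x \<omega>)) + (K * \<theta> + (2 * K * indicator bad \<omega> + (\<epsilon> * indicator (Gu - Gv) \<omega>
        + (2 * C * S \<omega> ^ 4 + (\<epsilon> * (S \<omega>)\<^sup>2 + C * (a \<omega>)\<^sup>2))))) \<partial>M)"
      by (rule integral_mono_AE[OF _ _ ineq])
        (intro Bochner_Integration.integrable_add integrable_mult_right ipa pS rS ify i0 S4(1) S2i ia2 integrable_const)+
    also have "\<dots> = (\<integral>\<omega>. indicator Gv \<omega> * (f (y \<omega>) - f (x \<omega>)) \<partial>M) + (K * \<theta> + (2 * K * measure M bad + (\<epsilon> * measure M (Gu - Gv)
        + (2 * C * (\<integral>\<omega>. S \<omega> ^ 4 \<partial>M) + (\<epsilon> * (\<integral>\<omega>. (S \<omega>)\<^sup>2 \<partial>M) + C * (\<integral>\<omega>. (a \<omega>)\<^sup>2 \<partial>M))))))"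
      using ify i0 S4(1) S2i ia2
      by (simp add: Bochner_Integration.integral_add prob_space sets.Int_space_eq2 del: integral_indicator)
    also have "\<dots> \<le> (\<integral>\<omega>. indicator Gv \<omega> * (f (y \<omega>) - f (x \<omega>)) \<partial>M) + (K * \<theta> + (2 * K * \<theta> + (\<epsilon> * measure M (Gu - Gv)
        + (2 * C * (3 * c ^ 4 * (v - u)\<^sup>2) + (\<epsilon> * (c\<^sup>2 * (v - u)) + C * (\<integral>\<omega>. (a \<omega>)\<^sup>2 \<partial>M))))))"
      using Pbad S4(2) ES2 K(1) C e by (intro add_left_mono add_mono mult_left_mono order_refl) auto
    finally have fin: "(\<integral>\<omega>. p \<omega> * a \<omega> + (p \<omega> * S \<omega> + r \<omega> * (S \<omega>)\<^sup>2) \<partial>M) \<le> ?R + 3 * K * \<theta>"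
      by (simp add: algebra_simps)
    have "?L = (\<integral>\<omega>. p \<omega> * a \<omega> + r \<omega> * Q \<omega> \<partial>M)"
      by (intro Bochner_Integration.integral_cong) (auto simp: p_def r_def Q_def algebra_simps)
    also have "\<dots> = (\<integral>\<omega>. p \<omega> * a \<omega> \<partial>M) + (\<integral>\<omega>. r \<omega> * Q \<omega> \<partial>M)" using ipa irQ by simp
    also have "\<dots> \<le> (\<integral>\<omega>. p \<omega> * a \<omega> \<partial>M) + ((\<integral>\<omega>. p \<omega> * S \<omega> \<partial>M) + (\<integral>\<omega>. r \<omega> * (S \<omega>)\<^sup>2 \<partial>M)) + K * \<theta>"
      using rQq mart[OF p pK] mart[OF r rK] by simp
    also have "\<dots> = (\<integral>\<omega>. p \<omega> * a \<omega> + (p \<omega> * S \<omega> + r \<omega> * (S \<omega>)\<^sup>2) \<partial>M) + K * \<theta>"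
      using ipa pS rS by simp
    also have "\<dots> \<le> ?R + 4 * K * \<theta>" using fin by simp
    finally show ?thesis .
  qed
  show ?thesis
  proof (rule field_le_epsilon)
    fix d :: real assume d: "0 < d"
    have "4 * K * (d / (4 * (K + 1))) \<le> d" using K(1) d by (simp add: field_simps)
    then show "?L \<le> ?R + d" using main[of "d / (4 * (K + 1))"] K(1) d by simp
  qed
qed

end

section \<open>Riemann sums along a stopped path\<close>

lemma set_integral_Icc_split:
  fixes g :: "real \<Rightarrow> real"
  assumes "set_integrable lborel {s..v} g" "s \<le> u" "u \<le> v"
  shows "(LBINT x:{s..v}. g x) = (LBINT x:{s..u}. g x) + (LBINT x:{u..v}. g x)"
proof -
  have "set_integrable lborel {s..u} g" "set_integrable lborel {u..v} g"
    using assms by (auto intro: set_integrable_subset)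
  then show ?thesis
    using assms by (simp add: set_borel_integral_eq_integral Henstock_Kurzweil_Integration.integral_combine)
qed

lemma set_integral_small_intervals:
  fixes g :: "real \<Rightarrow> real"
  assumes g: "set_integrable lborel {s..t} g" and e: "0 < \<eta>"
  obtains d where "0 < d" "\<And>u v. s \<le> u \<Longrightarrow> u \<le> v \<Longrightarrow> v \<le> t \<Longrightarrow> v - u < d \<Longrightarrow> \<bar>LBINT x:{u..v}. g x\<bar> \<le> \<eta>"
proof -
  have "continuous_on {s..t} (\<lambda>x. integral {s..x} g)"
    using set_borel_integral_eq_integral(1)[OF g] by (rule indefinite_integral_continuous_1)
  then have "uniformly_continuous_on {s..t} (\<lambda>x. integral {s..x} g)"
    by (intro compact_uniformly_continuous) auto
  then obtain d where d: "0 < d" "\<And>x y. x \<in> {s..t} \<Longrightarrow> y \<in> {s..t} \<Longrightarrow> dist y x < d \<Longrightarrow> dist (integral {s..y} g) (integral {s..x} g) < \<eta>"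
    using e unfolding uniformly_continuous_on_def by metis
  show thesis
  proof (rule that[OF d(1)])
    fix u v assume uv: "s \<le> u" "u \<le> v" "v \<le> t" "v - u < d"
    have i: "set_integrable lborel {s..v} g" "set_integrable lborel {s..u} g" using g uv by (auto intro: set_integrable_subset)
    have "(LBINT x:{u..v}. g x) = integral {s..v} g - integral {s..u} g"
      using set_integral_Icc_split[OF i(1) uv(1,2)] i by (simp add: set_borel_integral_eq_integral)
    then show "\<bar>LBINT x:{u..v}. g x\<bar> \<le> \<eta>"
      using d(2)[of u v] uv by (simp add: dist_real_def)
  qed
qed

text \<open>The terms that survive are those before the last index at which \<open>G\<close> holds, so they form a partial sum.\<close>

lemma sum_until_stop_le:
  fixes \<beta> :: "nat \<Rightarrow> real"
  assumes dec: "\<And>i. i < n \<Longrightarrow> G (Suc i) \<Longrightarrow> G i" and m: "0 \<le> m"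
    and le: "\<And>k. k \<le> n \<Longrightarrow> G k \<Longrightarrow> (\<Sum>i<k. \<beta> i) \<le> m"
  shows "(\<Sum>i<n. if G (Suc i) then \<beta> i else 0) \<le> m"
  using dec le
proof (induction n)
  case 0
  then show ?case using m by simp
next
  case (Suc n)
  show ?case
  proof (cases "G (Suc n)")
    case True
    have G: "G (Suc i)" if "i \<le> n" for i
      using that
    proof (induction rule: inc_induct)
      case base
      then show ?case using True by simp
    next
      case (step k)
      then show ?case using Suc.prems(1)[of "Suc k"] by simp
    qed
    then have "(\<Sum>i<Suc n. if G (Suc i) then \<beta> i else 0) = (\<Sum>i<Suc n. \<beta> i)"
      by (intro sum.cong) auto
    then show ?thesis using Suc.prems(2)[of "Suc n"] True by simp
  next
    case False
    then show ?thesis using Suc.IH Suc.prems by simp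
  qed
qed

lemma stopped_telescope:
  fixes F :: "nat \<Rightarrow> real"
  assumes "\<And>i. i < n \<Longrightarrow> G (Suc i) \<Longrightarrow> G i"
  shows "\<exists>k\<le>n. (k = 0 \<or> G k) \<and> (\<Sum>i<n. of_bool (G (Suc i)) * (F (Suc i) - F i)) = F k - F 0"
  using assms
proof (induction n)
  case (Suc n)
  show ?case
  proof (cases "G (Suc n)")
    case True
    have G: "G (Suc i)" if "i \<le> n" for i
      using that
    proof (induction rule: inc_induct)
      case base
      then show ?case using True by simp
    next
      case (step k)
      then show ?case using Suc.prems(1)[of "Suc k"] by simp
    qed
    then have "(\<Sum>i<Suc n. of_bool (G (Suc i)) * (F (Suc i) - F i)) = (\<Sum>i<Suc n. F (Suc i) - F i)"
      by (intro sum.cong) auto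
    then show ?thesis using True by (intro exI[of _ "Suc n"]) (simp add: sum_lessThan_telescope del: sum.lessThan_Suc)
  next
    case False
    obtain k where "k \<le> n" "k = 0 \<or> G k" "(\<Sum>i<n. of_bool (G (Suc i)) * (F (Suc i) - F i)) = F k - F 0"
      using Suc.IH Suc.prems by (metis less_Suc_eq)
    then show ?thesis using False by (intro exI[of _ k]) auto
  qed
qed simp

text \<open>There are \<open>n + 1\<close> pieces, so that no case distinction at \<open>n = 0\<close> is needed.\<close>

definition mesh :: "real \<Rightarrow> real \<Rightarrow> nat \<Rightarrow> real" where
  "mesh s t n = (t - s) / real (Suc n)"

definition grid :: "real \<Rightarrow> real \<Rightarrow> nat \<Rightarrow> nat \<Rightarrow> real" where
  "grid s t n i = s + real i * mesh s t n"

lemma mesh_total: "real (Suc n) * mesh s t n = t - s" by (simp add: mesh_def del: of_nat_Suc)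

lemma mesh_nonneg: "s \<le> t \<Longrightarrow> 0 \<le> mesh s t n" by (simp add: mesh_def)

lemma mesh_pos: "s < t \<Longrightarrow> 0 < mesh s t n" by (simp add: mesh_def)

lemma grid_0: "grid s t n 0 = s" by (simp add: grid_def)

lemma grid_end: "grid s t n (Suc n) = t" unfolding grid_def mesh_total by simp

lemma grid_Suc: "grid s t n (Suc i) - grid s t n i = mesh s t n"
  by (simp add: grid_def algebra_simps)

lemma grid_mono: "s \<le> t \<Longrightarrow> i \<le> j \<Longrightarrow> grid s t n i \<le> grid s t n j"
  by (auto simp: grid_def intro!: mult_right_mono mesh_nonneg)

lemma grid_bounds: "s \<le> t \<Longrightarrow> i \<le> Suc n \<Longrightarrow> s \<le> grid s t n i \<and> grid s t n i \<le> t"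
  using grid_mono[of s t 0 i n] grid_mono[of s t i "Suc n" n] by (simp add: grid_0 grid_end)

text \<open>One path \<open>X\<close> with drift \<open>\<beta> = b(X)\<close> and diffusion coefficient \<open>h = \<sigma>(X)\<close>.  The predicate \<open>G r\<close> says that on
\<open>[s,r]\<close> the path stays in \<open>[-R,R]\<close> and the variation of the drift is at most \<open>m\<close>.\<close>

locale stopped_path =
  fixes s t R m c K :: real and X \<beta> h :: "real \<Rightarrow> real" and G :: "real \<Rightarrow> bool" and f :: "real \<Rightarrow> real"
  assumes st: "s < t" and nonneg: "0 \<le> R" "0 \<le> m" "0 \<le> c" "0 \<le> K"
    and X: "continuous_on {s..t} X"
    and h: "h \<in> borel_measurable borel"
    and G_dec: "\<And>u v. s \<le> u \<Longrightarrow> u \<le> v \<Longrightarrow> v \<le> t \<Longrightarrow> G v \<Longrightarrow> G u"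
    and G_R: "\<And>r. s \<le> r \<Longrightarrow> r \<le> t \<Longrightarrow> G r \<Longrightarrow> \<bar>X r\<bar> \<le> R"
    and G_int: "\<And>r. s \<le> r \<Longrightarrow> r \<le> t \<Longrightarrow> G r \<Longrightarrow> set_integrable lborel {s..r} \<beta>"
    and G_m: "\<And>r. s \<le> r \<Longrightarrow> r \<le> t \<Longrightarrow> G r \<Longrightarrow> (LBINT x:{s..r}. \<bar>\<beta> x\<bar>) \<le> m"
    and h_c: "\<And>r. s \<le> r \<Longrightarrow> r \<le> t \<Longrightarrow> \<bar>X r\<bar> \<le> R \<Longrightarrow> \<bar>h r\<bar> \<le> c"
    and gen: "\<And>r. s \<le> r \<Longrightarrow> r \<le> t \<Longrightarrow> \<beta> r * deriv f (X r) + 1/2 * (h r)\<^sup>2 * deriv (deriv f) (X r) = 1"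
    and f: "C2 f"
    and K: "\<And>x. \<bar>x\<bar> \<le> R \<Longrightarrow> \<bar>deriv f x\<bar> \<le> K" "\<And>x. \<bar>x\<bar> \<le> R \<Longrightarrow> \<bar>deriv (deriv f) x\<bar> \<le> K"

begin

abbreviation "T \<equiv> grid s t"

text \<open>The drift over one piece counts only if the path is not stopped during it, while the quadratic term counts as soon as
the path is not stopped at its left end; this is the form in which the two terms occur in the one-step inequality.\<close>

definition "drift_inc n i = (if G (T n (Suc i)) then (LBINT x:{T n i..T n (Suc i)}. \<beta> x) else 0)"

definition "quad_inc n i = (LBINT x:{T n i..T n (Suc i)}. (clip c (h x))\<^sup>2)"

definition "ito_sum n = (\<Sum>i<Suc n. of_bool (G (T n i)) * (deriv f (X (T n i)) * drift_inc n i + 1/2 * deriv (deriv f) (X (T n i)) * quad_inc n i))"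

lemma T_step:
  assumes "i < Suc n"
  shows "s \<le> T n i" "T n i \<le> T n (Suc i)" "T n (Suc i) \<le> t" "T n i \<le> t" "s \<le> T n (Suc i)"
  using grid_bounds[of s t i n] grid_bounds[of s t "Suc i" n] grid_mono[of s t i "Suc i" n] assms st by auto

lemma quad_inc_bounds:
  assumes "i < Suc n"
  shows "0 \<le> quad_inc n i" "quad_inc n i \<le> c\<^sup>2 * mesh s t n"
proof -
  show "0 \<le> quad_inc n i" unfolding quad_inc_def by (rule clipped_square_integral(2)[OF h nonneg(3)])
  show "quad_inc n i \<le> c\<^sup>2 * mesh s t n"
    unfolding quad_inc_def grid_Suc[symmetric, of s t n i]
    by (rule clipped_square_integral(3)[OF h nonneg(3) T_step(2)[OF assms]])
qed

lemma sum_abs_increments: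
  "(\<Sum>i<Suc n. if G (T n (Suc i)) then (LBINT x:{T n i..T n (Suc i)}. \<bar>\<beta> x\<bar>) else 0) \<le> m"
proof (rule sum_until_stop_le[where G="\<lambda>i. G (T n i)"])
  show "G (T n i)" if "i < Suc n" "G (T n (Suc i))" for i
    using G_dec T_step[OF that(1)] that by blast
  fix k assume k: "k \<le> Suc n" "G (T n k)"
  have b: "s \<le> T n k" "T n k \<le> t" using grid_bounds[of s t k n] k st by auto
  have int: "set_integrable lborel {s..T n k} (\<lambda>x. \<bar>\<beta> x\<bar>)" using G_int[OF b k(2)] by (rule set_integrable_abs)
  have "j \<le> k \<Longrightarrow> (\<Sum>i<j. LBINT x:{T n i..T n (Suc i)}. \<bar>\<beta> x\<bar>) = (LBINT x:{s..T n j}. \<bar>\<beta> x\<bar>)" for j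
  proof (induction j)
    case 0
    have "(LBINT x:{s..s}. \<bar>\<beta> x\<bar>) = 0"
      by (subst set_borel_integral_eq_integral(2)) (auto intro: set_integrable_subset[OF int] simp: b)
    then show ?case by (simp add: grid_0)
  next
    case (Suc j)
    have "set_integrable lborel {s..T n (Suc j)} (\<lambda>x. \<bar>\<beta> x\<bar>)"
      using int Suc.prems grid_mono[of s t "Suc j" k n] st by (auto intro: set_integrable_subset)
    from set_integral_Icc_split[OF this] show ?case using Suc T_step[of j n] k by simp
  qed
  then show "(\<Sum>i<k. LBINT x:{T n i..T n (Suc i)}. \<bar>\<beta> x\<bar>) \<le> m" using G_m[OF b k(2)] by simp
qed (use nonneg in auto)

lemma G_sub_int:
  assumes "i < Suc n" "G (T n (Suc i))"
  shows "set_integrable lborel {T n i..T n (Suc i)} \<beta>"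
  using G_int[of "T n (Suc i)"] T_step[OF assms(1)] assms(2) by (auto intro: set_integrable_subset)

lemma abs_drift_inc_le: "i < Suc n \<Longrightarrow> \<bar>drift_inc n i\<bar> \<le> (if G (T n (Suc i)) then (LBINT x:{T n i..T n (Suc i)}. \<bar>\<beta> x\<bar>) else 0)"
  using set_integral_norm_bound[OF G_sub_int[of i n]] by (simp add: drift_inc_def)

lemma sum_abs_drift_inc_le: "(\<Sum>i<Suc n. \<bar>drift_inc n i\<bar>) \<le> m"
  by (rule order_trans[OF sum_mono sum_abs_increments]) (use abs_drift_inc_le in auto)

lemma abs_drift_inc_le_m: "i < Suc n \<Longrightarrow> \<bar>drift_inc n i\<bar> \<le> m"
  by (rule order_trans[OF member_le_sum sum_abs_drift_inc_le]) auto

lemma sum_drift_inc_sq_le: "(\<Sum>i<Suc n. (drift_inc n i)\<^sup>2) \<le> m\<^sup>2"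
proof -
  have "(\<Sum>i<Suc n. (drift_inc n i)\<^sup>2) \<le> (\<Sum>i<Suc n. m * \<bar>drift_inc n i\<bar>)"
  proof (rule sum_mono)
    fix i assume "i \<in> {..<Suc n}"
    then have "\<bar>drift_inc n i\<bar> * \<bar>drift_inc n i\<bar> \<le> m * \<bar>drift_inc n i\<bar>" using abs_drift_inc_le_m by (intro mult_right_mono) auto
    then show "(drift_inc n i)\<^sup>2 \<le> m * \<bar>drift_inc n i\<bar>" by (simp add: power2_eq_square)
  qed
  also have "\<dots> = m * (\<Sum>i<Suc n. \<bar>drift_inc n i\<bar>)" by (rule sum_distrib_left[symmetric])
  also have "\<dots> \<le> m * m" using sum_abs_drift_inc_le nonneg by (intro mult_left_mono) auto
  finally show ?thesis by (simp add: power2_eq_square)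
qed

lemma eventually_mesh: "0 < d \<Longrightarrow> \<forall>\<^sub>F n in sequentially. mesh s t n < d"
proof -
  assume "0 < d"
  have "(\<lambda>n. (t - s) * (1 / real (Suc n))) \<longlonglongrightarrow> (t - s) * 0"
    by (intro tendsto_mult tendsto_const LIMSEQ_Suc[OF lim_1_over_n])
  then show ?thesis using \<open>0 < d\<close> unfolding mesh_def by (intro order_tendstoD(2)[of _ 0]) auto
qed

lemma sum_drift_inc_sq_tendsto:
  assumes "set_integrable lborel {s..t} \<beta>"
  shows "(\<lambda>n. \<Sum>i<Suc n. (drift_inc n i)\<^sup>2) \<longlonglongrightarrow> 0"
proof (rule LIMSEQ_I)
  fix e :: real assume e: "0 < e"
  define \<eta> where "\<eta> = e / (m + 1) / 2"
  have eta: "0 < \<eta>" "\<eta> * m < e" using e nonneg by (auto simp: \<eta>_def field_simps add_pos_nonneg intro: add_nonneg_pos)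
  obtain d where d: "0 < d" "\<And>u v. s \<le> u \<Longrightarrow> u \<le> v \<Longrightarrow> v \<le> t \<Longrightarrow> v - u < d \<Longrightarrow> \<bar>LBINT x:{u..v}. \<beta> x\<bar> \<le> \<eta>"
    using set_integral_small_intervals[OF assms eta(1)] by metis
  from eventually_mesh[OF d(1)] obtain n0 where n0: "\<And>n. n \<ge> n0 \<Longrightarrow> mesh s t n < d"
    by (auto simp: eventually_sequentially)
  have "norm ((\<Sum>i<Suc n. (drift_inc n i)\<^sup>2) - 0) < e" if n: "n \<ge> n0" for n
  proof -
    have "(\<Sum>i<Suc n. (drift_inc n i)\<^sup>2) \<le> (\<Sum>i<Suc n. \<eta> * \<bar>drift_inc n i\<bar>)"
    proof (rule sum_mono)
      fix i assume i: "i \<in> {..<Suc n}"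
      then have "\<bar>drift_inc n i\<bar> \<le> \<eta>" using d(2)[of "T n i" "T n (Suc i)"] T_step[of i n] n0[OF n] eta
        by (auto simp: drift_inc_def grid_Suc)
      then have "\<bar>drift_inc n i\<bar> * \<bar>drift_inc n i\<bar> \<le> \<eta> * \<bar>drift_inc n i\<bar>" by (intro mult_right_mono) auto
      then show "(drift_inc n i)\<^sup>2 \<le> \<eta> * \<bar>drift_inc n i\<bar>" by (simp add: power2_eq_square)
    qed
    also have "\<dots> = \<eta> * (\<Sum>i<Suc n. \<bar>drift_inc n i\<bar>)" by (rule sum_distrib_left[symmetric])
    also have "\<dots> \<le> \<eta> * m" using sum_abs_drift_inc_le eta by (intro mult_left_mono) auto
    finally have "(\<Sum>i<Suc n. (drift_inc n i)\<^sup>2) < e" using eta(2) by linarith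
    moreover have "0 \<le> (\<Sum>i<Suc n. (drift_inc n i)\<^sup>2)" by (intro sum_nonneg) auto
    ultimately show ?thesis by (simp only: real_norm_def diff_zero abs_of_nonneg)
  qed
  then show "\<exists>n0. \<forall>n\<ge>n0. norm ((\<Sum>i<Suc n. (drift_inc n i)\<^sup>2) - 0) < e" by blast
qed

lemma abs_ito_sum_le: "\<bar>ito_sum n\<bar> \<le> K * m + K * c\<^sup>2 * (t - s)"
proof -
  let ?D = "mesh s t n"
  have "\<bar>ito_sum n\<bar> \<le> (\<Sum>i<Suc n. \<bar>of_bool (G (T n i)) * (deriv f (X (T n i)) * drift_inc n i + 1/2 * deriv (deriv f) (X (T n i)) * quad_inc n i)\<bar>)"
    unfolding ito_sum_def by (rule sum_abs)
  also have "\<dots> \<le> (\<Sum>i<Suc n. K * \<bar>drift_inc n i\<bar> + K * c\<^sup>2 * ?D)"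
  proof (rule sum_mono)
    fix i assume i: "i \<in> {..<Suc n}"
    have pos: "0 \<le> K * \<bar>drift_inc n i\<bar>" "0 \<le> K * (c\<^sup>2 * ?D)" using nonneg st mesh_nonneg[of s t n] by auto
    show "\<bar>of_bool (G (T n i)) * (deriv f (X (T n i)) * drift_inc n i + 1/2 * deriv (deriv f) (X (T n i)) * quad_inc n i)\<bar> \<le> K * \<bar>drift_inc n i\<bar> + K * c\<^sup>2 * ?D"
    proof (cases "G (T n i)")
      case True
      have XR: "\<bar>X (T n i)\<bar> \<le> R" using G_R True T_step[of i n] i by auto
      have 1: "\<bar>deriv f (X (T n i)) * drift_inc n i\<bar> \<le> K * \<bar>drift_inc n i\<bar>"
        unfolding abs_mult using K(1)[OF XR] by (intro mult_right_mono) auto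
      have 2: "\<bar>1/2 * deriv (deriv f) (X (T n i)) * quad_inc n i\<bar> \<le> K * (c\<^sup>2 * ?D)"
        unfolding abs_mult using K(2)[OF XR] quad_inc_bounds[of i n] i nonneg by (intro mult_mono) auto
      have "\<bar>deriv f (X (T n i)) * drift_inc n i + 1/2 * deriv (deriv f) (X (T n i)) * quad_inc n i\<bar> \<le> K * \<bar>drift_inc n i\<bar> + K * (c\<^sup>2 * ?D)"
        using 1 2 by linarith
      then show ?thesis using True by (simp add: mult.assoc)
    qed (use pos in \<open>simp add: mult.assoc\<close>)
  qed
  also have "\<dots> = K * (\<Sum>i<Suc n. \<bar>drift_inc n i\<bar>) + K * c\<^sup>2 * (t - s)"
    by (simp only: sum.distrib sum_distrib_left[symmetric] sum_constant card_lessThan mesh_total)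
  also have "\<dots> \<le> K * m + K * c\<^sup>2 * (t - s)"
    using sum_abs_drift_inc_le nonneg by (intro add_right_mono mult_left_mono) auto
  finally show ?thesis .
qed

text \<open>On a piece at whose end \<open>G\<close> still holds, the identity \<open>\<beta> f'(X) + h\<^sup>2 f''(X)/2 = 1\<close> and the uniform continuity of
\<open>f'(X)\<close> and \<open>f''(X)\<close> along the path show that the summand is almost the length of the piece.  On the single piece
during which \<open>G\<close> is left only the quadratic term is present, of the order of the mesh.\<close>

lemma ito_sum_lower:
  assumes e: "0 < e"
  shows "\<forall>\<^sub>F n in sequentially. of_bool (G t) * (t - s) - e \<le> ito_sum n"
proof -
  define \<eta> where "\<eta> = e / (2 * (m + c\<^sup>2 * (t - s) + 1))"
  have den: "0 < m + c\<^sup>2 * (t - s) + 1" using nonneg st by (intro add_nonneg_pos) auto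
  have eta: "0 < \<eta>" using e den by (simp add: \<eta>_def)
  have "\<eta> * (m + c\<^sup>2 * (t - s)) \<le> \<eta> * (m + c\<^sup>2 * (t - s) + 1)" using eta by (intro mult_left_mono) auto
  also have "\<dots> = e / 2" unfolding \<eta>_def using den by (metis (no_types) divide_divide_eq_left nonzero_eq_divide_eq less_irrefl mult.commute)
  finally have eta2: "\<eta> * (m + c\<^sup>2 * (t - s)) \<le> e / 2" .
  have uc: "uniformly_continuous_on {s..t} (\<lambda>r. g (X r))" if "continuous_on UNIV g" for g :: "real \<Rightarrow> real"
    using that by (intro compact_uniformly_continuous continuous_on_compose2[OF _ X]) auto
  obtain d1 where d1: "0 < d1" "\<And>x y. x \<in> {s..t} \<Longrightarrow> y \<in> {s..t} \<Longrightarrow> dist y x < d1 \<Longrightarrow> dist (deriv f (X y)) (deriv f (X x)) < \<eta>"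
    using uc[OF C2_continuous(2)[OF f]] eta unfolding uniformly_continuous_on_def by metis
  obtain d2 where d2: "0 < d2" "\<And>x y. x \<in> {s..t} \<Longrightarrow> y \<in> {s..t} \<Longrightarrow> dist y x < d2 \<Longrightarrow> dist (deriv (deriv f) (X y)) (deriv (deriv f) (X x)) < \<eta>"
    using uc[OF C2_continuous(3)[OF f]] eta unfolding uniformly_continuous_on_def by metis
  define d3 where "d3 = e / (2 * (K * c\<^sup>2 + 1))"
  have d3: "0 < d3" using e nonneg by (auto simp: d3_def intro!: divide_pos_pos add_nonneg_pos)
  have "\<forall>\<^sub>F n in sequentially. mesh s t n < min d1 (min d2 d3)"
    using d1 d2 d3 by (intro eventually_mesh) auto
  then show ?thesis
  proof eventually_elim
    fix n assume mesh: "mesh s t n < min d1 (min d2 d3)"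
    let ?D = "mesh s t n"
    have D0: "0 < ?D" using st by (rule mesh_pos)
    let ?B = "\<lambda>i. if G (T n (Suc i)) then (LBINT x:{T n i..T n (Suc i)}. \<bar>\<beta> x\<bar>) else 0"
    let ?g = "\<lambda>i. of_bool (G (T n i)) :: real"
    have step: "?g (Suc i) * ?D - \<eta> * ?B i - \<eta> * c\<^sup>2 * ?D - K * c\<^sup>2 * ?D * (?g i - ?g (Suc i))
      \<le> ?g i * (deriv f (X (T n i)) * drift_inc n i + 1/2 * deriv (deriv f) (X (T n i)) * quad_inc n i)"
      if i: "i < Suc n" for i
    proof -
      note Ts = T_step[OF i]
      let ?u = "T n i" and ?v = "T n (Suc i)"
      have vu: "?v - ?u = ?D" by (rule grid_Suc)
      have nn: "0 \<le> \<eta> * c\<^sup>2 * ?D" using eta D0 by (intro mult_nonneg_nonneg) auto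
      show ?thesis
      proof (cases "G ?v")
        case True
        have Gu: "G ?u" using G_dec[OF Ts(1,2,3) True] .
        have bi: "set_integrable lborel {?u..?v} \<beta>" by (rule G_sub_int[OF i True])
        have ci: "set_integrable lborel {?u..?v} (\<lambda>x. (clip c (h x))\<^sup>2)" by (rule clipped_square_integral(1)[OF h nonneg(3)])
        have const: "set_integrable lborel {?u..?v} (\<lambda>s. k)" for k :: real
          by (rule set_integrable_bounded_interval[where K="\<bar>k\<bar>"]) auto
        have LBc: "(LBINT s:{?u..?v}. k) = k * ?D" for k :: real
          using Ts(2) by (simp add: set_lebesgue_integral_def vu[symmetric])
        \<comment> \<open>The integrand with \<open>X\<close> frozen at the left end, raised by the
          error that freezing causes; it is at least 1.\<close>
        let ?r = "\<lambda>x. (deriv f (X ?u) * \<beta> x + \<eta> * \<bar>\<beta> x\<bar>) + (1/2 * deriv (deriv f) (X ?u) * (clip c (h x))\<^sup>2 + \<eta> * c\<^sup>2)"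
        have "(LBINT x:{?u..?v}. 1) \<le> (LBINT x:{?u..?v}. ?r x)"
        proof (rule set_integral_mono[OF const])
          show "set_integrable lborel {?u..?v} ?r"
            using bi ci by (intro set_integral_add set_integrable_mult_right set_integrable_abs const)
          fix x assume x: "x \<in> {?u..?v}"
          have xs: "s \<le> x" "x \<le> t" using x Ts by auto
          have "G x" using G_dec[of x ?v] x Ts True xs by auto
          then have XR: "\<bar>X x\<bar> \<le> R" using G_R xs by blast
          have hc: "\<bar>h x\<bar> \<le> c" by (rule h_c[OF xs XR])
          have dist: "dist x ?u < min d1 (min d2 d3)" using x mesh vu by (auto simp: dist_real_def)
          have A1: "\<bar>deriv f (X x) - deriv f (X ?u)\<bar> \<le> \<eta>" and A2: "\<bar>deriv (deriv f) (X x) - deriv (deriv f) (X ?u)\<bar> \<le> \<eta>"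
            using d1(2)[of ?u x] d2(2)[of ?u x] dist xs Ts by (auto simp: dist_real_def)
          have "\<bar>\<beta> x * (deriv f (X x) - deriv f (X ?u))\<bar> \<le> \<bar>\<beta> x\<bar> * \<eta>"
            unfolding abs_mult using A1 by (intro mult_left_mono) auto
          moreover have hc2: "(h x)\<^sup>2 \<le> c\<^sup>2" using hc nonneg by (simp add: abs_le_square_iff[symmetric])
          have "\<bar>1/2 * (h x)\<^sup>2 * (deriv (deriv f) (X x) - deriv (deriv f) (X ?u))\<bar> \<le> c\<^sup>2 * \<eta>"
            proof -
            have "\<bar>1/2 * (h x)\<^sup>2\<bar> \<le> c\<^sup>2"
              by (rule abs_leI) (use hc2 zero_le_power2[of "h x"] zero_le_power2[of c] in linarith)+
            then show "\<bar>1/2 * (h x)\<^sup>2 * (deriv (deriv f) (X x) - deriv (deriv f) (X ?u))\<bar> \<le> c\<^sup>2 * \<eta>"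
              unfolding abs_mult[of "1/2 * (h x)\<^sup>2"] using A2 by (intro mult_mono) auto
          qed
          moreover have "1 = deriv f (X ?u) * \<beta> x + \<beta> x * (deriv f (X x) - deriv f (X ?u))
             + (1/2 * deriv (deriv f) (X ?u) * (h x)\<^sup>2 + 1/2 * (h x)\<^sup>2 * (deriv (deriv f) (X x) - deriv (deriv f) (X ?u)))"
            using gen[OF xs] by (simp add: algebra_simps)
          ultimately show "1 \<le> ?r x" unfolding clip_id[OF hc] by (simp only: mult.commute)
        qed
        also have "\<dots> = (deriv f (X ?u) * (LBINT x:{?u..?v}. \<beta> x) + \<eta> * (LBINT x:{?u..?v}. \<bar>\<beta> x\<bar>))
           + (1/2 * deriv (deriv f) (X ?u) * quad_inc n i + \<eta> * c\<^sup>2 * ?D)"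
          using bi ci set_integrable_abs[OF bi] const
          by (simp only: set_integral_add set_integrable_mult_right set_integral_mult_right quad_inc_def LBc simp_thms)
        finally show ?thesis using True Gu LBc[of 1] by (simp add: drift_inc_def)
      next
        case False
        show ?thesis
        proof (cases "G ?u")
          case True
          have XR: "\<bar>X ?u\<bar> \<le> R" using G_R True Ts by auto
          have "\<bar>1/2 * deriv (deriv f) (X ?u) * quad_inc n i\<bar> \<le> K * (c\<^sup>2 * ?D)"
            unfolding abs_mult using K(2)[OF XR] quad_inc_bounds[OF i] nonneg by (intro mult_mono) auto
          then show ?thesis using True False nn by (simp add: drift_inc_def mult.assoc)
        qed (use False nn in simp)
      qed
    qed
    have tele: "(\<Sum>i<Suc n. ?g i - ?g (Suc i)) = ?g 0 - ?g (Suc n)" by (rule sum_lessThan_telescope')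
    have gt: "of_bool (G t) * (t - s) \<le> (\<Sum>i<Suc n. ?g (Suc i) * ?D)"
    proof (cases "G t")
      case True
      have "?g (Suc i) = 1" if "i < Suc n" for i using G_dec[of "T n (Suc i)" t] T_step[OF that] True by simp
      then have "(\<Sum>i<Suc n. ?g (Suc i) * ?D) = (\<Sum>i<Suc n. ?D)" by (intro sum.cong) auto
      also have "\<dots> = t - s" by (simp only: sum_constant card_lessThan mesh_total)
      finally show ?thesis using True by simp
    qed (use D0 in \<open>auto intro!: sum_nonneg simp del: sum.lessThan_Suc\<close>)
    have "(\<Sum>i<Suc n. ?g (Suc i) * ?D - \<eta> * ?B i - \<eta> * c\<^sup>2 * ?D - K * c\<^sup>2 * ?D * (?g i - ?g (Suc i))) \<le> ito_sum n"
      unfolding ito_sum_def by (rule sum_mono) (use step in auto)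
    moreover have "(\<Sum>i<Suc n. ?g (Suc i) * ?D - \<eta> * ?B i - \<eta> * c\<^sup>2 * ?D - K * c\<^sup>2 * ?D * (?g i - ?g (Suc i)))
      = (\<Sum>i<Suc n. ?g (Suc i) * ?D) - \<eta> * (\<Sum>i<Suc n. ?B i) - \<eta> * c\<^sup>2 * (t - s) - K * c\<^sup>2 * ?D * (?g 0 - ?g (Suc n))"
      by (simp only: sum_subtractf sum_distrib_left[symmetric] sum_constant card_lessThan mesh_total tele[unfolded sum_subtractf])
    moreover have "\<eta> * (\<Sum>i<Suc n. ?B i) \<le> \<eta> * m" using sum_abs_increments eta by (intro mult_left_mono) auto
    moreover have "K * c\<^sup>2 * ?D * (?g 0 - ?g (Suc n)) \<le> e / 2"
    proof -
      have "K * c\<^sup>2 * ?D * (?g 0 - ?g (Suc n)) \<le> K * c\<^sup>2 * ?D * 1"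
        using nonneg D0 by (intro mult_left_mono) auto
      also have "\<dots> \<le> (K * c\<^sup>2 + 1) * d3" using mesh nonneg D0 by (simp only: mult_1_right) (intro mult_mono, auto)
      also have "\<dots> = e / 2"
      proof -
        have "K * c\<^sup>2 + 1 \<noteq> 0" using nonneg add_nonneg_pos[of "K * c\<^sup>2" 1] by auto
        then show ?thesis by (simp add: d3_def field_simps)
      qed
      finally show ?thesis .
    qed
    ultimately show "of_bool (G t) * (t - s) - e \<le> ito_sum n"
      using gt eta2 by (simp only: distrib_left mult.assoc)
  qed
qed

end

section \<open>The exit inequality\<close>

context filtered_prob_space begin

text \<open>The time is clamped to \<open>[0,r]\<close>, so that the past up to \<open>r\<close> suffices.\<close>

lemma adapted_joint:
  assumes X: "continuous_adapted M \<F> X" and r: "0 \<le> r"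
  shows "(\<lambda>(\<omega>, x). X (max 0 (min x r)) \<omega>) \<in> borel_measurable (\<F> (ennreal r) \<Otimes>\<^sub>M lborel)"
proof (rule borel_measurable_continuous_joint)
  fix x :: real
  have "0 \<le> max 0 (min x r)" by simp
  then have "X (max 0 (min x r)) \<in> borel_measurable (\<F> (ennreal (max 0 (min x r))))"
    using X unfolding continuous_adapted_def by blast
  then show "X (max 0 (min x r)) \<in> borel_measurable (\<F> (ennreal r))"
    by (rule measurable_F_mono) (use r in \<open>auto intro!: ennreal_leI\<close>)
next
  fix \<omega> assume "\<omega> \<in> space (\<F> (ennreal r))"
  then have "continuous_on {0..} (\<lambda>t. X t \<omega>)" using X space_F by (auto simp: continuous_adapted_def)
  then show "continuous_on UNIV (\<lambda>x. X (max 0 (min x r)) \<omega>)"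
    by (rule continuous_on_compose2) (auto intro!: continuous_intros)
qed

end

context brownian_filtration begin

text \<open>Summing the one-step inequality over the partition, the increments of \<open>f(X)\<close> telescope along each path to a
difference of two values of \<open>f\<close> on \<open>[-R,R]\<close>, at most \<open>Bd\<close> on \<open>A\<close> and 0 elsewhere.  The left-hand
side is the expectation of the sums \<open>ito_sum\<close>, which are bounded by a constant and in the limit of fine partitions at least
\<open>t - s\<close> on the paths that are not stopped by time \<open>t\<close> and nonnegative on the others.  Dominated convergence removes the errors that
depend on the mesh.\<close>

lemma exit_inequality_bounded_variation:
  fixes b \<sigma> f :: "real \<Rightarrow> real"
  assumes X: "continuous_adapted M \<F> X" and b: "b \<in> borel_measurable borel"
    and ito: "ito_integral M \<F> B (\<lambda>s \<omega>. \<sigma> (X s \<omega>)) I"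
    and bint: "\<And>r. 0 \<le> r \<Longrightarrow> AE \<omega> in M. set_integrable lborel {0..r} (\<lambda>x. b (X x \<omega>))"
    and sde: "\<And>r. 0 \<le> r \<Longrightarrow> AE \<omega> in M. X r \<omega> = x0 + (LBINT x:{0..r}. b (X x \<omega>)) + I r \<omega>"
    and R: "0 \<le> R" and c: "0 \<le> c" "\<And>x. \<bar>x\<bar> \<le> R \<Longrightarrow> \<bar>\<sigma> x\<bar> \<le> c" and m: "0 \<le> m"
    and f: "C2 f" and gen: "\<And>x. generator b \<sigma> f x = 1"
    and st: "0 \<le> s" "s < t" and A: "A \<in> sets (\<F> (ennreal s))"
    and Bd: "\<And>x y. \<bar>x\<bar> \<le> R \<Longrightarrow> \<bar>y\<bar> \<le> R \<Longrightarrow> f y - f x \<le> Bd"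
  shows "{\<omega>\<in>A. (\<forall>r\<in>{s..t}. \<bar>X r \<omega>\<bar> \<le> R) \<and> (\<integral>\<^sup>+ x\<in>{s..t}. ennreal \<bar>b (X x \<omega>)\<bar> \<partial>lborel) \<le> ennreal m} \<in> sets M"
    and "(t - s) * measure M {\<omega>\<in>A. (\<forall>r\<in>{s..t}. \<bar>X r \<omega>\<bar> \<le> R) \<and> (\<integral>\<^sup>+ x\<in>{s..t}. ennreal \<bar>b (X x \<omega>)\<bar> \<partial>lborel) \<le> ennreal m} \<le> Bd * measure M A"
proof -
  let ?S = "{\<omega>\<in>A. (\<forall>r\<in>{s..t}. \<bar>X r \<omega>\<bar> \<le> R) \<and> (\<integral>\<^sup>+ x\<in>{s..t}. ennreal \<bar>b (X x \<omega>)\<bar> \<partial>lborel) \<le> ennreal m}"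
  have Xc: "continuous_on {0..} (\<lambda>t. X t \<omega>)" if "\<omega> \<in> space M" for \<omega>
    using X that by (auto simp: continuous_adapted_def)
  have Xm: "X r \<in> borel_measurable (\<F> (ennreal r))" if "0 \<le> r" for r
    using X that by (auto simp: continuous_adapted_def)
  have Ica: "continuous_adapted M \<F> I" and prog: "progressive \<F> (\<lambda>s \<omega>. \<sigma> (X s \<omega>))" using ito by (auto simp: ito_integral_def)
  have Asub: "A \<subseteq> space M" using sets.sets_into_space[OF A] space_F by auto
  define var where "var r \<omega> = (\<integral>\<^sup>+ x\<in>{s..r}. ennreal \<bar>b (X x \<omega>)\<bar> \<partial>lborel)" for r \<omega>
  have var_m: "var r \<in> borel_measurable (\<F> (ennreal r))" if r: "s \<le> r" for r
  proof -
    have j: "(\<lambda>(\<omega>, x). X (max 0 (min x r)) \<omega>) \<in> borel_measurable (\<F> (ennreal r) \<Otimes>\<^sub>M lborel)"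
      using adapted_joint[OF X] st r by simp
    have eq: "var r = (\<lambda>\<omega>. \<integral>\<^sup>+ x. ennreal \<bar>b (X (max 0 (min x r)) \<omega>)\<bar> * indicator {s..r} x \<partial>lborel)"
      unfolding var_def using st by (intro ext nn_integral_cong) (auto simp: indicator_def)
    moreover have "(\<lambda>\<omega>. \<integral>\<^sup>+ x. ennreal \<bar>b (X (max 0 (min x r)) \<omega>)\<bar> * indicator {s..r} x \<partial>lborel) \<in> borel_measurable (\<F> (ennreal r))"
      by (rule lborel.borel_measurable_nn_integral) (use j b in measurable)
    ultimately show ?thesis by simp
  qed
  define G where "G r = {\<omega>\<in>A. (\<forall>x\<in>{s..r}. \<bar>X x \<omega>\<bar> \<le> R) \<and> var r \<omega> \<le> ennreal m}" for r
  have GS: "?S = G t" by (simp add: G_def var_def)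
  have G_sets: "G r \<in> sets (\<F> (ennreal r))" if r: "s \<le> r" for r
  proof -
    have AF: "A \<in> sets (\<F> (ennreal r))" using A sets_F_mono[of "ennreal s" "ennreal r"] r by (auto simp: ennreal_leI)
    have [measurable]: "(\<lambda>\<omega>. run_max (\<lambda>x. X (max s (min x r)) \<omega>) (ennreal r)) \<in> borel_measurable (\<F> (ennreal r))"
    proof (rule run_max_measurable)
      fix \<omega> assume "\<omega> \<in> space (\<F> (ennreal r))"
      then have "\<omega> \<in> space M" using space_F by auto
      from Xc[OF this] show "continuous_on {0..} (\<lambda>x. X (max s (min x r)) \<omega>)"
        by (rule continuous_on_compose2) (use st in \<open>auto intro!: continuous_intros\<close>)
    next
      fix x :: real
      have "0 \<le> max s (min x r)" "max s (min x r) \<le> r" using st r by auto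
      then show "X (max s (min x r)) \<in> borel_measurable (\<F> (ennreal r))"
        using measurable_F_mono[OF Xm, of "max s (min x r)" "ennreal r"] by (simp add: ennreal_leI)
    qed
    have "(\<forall>x\<in>{s..r}. \<bar>X x \<omega>\<bar> \<le> R) \<longleftrightarrow> run_max (\<lambda>x. X (max s (min x r)) \<omega>) (ennreal r) \<le> ennreal R" for \<omega>
    proof (subst run_max_le_iff)
      show "(\<forall>x\<in>{s..r}. \<bar>X x \<omega>\<bar> \<le> R) = (\<forall>x\<in>{0..r}. \<bar>X (max s (min x r)) \<omega>\<bar> \<le> R)"
        using st r by (auto simp: max_def min_def)
    qed (use R st r in auto)
    then have "G r = A \<inter> {\<omega>\<in>space (\<F> (ennreal r)). run_max (\<lambda>x. X (max s (min x r)) \<omega>) (ennreal r) \<le> ennreal R \<and> var r \<omega> \<le> ennreal m}"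
      using Asub space_F by (auto simp: G_def)
    also have "\<dots> \<in> sets (\<F> (ennreal r))" using AF var_m[OF r] by measurable
    finally show ?thesis .
  qed
  have G_setsM: "G r \<in> sets M" if "s \<le> r" for r using G_sets[OF that] sets_F_subset by blast
  show S_sets: "?S \<in> sets M" unfolding GS using G_setsM st by simp
  have G_dec: "G v \<subseteq> G u" if "s \<le> u" "u \<le> v" for u v
  proof -
    have "var u \<omega> \<le> var v \<omega>" for \<omega>
      unfolding var_def using that by (intro nn_integral_mono) (auto simp: indicator_def)
    then show ?thesis using that by (auto simp: G_def intro: order_trans)
  qed
  have G_R: "\<bar>X x \<omega>\<bar> \<le> R" if "\<omega> \<in> G r" "s \<le> x" "x \<le> r" for \<omega> r x using that by (auto simp: G_def)
  obtain K where K: "0 \<le> K" "\<And>x. \<bar>x\<bar> \<le> R \<Longrightarrow> \<bar>f (clip R x)\<bar> \<le> K" "\<And>x. \<bar>x\<bar> \<le> R \<Longrightarrow> \<bar>deriv f x\<bar> \<le> K" "\<And>x. \<bar>x\<bar> \<le> R \<Longrightarrow> \<bar>deriv (deriv f) x\<bar> \<le> K"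
    using clipped_C2_bounds[OF f R] by metis
  have fK: "\<bar>f x\<bar> \<le> K" if "\<bar>x\<bar> \<le> R" for x using K(2)[OF that] clip_id[OF that] by simp
  have t0: "0 \<le> t" using st by simp
  have H'm: "(\<lambda>(\<omega>, x). \<sigma> (X (max 0 (min x t)) \<omega>)) \<in> borel_measurable (M \<Otimes>\<^sub>M lborel)"
    by (rule progressive_joint[OF prog t0])
  have idM: "(\<lambda>\<omega>. \<omega>) \<in> M \<rightarrow>\<^sub>M \<F> (ennreal t)"
    using sets_F_subset[of "ennreal t"] space_F[of "ennreal t"] by (auto simp: measurable_def sets.sets_into_space Int_absorb2)
  have XjM: "(\<lambda>(\<omega>, x). X (max 0 (min x t)) \<omega>) \<in> borel_measurable (M \<Otimes>\<^sub>M lborel)"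
  proof -
    have "(\<lambda>p. (fst p, snd p)) \<in> (M \<Otimes>\<^sub>M lborel) \<rightarrow>\<^sub>M (\<F> (ennreal t) \<Otimes>\<^sub>M lborel)"
      by (intro measurable_Pair measurable_compose[OF measurable_fst idM] measurable_snd)
    from measurable_compose[OF this adapted_joint[OF X t0]] show ?thesis by (simp add: case_prod_beta)
  qed
  have bXm: "(\<lambda>x. b (X (max 0 (min x t)) \<omega>)) \<in> borel_measurable borel" if "\<omega> \<in> space M" for \<omega>
    using measurable_compose[OF measurable_Pair2[OF XjM that] b] by simp
  have G_int: "set_integrable lborel {s..r} (\<lambda>x. b (X x \<omega>)) \<and> (LBINT x:{s..r}. \<bar>b (X x \<omega>)\<bar>) \<le> m"
    if w: "\<omega> \<in> G r" and r: "s \<le> r" "r \<le> t" for \<omega> r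
  proof -
    have wM: "\<omega> \<in> space M" using w Asub by (auto simp: G_def)
    have eq: "indicator {s..r} x *\<^sub>R b (X x \<omega>) = indicator {s..r} x *\<^sub>R b (X (max 0 (min x t)) \<omega>)" for x
      using r st by (auto simp: indicator_def)
    have [measurable]: "(\<lambda>x. indicator {s..r} x *\<^sub>R b (X x \<omega>)) \<in> borel_measurable lborel"
      unfolding eq using bXm[OF wM] by measurable
    then have bmx: "(\<lambda>x. indicator {s..r} x * b (X x \<omega>)) \<in> borel_measurable borel" by simp
    have bmx': "(\<lambda>x. \<bar>indicator {s..r} x * b (X x \<omega>)\<bar>) \<in> borel_measurable borel"
      by (rule borel_measurable_abs[OF bmx])
    have nn: "(\<integral>\<^sup>+ x. ennreal (norm (indicator {s..r} x *\<^sub>R b (X x \<omega>))) \<partial>lborel) \<le> ennreal m"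
    proof -
      have "(\<integral>\<^sup>+ x. ennreal (norm (indicator {s..r} x *\<^sub>R b (X x \<omega>))) \<partial>lborel) = var r \<omega>"
        unfolding var_def by (intro nn_integral_cong) (auto simp: indicator_def)
      then show ?thesis using w by (simp add: G_def)
    qed
    have int: "integrable lborel (\<lambda>x. indicator {s..r} x *\<^sub>R b (X x \<omega>))"
      by (rule integrableI_bounded) (use le_less_trans[OF nn] bmx in auto)
    have "(LBINT x:{s..r}. \<bar>b (X x \<omega>)\<bar>) = (\<integral>x. norm (indicator {s..r} x *\<^sub>R b (X x \<omega>)) \<partial>lborel)"
      unfolding set_lebesgue_integral_def by (intro Bochner_Integration.integral_cong) (auto simp: abs_mult)
    also have "\<dots> \<le> m"
      using nn m bmx' by (subst integral_eq_nn_integral) (auto intro!: enn2real_leI)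
    finally show ?thesis using int by (simp add: set_integrable_def)
  qed
  let ?h = "\<lambda>\<omega> r. \<sigma> (X (max 0 (min r t)) \<omega>)"
  have sp: "stopped_path s t R m c K (\<lambda>r. X r \<omega>) (\<lambda>r. b (X r \<omega>)) (?h \<omega>) (\<lambda>r. \<omega> \<in> G r) f" if w: "\<omega> \<in> space M" for \<omega>
  proof
    show "continuous_on {s..t} (\<lambda>r. X r \<omega>)" using Xc[OF w] st by (auto intro: continuous_on_subset)
    show "?h \<omega> \<in> borel_measurable borel" using measurable_Pair2[OF H'm w] by simp
    show "\<omega> \<in> G u" if "s \<le> u" "u \<le> v" "v \<le> t" "\<omega> \<in> G v" for u v using G_dec that by blast
    show "b (X r \<omega>) * deriv f (X r \<omega>) + 1/2 * (?h \<omega> r)\<^sup>2 * deriv (deriv f) (X r \<omega>) = 1" if "s \<le> r" "r \<le> t" for r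
      using gen[of "X r \<omega>"] that st by (simp add: generator_def)
  qed (use st R m c K f G_int G_R in auto)
  let ?T = "grid s t"
  have Ts: "s \<le> ?T n i" "?T n i \<le> ?T n (Suc i)" "?T n (Suc i) \<le> t" "?T n i \<le> t" "0 \<le> ?T n i" "0 \<le> ?T n (Suc i)" "s \<le> ?T n (Suc i)"
    if "i < Suc n" for i n
    using grid_bounds[of s t i n] grid_bounds[of s t "Suc i" n] grid_mono[of s t i "Suc i" n] that st by auto
  define a where "a n i \<omega> = (if \<omega> \<in> G (?T n (Suc i)) then (LBINT x:{?T n i..?T n (Suc i)}. b (X x \<omega>)) else 0)" for n i \<omega>
  define W where "W n i \<omega> = indicator (G (?T n i)) \<omega> * (deriv f (X (?T n i) \<omega>) * a n i \<omega>
      + 1/2 * deriv (deriv f) (X (?T n i) \<omega>) * (LBINT x:{?T n i..?T n (Suc i)}. (clip c (\<sigma> (X x \<omega>)))\<^sup>2))" for n i \<omega>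
  define Z where "Z n \<omega> = (\<Sum>i<Suc n. W n i \<omega>)" for n \<omega>
  have a_eq: "stopped_path.drift_inc s t (\<lambda>r. b (X r \<omega>)) (\<lambda>r. \<omega> \<in> G r) n i = a n i \<omega>" if "\<omega> \<in> space M" for \<omega> n i
    using stopped_path.drift_inc_def[OF sp[OF that]] by (simp add: a_def)
  have q_eq: "stopped_path.quad_inc s t c (?h \<omega>) n i = (LBINT x:{?T n i..?T n (Suc i)}. (clip c (\<sigma> (X x \<omega>)))\<^sup>2)"
    if "\<omega> \<in> space M" "i < Suc n" for \<omega> n i
    unfolding stopped_path.quad_inc_def[OF sp[OF that(1)]]
    using Ts[OF that(2)] by (intro set_lebesgue_integral_cong) auto
  have Z_eq: "stopped_path.ito_sum s t c (\<lambda>r. X r \<omega>) (\<lambda>r. b (X r \<omega>)) (?h \<omega>) (\<lambda>r. \<omega> \<in> G r) f n = Z n \<omega>"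
    if w: "\<omega> \<in> space M" for \<omega> n
    unfolding stopped_path.ito_sum_def[OF sp[OF w]] Z_def W_def
    by (intro sum.cong) (simp_all add: a_eq[OF w] q_eq[OF w] indicator_def of_bool_def)
  have aM: "a n i \<in> borel_measurable M" if i: "i < Suc n" for n i
  proof -
    have eq: "a n i = (\<lambda>\<omega>. indicator (G (?T n (Suc i))) \<omega> * (\<integral>x. indicator {?T n i..?T n (Suc i)} x *\<^sub>R b (X (max 0 (min x t)) \<omega>) \<partial>lborel))"
      unfolding a_def set_lebesgue_integral_def using Ts[OF i]
      by (intro ext) (auto intro!: Bochner_Integration.integral_cong simp: indicator_def)
    moreover have "(\<lambda>\<omega>. \<integral>x. indicator {?T n i..?T n (Suc i)} x *\<^sub>R b (X (max 0 (min x t)) \<omega>) \<partial>lborel) \<in> borel_measurable M"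
      by (rule lborel.borel_measurable_lebesgue_integral) (use XjM b in measurable)
    ultimately show ?thesis
      unfolding eq by (intro borel_measurable_times borel_measurable_indicator G_setsM[OF Ts(7)[OF i]])
  qed
  have QM: "(\<lambda>\<omega>. LBINT x:{?T n i..?T n (Suc i)}. (clip c (\<sigma> (X x \<omega>)))\<^sup>2) \<in> borel_measurable M" if i: "i < Suc n" for n i
    by (rule progressive_clipped_square_integral(1)[OF prog Ts(5)[OF i] Ts(2)[OF i] c(1)])
  have fm: "f \<in> borel_measurable borel" "deriv f \<in> borel_measurable borel" "deriv (deriv f) \<in> borel_measurable borel"
    using C2_continuous[OF f] by (auto intro: borel_measurable_continuous_onI)
  have XM: "X r \<in> borel_measurable M" if "0 \<le> r" for r using measurable_F_M[OF Xm[OF that]] .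
  have WM: "W n i \<in> borel_measurable M" if i: "i < Suc n" for n i
    unfolding W_def[abs_def]
    using aM[OF i] QM[OF i] fm XM[OF Ts(5)[OF i]] G_setsM[OF Ts(1)[OF i]] by measurable
  have ZM: "Z n \<in> borel_measurable M" for n
    unfolding Z_def[abs_def] by (intro borel_measurable_sum WM) auto
  have am: "\<bar>a n i \<omega>\<bar> \<le> m" if "i < Suc n" "\<omega> \<in> space M" for n i \<omega>
    using stopped_path.abs_drift_inc_le_m[OF sp[OF that(2)] that(1)] a_eq[OF that(2)] by simp
  have Zb: "\<bar>Z n \<omega>\<bar> \<le> K * m + K * c\<^sup>2 * (t - s)" if "\<omega> \<in> space M" for n \<omega>
    using stopped_path.abs_ito_sum_le[OF sp[OF that]] Z_eq[OF that] by simp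
  have Wb: "\<bar>W n i \<omega>\<bar> \<le> K * m + K * (c\<^sup>2 * mesh s t n)" if w: "\<omega> \<in> space M" and i: "i < Suc n" for n i \<omega>
  proof (cases "\<omega> \<in> G (?T n i)")
    case True
    have XR: "\<bar>X (?T n i) \<omega>\<bar> \<le> R" using G_R[OF True] Ts[OF i] by auto
    let ?Q = "LBINT x:{?T n i..?T n (Suc i)}. (clip c (\<sigma> (X x \<omega>)))\<^sup>2"
    have 1: "\<bar>deriv f (X (?T n i) \<omega>) * a n i \<omega>\<bar> \<le> K * m"
      unfolding abs_mult using K(1) K(3)[OF XR] am[OF i w] by (intro mult_mono) auto
    have 2: "\<bar>1/2 * deriv (deriv f) (X (?T n i) \<omega>) * ?Q\<bar> \<le> K * (c\<^sup>2 * mesh s t n)"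
      unfolding abs_mult using K(1) K(4)[OF XR] stopped_path.quad_inc_bounds[OF sp[OF w] i] q_eq[OF w i] by (intro mult_mono) auto
    show ?thesis using True 1 2 by (simp add: W_def del: times_divide_eq_left times_divide_eq_right mult_1)
  next
    case False
    have "0 \<le> K * m + K * (c\<^sup>2 * mesh s t n)" using K m mesh_nonneg[of s t n] st by auto
    then show ?thesis using False by (simp add: W_def)
  qed
  have Wi: "integrable M (W n i)" if "i < Suc n" for n i
    by (rule integrable_bounded[OF WM[OF that] Wb[OF _ that]])
  have Ai: "A \<in> sets M" using A sets_F_subset by blast
  have Bd0: "0 \<le> Bd" using Bd[of 0 0] R by simp
  have main: "(t - s) * measure M (G t) \<le> Bd * measure M A + \<epsilon> + \<epsilon> * (c\<^sup>2 * (t - s))" if e: "0 < \<epsilon>" for \<epsilon>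
  proof -
    obtain C where C: "0 \<le> C"
      "\<And>x a S. \<bar>x\<bar> \<le> R \<Longrightarrow> \<bar>a\<bar> \<le> m \<Longrightarrow> deriv f x * a + deriv f x * S + 1/2 * deriv (deriv f) x * S\<^sup>2
      \<le> f (clip (R+1) (x + a + S)) - f x + \<epsilon> * S\<^sup>2 + C * a\<^sup>2 + C * S ^ 4"
      "\<And>x S. \<bar>x\<bar> \<le> R \<Longrightarrow> f (clip (R+1) (x + S)) - f x \<le> \<epsilon> + C * S ^ 4"
      using increment_quartic_bounds[OF f R m e] by metis
    define D where "D n i \<omega> = indicator (G (?T n (Suc i))) \<omega> * (f (X (?T n (Suc i)) \<omega>) - f (X (?T n i) \<omega>))" for n i \<omega>
    have step: "(\<integral>\<omega>. W n i \<omega> \<partial>M) \<le> (\<integral>\<omega>. D n i \<omega> \<partial>M) + \<epsilon> * (measure M (G (?T n i)) - measure M (G (?T n (Suc i))))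
      + \<epsilon> * (c\<^sup>2 * mesh s t n) + C * (\<integral>\<omega>. (a n i \<omega>)\<^sup>2 \<partial>M) + 6 * C * c ^ 4 * (mesh s t n)\<^sup>2"
      if i: "i < Suc n" for n i
    proof -
      let ?u = "?T n i" and ?v = "?T n (Suc i)"
      have sde': "AE \<omega> in M. \<omega> \<in> G ?v \<longrightarrow> X ?v \<omega> = X ?u \<omega> + a n i \<omega> + (I ?v \<omega> - I ?u \<omega>)"
        using sde[OF Ts(5)[OF i]] sde[OF Ts(6)[OF i]] bint[OF Ts(6)[OF i]]
      proof eventually_elim
        fix \<omega> assume e1: "X ?u \<omega> = x0 + (LBINT x:{0..?u}. b (X x \<omega>)) + I ?u \<omega>"
          and e2: "X ?v \<omega> = x0 + (LBINT x:{0..?v}. b (X x \<omega>)) + I ?v \<omega>"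
          and int: "set_integrable lborel {0..?v} (\<lambda>x. b (X x \<omega>))"
        show "\<omega> \<in> G ?v \<longrightarrow> X ?v \<omega> = X ?u \<omega> + a n i \<omega> + (I ?v \<omega> - I ?u \<omega>)"
          using set_integral_Icc_split[OF int Ts(5)[OF i] Ts(2)[OF i]] e1 e2 by (auto simp: a_def)
      qed
      have "(\<integral>\<omega>. indicator (G ?u) \<omega> * (deriv f (X ?u \<omega>) * a n i \<omega> + 1/2 * deriv (deriv f) (X ?u \<omega>) * (LBINT s:{?u..?v}. (clip c (\<sigma> (X s \<omega>)))\<^sup>2)) \<partial>M)
        \<le> (\<integral>\<omega>. indicator (G ?v) \<omega> * (f (X ?v \<omega>) - f (X ?u \<omega>)) \<partial>M) + \<epsilon> * measure M (G ?u - G ?v)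
        + \<epsilon> * (c\<^sup>2 * (?v - ?u)) + C * (\<integral>\<omega>. (a n i \<omega>)\<^sup>2 \<partial>M) + 6 * C * c ^ 4 * (?v - ?u)\<^sup>2"
        by (rule drift_increment_inequality[OF ito Ts(5)[OF i] Ts(2)[OF i] c(1) f R e C(1,2,3) Xm[OF Ts(5)[OF i]] XM[OF Ts(6)[OF i]]
              G_sets[OF Ts(1)[OF i]] G_setsM[OF Ts(7)[OF i]] G_dec[OF Ts(1)[OF i] Ts(2)[OF i]] _ _ _ aM[OF i] am[OF i] _ sde'])
          (use Ts[OF i] G_R c(2) in \<open>auto simp: a_def\<close>)
      then show ?thesis
        unfolding W_def D_def grid_Suc
        using finite_measure_Diff[OF G_setsM[OF Ts(1)[OF i]] G_setsM[OF Ts(7)[OF i]] G_dec[OF Ts(1)[OF i] Ts(2)[OF i]]] by simp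
    qed
    have Di: "integrable M (D n i)" if i: "i < Suc n" for n i
    proof (rule integrable_bounded[where K="2 * K"])
      show "D n i \<in> borel_measurable M" unfolding D_def[abs_def]
        using fm XM[OF Ts(5)[OF i]] XM[OF Ts(6)[OF i]] G_setsM[OF Ts(7)[OF i]] by measurable
      fix \<omega>
      show "\<bar>D n i \<omega>\<bar> \<le> 2 * K"
      proof (cases "\<omega> \<in> G (?T n (Suc i))")
        case True
        then show ?thesis using fK[OF G_R[OF True Ts(1)[OF i] Ts(2)[OF i]]] fK[OF G_R[OF True Ts(7)[OF i] order_refl]]
          by (simp add: D_def)
      qed (use K in \<open>simp add: D_def\<close>)
    qed
    have ai: "integrable M (\<lambda>\<omega>. (a n i \<omega>)\<^sup>2)" if "i < Suc n" for n i
      using aM[OF that] am[OF that] m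
      by (intro integrable_bounded[where K="m\<^sup>2"]) (auto simp: abs_le_square_iff[symmetric])
    have Dsum: "(\<Sum>i<Suc n. D n i \<omega>) \<le> Bd * indicator A \<omega>" for n \<omega>
    proof -
      obtain k where k: "k \<le> Suc n" "k = 0 \<or> \<omega> \<in> G (?T n k)"
        "(\<Sum>i<Suc n. of_bool (\<omega> \<in> G (?T n (Suc i))) * (f (X (?T n (Suc i)) \<omega>) - f (X (?T n i) \<omega>))) = f (X (?T n k) \<omega>) - f (X (?T n 0) \<omega>)"
        using stopped_telescope[of "Suc n" "\<lambda>i. \<omega> \<in> G (?T n i)" "\<lambda>i. f (X (?T n i) \<omega>)"] G_dec[OF Ts(1) Ts(2)] by blast
      have "(\<Sum>i<Suc n. D n i \<omega>) = f (X (?T n k) \<omega>) - f (X (?T n 0) \<omega>)"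
        unfolding k(3)[symmetric] D_def by (intro sum.cong) (auto simp: indicator_def)
      also have "\<dots> \<le> Bd * indicator A \<omega>"
      proof (cases "k = 0")
        case True
        then show ?thesis using Bd0 by simp
      next
        case False
        then have Gk: "\<omega> \<in> G (?T n k)" using k by simp
        have sk: "s \<le> ?T n k" using grid_bounds[of s t k n] k st by auto
        have "\<omega> \<in> A" using Gk by (simp add: G_def)
        moreover have "f (X (?T n k) \<omega>) - f (X (?T n 0) \<omega>) \<le> Bd"
          using G_R[OF Gk] sk by (intro Bd) (auto simp: grid_0)
        ultimately show ?thesis by simp
      qed
      finally show ?thesis .
    qed
    have EZ: "(\<integral>\<omega>. Z n \<omega> \<partial>M) \<le> Bd * measure M A + \<epsilon> + \<epsilon> * (c\<^sup>2 * (t - s))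
        + (C * (\<integral>\<omega>. (\<Sum>i<Suc n. (a n i \<omega>)\<^sup>2) \<partial>M) + 6 * C * c ^ 4 * (t - s) * mesh s t n)" for n
    proof -
      have "(\<integral>\<omega>. Z n \<omega> \<partial>M) = (\<Sum>i<Suc n. \<integral>\<omega>. W n i \<omega> \<partial>M)"
        unfolding Z_def by (rule Bochner_Integration.integral_sum) (use Wi in auto)
      also have "\<dots> \<le> (\<Sum>i<Suc n. (\<integral>\<omega>. D n i \<omega> \<partial>M) + \<epsilon> * (measure M (G (?T n i)) - measure M (G (?T n (Suc i))))
        + \<epsilon> * (c\<^sup>2 * mesh s t n) + C * (\<integral>\<omega>. (a n i \<omega>)\<^sup>2 \<partial>M) + 6 * C * c ^ 4 * (mesh s t n)\<^sup>2)"
        by (rule sum_mono) (use step in auto)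
      also have "\<dots> = (\<Sum>i<Suc n. \<integral>\<omega>. D n i \<omega> \<partial>M) + \<epsilon> * (\<Sum>i<Suc n. measure M (G (?T n i)) - measure M (G (?T n (Suc i))))
        + \<epsilon> * (c\<^sup>2 * (real (Suc n) * mesh s t n)) + C * (\<Sum>i<Suc n. \<integral>\<omega>. (a n i \<omega>)\<^sup>2 \<partial>M) + 6 * C * c ^ 4 * (real (Suc n) * mesh s t n) * mesh s t n"
        unfolding sum.distrib sum_distrib_left[symmetric] by (simp add: power2_eq_square mult_ac del: sum.lessThan_Suc of_nat_Suc)
      also have "(\<Sum>i<Suc n. measure M (G (?T n i)) - measure M (G (?T n (Suc i)))) = measure M (G (?T n 0)) - measure M (G (?T n (Suc n)))"
        by (rule sum_lessThan_telescope')
      also have "(\<Sum>i<Suc n. \<integral>\<omega>. D n i \<omega> \<partial>M) = (\<integral>\<omega>. (\<Sum>i<Suc n. D n i \<omega>) \<partial>M)"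
        by (rule Bochner_Integration.integral_sum[symmetric]) (use Di in auto)
      also have "(\<Sum>i<Suc n. \<integral>\<omega>. (a n i \<omega>)\<^sup>2 \<partial>M) = (\<integral>\<omega>. (\<Sum>i<Suc n. (a n i \<omega>)\<^sup>2) \<partial>M)"
        by (rule Bochner_Integration.integral_sum[symmetric]) (use ai in auto)
      finally have 1: "(\<integral>\<omega>. Z n \<omega> \<partial>M) \<le> (\<integral>\<omega>. (\<Sum>i<Suc n. D n i \<omega>) \<partial>M) + \<epsilon> * (measure M (G (?T n 0)) - measure M (G (?T n (Suc n))))
        + \<epsilon> * (c\<^sup>2 * (t - s)) + C * (\<integral>\<omega>. (\<Sum>i<Suc n. (a n i \<omega>)\<^sup>2) \<partial>M) + 6 * C * c ^ 4 * (t - s) * mesh s t n"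
        by (simp only: mesh_total)
      have "(\<integral>\<omega>. (\<Sum>i<Suc n. D n i \<omega>) \<partial>M) \<le> (\<integral>\<omega>. Bd * indicator A \<omega> \<partial>M)"
        using Dsum Ai by (intro integral_mono Bochner_Integration.integrable_sum Di integrable_mult_right integrable_real_indicator)
          (auto simp: emeasure_eq_measure simp del: sum.lessThan_Suc)
      also have "\<dots> = Bd * measure M A" using Ai by (simp add: sets.Int_space_eq2)
      finally have 2: "(\<integral>\<omega>. (\<Sum>i<Suc n. D n i \<omega>) \<partial>M) \<le> Bd * measure M A" .
      have "measure M (G (?T n 0)) - measure M (G (?T n (Suc n))) \<le> 1"
        using prob_le_1[of "G (?T n 0)"] measure_nonneg[of M "G (?T n (Suc n))"] by linarith
      then have 3: "\<epsilon> * (measure M (G (?T n 0)) - measure M (G (?T n (Suc n)))) \<le> \<epsilon>"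
        using e by (simp add: mult_left_le)
      show ?thesis using 1 2 3 by linarith
    qed
    have a2: "(\<lambda>n. \<integral>\<omega>. (\<Sum>i<Suc n. (a n i \<omega>)\<^sup>2) \<partial>M) \<longlonglongrightarrow> (\<integral>\<omega>. 0 \<partial>M)"
    proof (rule integral_dominated_convergence[where w="\<lambda>_. m\<^sup>2"])
      show "AE \<omega> in M. (\<lambda>n. \<Sum>i<Suc n. (a n i \<omega>)\<^sup>2) \<longlonglongrightarrow> 0"
        using bint[OF t0] AE_space
      proof eventually_elim
        fix \<omega> assume i: "set_integrable lborel {0..t} (\<lambda>x. b (X x \<omega>))" and w: "\<omega> \<in> space M"
        have "set_integrable lborel {s..t} (\<lambda>x. b (X x \<omega>))" using i st by (auto intro: set_integrable_subset)
        from stopped_path.sum_drift_inc_sq_tendsto[OF sp[OF w] this]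
        show "(\<lambda>n. \<Sum>i<Suc n. (a n i \<omega>)\<^sup>2) \<longlonglongrightarrow> 0" by (simp only: a_eq[OF w])
      qed
      show "AE \<omega> in M. norm (\<Sum>i<Suc n. (a n i \<omega>)\<^sup>2) \<le> m\<^sup>2" for n
      proof (rule AE_I2)
        fix \<omega> assume w: "\<omega> \<in> space M"
        have "0 \<le> (\<Sum>i<Suc n. (a n i \<omega>)\<^sup>2)" by (intro sum_nonneg) auto
        then show "norm (\<Sum>i<Suc n. (a n i \<omega>)\<^sup>2) \<le> m\<^sup>2"
          using stopped_path.sum_drift_inc_sq_le[OF sp[OF w]] by (simp only: a_eq[OF w] real_norm_def abs_of_nonneg)
      qed
      show "(\<lambda>\<omega>. \<Sum>i<Suc n. (a n i \<omega>)\<^sup>2) \<in> borel_measurable M" for n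
        by (intro borel_measurable_sum borel_measurable_power aM) auto
    qed auto
    define Y where "Y \<omega> = indicator (G t) \<omega> * (t - s)" for \<omega>
    have Gt: "G t \<in> sets M" using G_setsM st by simp
    have YM: "Y \<in> borel_measurable M" unfolding Y_def[abs_def] using Gt by measurable
    have Yb: "0 \<le> Y \<omega>" "Y \<omega> \<le> t - s" for \<omega> using st by (auto simp: Y_def indicator_def)
    have neg: "(\<lambda>n. \<integral>\<omega>. max 0 (Y \<omega> - Z n \<omega>) \<partial>M) \<longlonglongrightarrow> (\<integral>\<omega>. 0 \<partial>M)"
    proof (rule integral_dominated_convergence[where w="\<lambda>_. (t - s) + (K * m + K * c\<^sup>2 * (t - s))"])
      show "AE \<omega> in M. (\<lambda>n. max 0 (Y \<omega> - Z n \<omega>)) \<longlonglongrightarrow> 0"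
      proof (rule AE_I2)
        fix \<omega> assume w: "\<omega> \<in> space M"
        show "(\<lambda>n. max 0 (Y \<omega> - Z n \<omega>)) \<longlonglongrightarrow> 0"
        proof (rule tendstoI)
          fix e :: real assume e: "0 < e"
          have "\<forall>\<^sub>F n in sequentially. Y \<omega> - e/2 \<le> Z n \<omega>"
            using stopped_path.ito_sum_lower[OF sp[OF w], of "e/2"] e by (simp add: Z_eq[OF w] Y_def indicator_def of_bool_def)
          then show "\<forall>\<^sub>F n in sequentially. dist (max 0 (Y \<omega> - Z n \<omega>)) 0 < e"
            by eventually_elim (use e in \<open>auto simp: dist_real_def\<close>)
        qed
      qed
      show "AE \<omega> in M. norm (max 0 (Y \<omega> - Z n \<omega>)) \<le> (t - s) + (K * m + K * c\<^sup>2 * (t - s))" for n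
      proof (rule AE_I2)
        fix \<omega> assume "\<omega> \<in> space M"
        from Zb[OF this, of n] Yb[of \<omega>] st show "norm (max 0 (Y \<omega> - Z n \<omega>)) \<le> (t - s) + (K * m + K * c\<^sup>2 * (t - s))"
          by (simp add: abs_le_iff)
      qed
    qed (use YM ZM in auto)
    have mesh0: "(\<lambda>n. mesh s t n) \<longlonglongrightarrow> 0"
    proof -
      have "(\<lambda>n. (t - s) * (1 / real (Suc n))) \<longlonglongrightarrow> (t - s) * 0"
        by (intro tendsto_mult tendsto_const LIMSEQ_Suc[OF lim_1_over_n])
      then show ?thesis by (simp add: mesh_def)
    qed
    have YE: "(\<integral>\<omega>. Y \<omega> \<partial>M) = (t - s) * measure M (G t)"
      unfolding Y_def using Gt by (simp add: sets.Int_space_eq2)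
    have Yi: "integrable M Y" using YM Yb by (intro integrable_bounded[where K="t - s"]) auto
    have Zi: "integrable M (Z n)" for n by (rule integrable_bounded[OF ZM Zb])
    \<comment> \<open>Only the last two groups of terms depend on \<open>n\<close>, and they tend to
      0.\<close>
    have bound: "(t - s) * measure M (G t) \<le> (Bd * measure M A + \<epsilon> + \<epsilon> * (c\<^sup>2 * (t - s)))
        + (C * (\<integral>\<omega>. (\<Sum>i<Suc n. (a n i \<omega>)\<^sup>2) \<partial>M) + 6 * C * c ^ 4 * (t - s) * mesh s t n) + (\<integral>\<omega>. max 0 (Y \<omega> - Z n \<omega>) \<partial>M)" for n
    proof -
      have mi: "integrable M (\<lambda>\<omega>. max 0 (Y \<omega> - Z n \<omega>))" using Yi Zi[of n] by auto
      have "(\<integral>\<omega>. Y \<omega> \<partial>M) \<le> (\<integral>\<omega>. Z n \<omega> + max 0 (Y \<omega> - Z n \<omega>) \<partial>M)"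
        by (rule integral_mono) (use Yi Zi[of n] mi in auto)
      also have "\<dots> = (\<integral>\<omega>. Z n \<omega> \<partial>M) + (\<integral>\<omega>. max 0 (Y \<omega> - Z n \<omega>) \<partial>M)"
        by (rule Bochner_Integration.integral_add[OF Zi mi])
      finally show ?thesis using EZ[of n] YE by linarith
    qed
    have "(\<lambda>n. (Bd * measure M A + \<epsilon> + \<epsilon> * (c\<^sup>2 * (t - s)))
        + (C * (\<integral>\<omega>. (\<Sum>i<Suc n. (a n i \<omega>)\<^sup>2) \<partial>M) + 6 * C * c ^ 4 * (t - s) * mesh s t n) + (\<integral>\<omega>. max 0 (Y \<omega> - Z n \<omega>) \<partial>M))
      \<longlonglongrightarrow> (Bd * measure M A + \<epsilon> + \<epsilon> * (c\<^sup>2 * (t - s))) + (C * (\<integral>\<omega>. 0 \<partial>M) + 6 * C * c ^ 4 * (t - s) * 0) + (\<integral>\<omega>. 0 \<partial>M)"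
      by (intro tendsto_intros a2 neg mesh0)
    from LIMSEQ_le_const[OF this] bound show ?thesis by (simp del: sum.lessThan_Suc)
  qed
  have "(t - s) * measure M (G t) \<le> Bd * measure M A"
  proof (rule field_le_epsilon)
    fix d :: real assume d: "0 < d"
    define \<epsilon> where "\<epsilon> = d / (1 + c\<^sup>2 * (t - s))"
    have den: "0 < 1 + c\<^sup>2 * (t - s)" using st by (intro add_pos_nonneg) auto
    have "\<epsilon> * (1 + c\<^sup>2 * (t - s)) = d" using den by (simp add: \<epsilon>_def)
    then have "\<epsilon> + \<epsilon> * (c\<^sup>2 * (t - s)) = d" by (simp only: distrib_left mult_1_right)
    moreover have "0 < \<epsilon>" using d den by (simp add: \<epsilon>_def)
    ultimately show "(t - s) * measure M (G t) \<le> Bd * measure M A + d" using main[of \<epsilon>] by linarith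
  qed
  then show "(t - s) * measure M ?S \<le> Bd * measure M A" unfolding GS .
qed

text \<open>The integral of \<open>|b(X)|\<close> over \<open>[s,t]\<close> is finite almost surely, so the paths on which it is at most \<open>m\<close>
exhaust \<open>D\<close> as \<open>m\<close> grows, while the bound does not depend on \<open>m\<close>.\<close>

lemma exit_inequality:
  fixes b \<sigma> f :: "real \<Rightarrow> real"
  assumes X: "continuous_adapted M \<F> X" and b: "b \<in> borel_measurable borel"
    and ito: "ito_integral M \<F> B (\<lambda>s \<omega>. \<sigma> (X s \<omega>)) I"
    and bint: "\<And>r. 0 \<le> r \<Longrightarrow> AE \<omega> in M. set_integrable lborel {0..r} (\<lambda>x. b (X x \<omega>))"
    and sde: "\<And>r. 0 \<le> r \<Longrightarrow> AE \<omega> in M. X r \<omega> = x0 + (LBINT x:{0..r}. b (X x \<omega>)) + I r \<omega>"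
    and R: "0 \<le> R" and \<sigma>: "bounded (\<sigma> ` {-R..R})"
    and f: "C2 f" and gen: "\<And>x. generator b \<sigma> f x = 1"
    and st: "0 \<le> s" "s < t" and A: "A \<in> sets (\<F> (ennreal s))"
    and Bd: "\<And>x y. \<bar>x\<bar> \<le> R \<Longrightarrow> \<bar>y\<bar> \<le> R \<Longrightarrow> f y - f x \<le> Bd"
    and D: "D \<in> sets M" "D \<subseteq> A" "\<And>\<omega> r. \<omega> \<in> D \<Longrightarrow> s \<le> r \<Longrightarrow> r \<le> t \<Longrightarrow> \<bar>X r \<omega>\<bar> \<le> R"
  shows "(t - s) * measure M D \<le> Bd * measure M A"
proof -
  obtain c0 where c0: "\<And>y. y \<in> \<sigma> ` {-R..R} \<Longrightarrow> norm y \<le> c0" using \<sigma> by (auto simp: bounded_iff)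
  have c: "\<bar>\<sigma> x\<bar> \<le> \<bar>c0\<bar>" if "\<bar>x\<bar> \<le> R" for x using c0[of "\<sigma> x"] that by force
  define S where "S n = {\<omega>\<in>A. (\<forall>r\<in>{s..t}. \<bar>X r \<omega>\<bar> \<le> R) \<and>
      (\<integral>\<^sup>+ x\<in>{s..t}. ennreal \<bar>b (X x \<omega>)\<bar> \<partial>lborel) \<le> ennreal (real n)}" for n :: nat
  note bv = exit_inequality_bounded_variation[OF X b ito bint sde R abs_ge_zero c _ f gen st A Bd]
  have SM: "S n \<in> sets M" for n unfolding S_def by (rule bv) auto
  have Sle: "(t - s) * measure M (S n) \<le> Bd * measure M A" for n
    unfolding S_def by (rule bv) auto
  have inc: "incseq S"
    by (auto simp: incseq_def S_def intro: order_trans[OF _ ennreal_leI])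
  have "(\<lambda>n. measure M (S n)) \<longlonglongrightarrow> measure M (\<Union>n. S n)"
    using SM inc by (intro finite_Lim_measure_incseq) auto
  then have "(\<lambda>n. (t - s) * measure M (S n)) \<longlonglongrightarrow> (t - s) * measure M (\<Union>n. S n)"
    by (intro tendsto_intros)
  then have U: "(t - s) * measure M (\<Union>n. S n) \<le> Bd * measure M A"
    by (rule LIMSEQ_le_const2) (use Sle in auto)
  have "AE \<omega> in M. \<omega> \<in> D \<longrightarrow> \<omega> \<in> (\<Union>n. S n)"
    using bint[of t]
  proof (rule AE_mp, goal_cases)
    case 1
    then show ?case using st by simp
  next
    case 2
    show ?case
    proof (rule AE_I2, intro impI)
      fix \<omega> assume i: "set_integrable lborel {0..t} (\<lambda>x. b (X x \<omega>))" and w: "\<omega> \<in> D"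
      have "set_integrable lborel {s..t} (\<lambda>x. b (X x \<omega>))" using i st by (auto intro: set_integrable_subset)
      then have "(\<integral>\<^sup>+ x. ennreal (norm (indicator {s..t} x *\<^sub>R b (X x \<omega>))) \<partial>lborel) < \<infinity>"
        unfolding set_integrable_def integrable_iff_bounded by blast
      moreover have "(\<integral>\<^sup>+ x. ennreal (norm (indicator {s..t} x *\<^sub>R b (X x \<omega>))) \<partial>lborel) = (\<integral>\<^sup>+ x\<in>{s..t}. ennreal \<bar>b (X x \<omega>)\<bar> \<partial>lborel)"
        by (intro nn_integral_cong) (auto simp: indicator_def)
      ultimately have fin: "(\<integral>\<^sup>+ x\<in>{s..t}. ennreal \<bar>b (X x \<omega>)\<bar> \<partial>lborel) \<noteq> \<top>" by simp
      then obtain v where v: "(\<integral>\<^sup>+ x\<in>{s..t}. ennreal \<bar>b (X x \<omega>)\<bar> \<partial>lborel) = ennreal v" "0 \<le> v"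
        by (cases "(\<integral>\<^sup>+ x\<in>{s..t}. ennreal \<bar>b (X x \<omega>)\<bar> \<partial>lborel)") auto
      obtain n where "v \<le> real n" using real_arch_simple by blast
      then have "\<omega> \<in> S n" using v D w by (auto simp: S_def ennreal_leI)
      then show "\<omega> \<in> (\<Union>n. S n)" by blast
    qed
  qed
  then have "measure M D \<le> measure M (\<Union>n. S n)"
    using SM by (intro finite_measure_mono_AE) auto
  then have "(t - s) * measure M D \<le> (t - s) * measure M (\<Union>n. S n)"
    using st by (intro mult_left_mono) auto
  then show ?thesis using U by linarith
qed

section \<open>The clock dominated by the maximum\<close>

text \<open>The exit inequality is applied on the time interval \<open>[s,t]\<close> during which the clock runs from \<open>l\<close> to \<open>\<beta>l\<close>, with the
event \<open>\<tau> \<ge> s\<close> as \<open>A\<close>.  Half of the \<open>\<delta>\<close> provided by the limit is used, because the bound on the oscillation of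
\<open>f\<close> is needed on a closed interval.\<close>

lemma scale_good_lambda:
  fixes b \<sigma> f g :: "real \<Rightarrow> real"
  assumes X: "continuous_adapted M \<F> X" and b: "b \<in> borel_measurable borel"
    and ito: "ito_integral M \<F> B (\<lambda>s \<omega>. \<sigma> (X s \<omega>)) I"
    and bint: "\<And>r. 0 \<le> r \<Longrightarrow> AE \<omega> in M. set_integrable lborel {0..r} (\<lambda>x. b (X x \<omega>))"
    and sde: "\<And>r. 0 \<le> r \<Longrightarrow> AE \<omega> in M. X r \<omega> = x0 + (LBINT x:{0..r}. b (X x \<omega>)) + I r \<omega>"
    and \<sigma>: "\<And>K. compact K \<Longrightarrow> bounded (\<sigma> ` K)"
    and f: "C2 f" and gen: "\<And>x. generator b \<sigma> f x = 1"
    and scale: "scale_function g" and \<beta>: "1 < \<beta>"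
    and lim: "((\<lambda>\<delta>. SUP (l, x, y)\<in>{(l, x, y). 0 < l \<and> \<bar>x\<bar> < \<delta> * l \<and> \<bar>y\<bar> < \<delta> * l}.
          ereal ((f y - f x) / (the_inv_into {0..} g (\<beta> * l) - the_inv_into {0..} g l))) \<longlongrightarrow> 0) (at_right 0)"
    and e: "0 < \<epsilon>"
  shows "\<exists>\<delta>>0. \<forall>\<tau> l. stopping_time \<F> \<tau> \<longrightarrow> 0 < l \<longrightarrow>
    measure M {\<omega>\<in>space M. ennreal (\<beta> * l) \<le> at_ext g (\<tau> \<omega>) \<and> run_max (\<lambda>s. X s \<omega>) (\<tau> \<omega>) < ennreal (\<delta> * l)}
      \<le> \<epsilon> * measure M {\<omega>\<in>space M. ennreal l \<le> at_ext g (\<tau> \<omega>)}"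
proof -
  interpret g: scale_function g by fact
  have "\<forall>\<^sub>F \<delta> in at_right 0. (SUP (l, x, y)\<in>{(l, x, y). 0 < l \<and> \<bar>x\<bar> < \<delta> * l \<and> \<bar>y\<bar> < \<delta> * l}.
          ereal ((f y - f x) / (g.time_of (\<beta> * l) - g.time_of l))) < ereal \<epsilon>"
    unfolding g.time_of_def by (rule order_tendstoD(2)[OF lim]) (use e in auto)
  then have "\<forall>\<^sub>F \<delta> in at_right 0. (SUP (l, x, y)\<in>{(l, x, y). 0 < l \<and> \<bar>x\<bar> < \<delta> * l \<and> \<bar>y\<bar> < \<delta> * l}.
          ereal ((f y - f x) / (g.time_of (\<beta> * l) - g.time_of l))) < ereal \<epsilon> \<and> 0 < \<delta>"
    using eventually_at_right_less[of "0::real"] by eventually_elim auto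
  from eventually_happens'[OF trivial_limit_at_right_real this]
  obtain d where d: "0 < d" and sup: "(SUP (l, x, y)\<in>{(l, x, y). 0 < l \<and> \<bar>x\<bar> < d * l \<and> \<bar>y\<bar> < d * l}.
          ereal ((f y - f x) / (g.time_of (\<beta> * l) - g.time_of l))) < ereal \<epsilon>" by blast
  show ?thesis
  proof (intro exI[of _ "d / 2"] conjI allI impI)
    show "0 < d / 2" using d by simp
    fix \<tau> and l :: real assume \<tau>: "stopping_time \<F> \<tau>" and l: "0 < l"
    define s where "s = g.time_of l"
    define t where "t = g.time_of (\<beta> * l)"
    define R where "R = d / 2 * l"
    have bl: "0 \<le> \<beta> * l" "l < \<beta> * l" using \<beta> l by auto
    have s0: "0 \<le> s" unfolding s_def using l by (intro g.time_of_nonneg) simp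
    have st: "s < t" unfolding s_def t_def using l bl by (intro g.time_of_less) auto
    have R0: "0 \<le> R" using d l by (simp add: R_def)
    have Bd: "f y - f x \<le> \<epsilon> * (t - s)" if "\<bar>x\<bar> \<le> R" "\<bar>y\<bar> \<le> R" for x y
    proof -
      have "R < d * l" using d l by (simp add: R_def)
      then have "\<bar>x\<bar> < d * l" "\<bar>y\<bar> < d * l" using that by auto
      then have "ereal ((f y - f x) / (t - s)) \<le> (SUP (l, x, y)\<in>{(l, x, y). 0 < l \<and> \<bar>x\<bar> < d * l \<and> \<bar>y\<bar> < d * l}.
          ereal ((f y - f x) / (g.time_of (\<beta> * l) - g.time_of l)))"
        unfolding s_def t_def using l by (intro SUP_upper2[of "(l, x, y)"]) auto
      then have "ereal ((f y - f x) / (t - s)) < ereal \<epsilon>" using sup by (rule le_less_trans)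
      then show ?thesis using st by (simp add: divide_less_eq less_imp_le)
    qed
    define A where "A = {\<omega>\<in>space M. ennreal s \<le> \<tau> \<omega>}"
    define D where "D = {\<omega>\<in>space M. ennreal (\<beta> * l) \<le> at_ext g (\<tau> \<omega>) \<and> run_max (\<lambda>s. X s \<omega>) (\<tau> \<omega>) < ennreal (d / 2 * l)}"
    have \<tau>m[measurable]: "\<tau> \<in> borel_measurable M"
      by (rule measurable_stopping_time[OF \<tau> sets_F_subset space_F])
    have DA: "D = {\<omega>\<in>space M. ennreal t \<le> \<tau> \<omega> \<and> run_max (\<lambda>s. X s \<omega>) (\<tau> \<omega>) < ennreal R}"
      unfolding D_def t_def R_def g.at_ext_ge_iff[OF bl(1)] by (rule refl)
    have A: "A \<in> sets (\<F> (ennreal s))"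
    proof -
      have "{\<omega>\<in>space M. \<tau> \<omega> < ennreal s} \<in> sets (\<F> (ennreal s))"
        using stopping_time_less_const[OF \<tau>, of "ennreal s"] space_F by (simp add: pred_def)
      then have "space (\<F> (ennreal s)) - {\<omega>\<in>space M. \<tau> \<omega> < ennreal s} \<in> sets (\<F> (ennreal s))" by (rule sets.compl_sets)
      moreover have "space (\<F> (ennreal s)) - {\<omega>\<in>space M. \<tau> \<omega> < ennreal s} = A"
        unfolding A_def space_F by (auto simp only: not_less)
      ultimately show ?thesis by simp
    qed
    have "(t - s) * measure M D \<le> (\<epsilon> * (t - s)) * measure M A"
    proof (rule exit_inequality[OF X b ito bint sde R0 _ f gen s0 st A Bd])
      show "bounded (\<sigma> ` {-R..R})" by (rule \<sigma>) simp
      show "D \<in> sets M" unfolding DA using run_max_random_time_measurable[OF X \<tau>m] by measurable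
      show "D \<subseteq> A"
      proof
        fix \<omega> assume "\<omega> \<in> D"
        then have "\<omega> \<in> space M" "ennreal t \<le> \<tau> \<omega>" by (auto simp: DA)
        moreover have "ennreal s \<le> ennreal t" using st by (intro ennreal_leI) simp
        ultimately show "\<omega> \<in> A" unfolding A_def using order_trans by blast
      qed
      fix \<omega> r assume w: "\<omega> \<in> D" and r: "s \<le> r" "r \<le> t"
      have "ennreal r \<le> ennreal t" using r by (intro ennreal_leI)
      then have "ennreal r \<le> \<tau> \<omega>" using w order_trans by (auto simp: DA)
      then have "ennreal \<bar>X r \<omega>\<bar> \<le> run_max (\<lambda>s. X s \<omega>) (\<tau> \<omega>)" using r s0 by (intro run_max_upper) auto
      also have "\<dots> < ennreal R" using w by (simp add: DA)
      finally show "\<bar>X r \<omega>\<bar> \<le> R" by (simp add: ennreal_less_iff)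
    qed
    then have "(t - s) * measure M D \<le> (t - s) * (\<epsilon> * measure M A)" by (simp add: mult_ac)
    then have "measure M D \<le> \<epsilon> * measure M A" using st by (simp only: mult_le_cancel_left_pos diff_gt_0_iff_gt)
    moreover have "A = {\<omega>\<in>space M. ennreal l \<le> at_ext g (\<tau> \<omega>)}"
      unfolding A_def s_def using g.at_ext_ge_iff[of l] l by simp
    ultimately show "measure M {\<omega>\<in>space M. ennreal (\<beta> * l) \<le> at_ext g (\<tau> \<omega>) \<and> run_max (\<lambda>s. X s \<omega>) (\<tau> \<omega>) < ennreal (d / 2 * l)}
      \<le> \<epsilon> * measure M {\<omega>\<in>space M. ennreal l \<le> at_ext g (\<tau> \<omega>)}"
      unfolding D_def by simp
  qed
qed

end

section \<open>The moderate maximal inequality\<close>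

theorem corollary2p5:
  fixes M :: "'a measure" and \<F> :: "ennreal \<Rightarrow> 'a measure"
    and B X :: "real \<Rightarrow> 'a \<Rightarrow> real"
    and b \<sigma> g :: "real \<Rightarrow> real"
    and P :: "real \<Rightarrow> (real \<Rightarrow> real) measure"
  assumes b_measurable: "b \<in> borel_measurable borel"
    and \<sigma>_nonneg: "\<And>x. 0 \<le> \<sigma> x"
    and \<sigma>_locally_bounded: "\<And>K. compact K \<Longrightarrow> bounded (\<sigma> ` K)"
    and X_diffusion: "diffusion b \<sigma> P 0 M \<F> B X"
    and P_kernel: "P \<in> borel \<rightarrow>\<^sub>M prob_algebra path_space"
    and P_law: "\<And>x. \<exists>(N :: 'w measure) \<G> W Y.
      diffusion b \<sigma> P x N \<G> W Y \<and> P x = distr N path_space (path_from Y 0)"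
    and g_maps: "g ` {0..} = {0..}" and g_0: "g 0 = 0"
    and g_strict: "strict_mono_on {0..} g" and g_continuous: "continuous_on {0..} g"
    and i: "controllable P"
    and ii: "\<exists>q>0. \<exists>K>0. \<forall>t\<ge>0.
      (\<integral>\<^sup>+ \<omega>. at_ext (\<lambda>x. x powr q) (run_max (\<lambda>s. X s \<omega>) (ennreal t)) \<partial>M)
        \<le> ennreal (K * g t powr q)"
    and iii: "\<exists>f \<beta>. C2 f \<and> (\<forall>x. generator b \<sigma> f x = 1) \<and> f 0 = 0 \<and> \<beta> > 1 \<and>
      ((\<lambda>\<delta>. SUP (l, x, y)\<in>{(l, x, y). 0 < l \<and> \<bar>x\<bar> < \<delta> * l \<and> \<bar>y\<bar> < \<delta> * l}.
          ereal ((f y - f x) / (the_inv_into {0..} g (\<beta> * l) - the_inv_into {0..} g l)))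
        \<longlongrightarrow> 0) (at_right 0)"
  shows "(\<forall>\<Phi>. moderate \<Phi> \<longrightarrow> (\<exists>c>0. \<exists>C>0. \<forall>\<tau>. stopping_time \<F> \<tau> \<longrightarrow>
      ennreal c * (\<integral>\<^sup>+ \<omega>. at_ext \<Phi> (at_ext g (\<tau> \<omega>)) \<partial>M)
        \<le> (\<integral>\<^sup>+ \<omega>. at_ext \<Phi> (run_max (\<lambda>s. X s \<omega>) (\<tau> \<omega>)) \<partial>M) \<and>
      (\<integral>\<^sup>+ \<omega>. at_ext \<Phi> (run_max (\<lambda>s. X s \<omega>) (\<tau> \<omega>)) \<partial>M)
        \<le> ennreal C * (\<integral>\<^sup>+ \<omega>. at_ext \<Phi> (at_ext g (\<tau> \<omega>)) \<partial>M))) \<and>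
    (\<forall>p>0. \<exists>c>0. \<exists>C>0. \<forall>\<tau>. stopping_time \<F> \<tau> \<longrightarrow>
      ennreal c * (\<integral>\<^sup>+ \<omega>. at_ext (\<lambda>x. x powr p) (at_ext g (\<tau> \<omega>)) \<partial>M)
        \<le> (\<integral>\<^sup>+ \<omega>. at_ext (\<lambda>x. x powr p) (run_max (\<lambda>s. X s \<omega>) (\<tau> \<omega>)) \<partial>M) \<and>
      (\<integral>\<^sup>+ \<omega>. at_ext (\<lambda>x. x powr p) (run_max (\<lambda>s. X s \<omega>) (\<tau> \<omega>)) \<partial>M)
        \<le> ennreal C * (\<integral>\<^sup>+ \<omega>. at_ext (\<lambda>x. x powr p) (at_ext g (\<tau> \<omega>)) \<partial>M))"
proof -
  have ws: "weak_solution b \<sigma> 0 M \<F> B X" and sm: "strong_markov P M \<F> X"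
    using X_diffusion by (auto simp: diffusion_def)
  have uc: "usual_conditions M \<F>" and bm: "brownian_motion M \<F> B" and X: "continuous_adapted M \<F> X"
    and X0: "AE \<omega> in M. X 0 \<omega> = 0"
    and bint: "\<And>t. 0 \<le> t \<Longrightarrow> AE \<omega> in M. set_integrable lborel {0..t} (\<lambda>s. b (X s \<omega>))"
    using ws unfolding weak_solution_def by blast+
  obtain I where ito: "ito_integral M \<F> B (\<lambda>s \<omega>. \<sigma> (X s \<omega>)) I"
    and sde: "\<And>t. 0 \<le> t \<Longrightarrow> AE \<omega> in M. X t \<omega> = 0 + (LBINT s:{0..t}. b (X s \<omega>)) + I t \<omega>"
    using ws unfolding weak_solution_def by blast
  have M: "prob_space M" and fil: "filtration (space M) \<F>" and sub: "\<And>t. sets (\<F> t) \<subseteq> sets M"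
    using uc unfolding usual_conditions_def by blast+
  interpret brownian_filtration M \<F> B
    by (intro brownian_filtration.intro filtered_prob_space.intro filtered_prob_space_axioms.intro
        brownian_filtration_axioms.intro M fil sub bm)
  have scale: "scale_function g" using g_maps g_strict by (rule scale_function.intro)
  have P1: "prob_space (P x)" for x
  proof -
    have "P x \<in> space (prob_algebra path_space)" using P_kernel by (rule measurable_space) simp
    then show ?thesis by (simp add: space_prob_algebra)
  qed
  let ?J = "{\<tau>. stopping_time \<F> \<tau>}"
  let ?U = "\<lambda>\<tau> \<omega>. run_max (\<lambda>s. X s \<omega>) (\<tau> \<omega>)" and ?Z = "\<lambda>\<tau> \<omega>. at_ext g (\<tau> \<omega>)"
  have \<tau>m: "\<tau> \<in> borel_measurable M" if "\<tau> \<in> ?J" for \<tau>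
    using that by (intro measurable_stopping_time[OF _ sets_F_subset space_F]) simp
  have Um: "?U \<tau> \<in> borel_measurable M" if "\<tau> \<in> ?J" for \<tau>
    by (rule run_max_random_time_measurable[OF X \<tau>m[OF that]])
  have Zm: "?Z \<tau> \<in> borel_measurable M" if "\<tau> \<in> ?J" for \<tau>
    by (rule measurable_compose[OF \<tau>m[OF that] at_ext_measurable[OF g_continuous]])
  obtain \<beta>1 where b1: "1 < \<beta>1" "\<And>\<epsilon>. 0 < \<epsilon> \<Longrightarrow> \<exists>\<delta>>0. \<forall>\<tau> l. stopping_time \<F> \<tau> \<longrightarrow> 0 < l \<longrightarrow>
    measure M {\<omega>\<in>space M. ennreal (\<beta>1 * l) \<le> ?U \<tau> \<omega> \<and> ?Z \<tau> \<omega> < ennreal (\<delta> * l)}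
      \<le> \<epsilon> * measure M {\<omega>\<in>space M. ennreal l \<le> ?U \<tau> \<omega>}"
    by (rule controllable_maximum_good_lambda[OF X sm X0 P1 i scale ii]) blast
  obtain f \<beta>2 where f: "C2 f" "\<And>x. generator b \<sigma> f x = 1" and b2: "1 < \<beta>2"
    and lim: "((\<lambda>\<delta>. SUP (l, x, y)\<in>{(l, x, y). 0 < l \<and> \<bar>x\<bar> < \<delta> * l \<and> \<bar>y\<bar> < \<delta> * l}.
          ereal ((f y - f x) / (the_inv_into {0..} g (\<beta>2 * l) - the_inv_into {0..} g l))) \<longlongrightarrow> 0) (at_right 0)"
    using iii by blast
  have low: "\<exists>\<delta>>0. \<forall>\<tau> l. stopping_time \<F> \<tau> \<longrightarrow> 0 < l \<longrightarrow>
    measure M {\<omega>\<in>space M. ennreal (\<beta>2 * l) \<le> ?Z \<tau> \<omega> \<and> ?U \<tau> \<omega> < ennreal (\<delta> * l)}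
      \<le> \<epsilon> * measure M {\<omega>\<in>space M. ennreal l \<le> ?Z \<tau> \<omega>}" if "0 < \<epsilon>" for \<epsilon>
    by (rule scale_good_lambda[OF X b_measurable ito bint sde \<sigma>_locally_bounded f scale b2 lim that])
  have main: "\<exists>c>0. \<exists>C>0. \<forall>\<tau>. stopping_time \<F> \<tau> \<longrightarrow>
      ennreal c * (\<integral>\<^sup>+ \<omega>. at_ext \<Phi> (?Z \<tau> \<omega>) \<partial>M) \<le> (\<integral>\<^sup>+ \<omega>. at_ext \<Phi> (?U \<tau> \<omega>) \<partial>M) \<and>
      (\<integral>\<^sup>+ \<omega>. at_ext \<Phi> (?U \<tau> \<omega>) \<partial>M) \<le> ennreal C * (\<integral>\<^sup>+ \<omega>. at_ext \<Phi> (?Z \<tau> \<omega>) \<partial>M)"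
    if \<Phi>: "moderate \<Phi>" for \<Phi>
  proof -
    obtain C where C: "0 < C" "\<And>\<tau>. \<tau> \<in> ?J \<Longrightarrow> (\<integral>\<^sup>+ \<omega>. at_ext \<Phi> (?U \<tau> \<omega>) \<partial>M) \<le> ennreal C * (\<integral>\<^sup>+ \<omega>. at_ext \<Phi> (?Z \<tau> \<omega>) \<partial>M)"
      using good_lambda_family[where J="?J" and U="?U" and Z="?Z", OF M \<Phi> b1(1) Um Zm] b1(2) by auto
    obtain C' where C': "0 < C'" "\<And>\<tau>. \<tau> \<in> ?J \<Longrightarrow> (\<integral>\<^sup>+ \<omega>. at_ext \<Phi> (?Z \<tau> \<omega>) \<partial>M) \<le> ennreal C' * (\<integral>\<^sup>+ \<omega>. at_ext \<Phi> (?U \<tau> \<omega>) \<partial>M)"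
    proof -
      have "\<exists>C>0. \<forall>\<tau>\<in>?J. (\<integral>\<^sup>+ \<omega>. at_ext \<Phi> (?Z \<tau> \<omega>) \<partial>M) \<le> ennreal C * (\<integral>\<^sup>+ \<omega>. at_ext \<Phi> (?U \<tau> \<omega>) \<partial>M)"
      proof (rule good_lambda_family[OF M \<Phi> b2 Zm Um])
        fix \<epsilon> :: real assume "0 < \<epsilon>"
        from low[OF this] show "\<exists>\<delta>>0. \<forall>\<tau> l. \<tau> \<in> ?J \<longrightarrow> 0 < l \<longrightarrow>
          measure M {\<omega>\<in>space M. ennreal (\<beta>2 * l) \<le> ?Z \<tau> \<omega> \<and> ?U \<tau> \<omega> < ennreal (\<delta> * l)}
            \<le> \<epsilon> * measure M {\<omega>\<in>space M. ennreal l \<le> ?Z \<tau> \<omega>}" by simp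
      qed
      then show thesis using that by blast
    qed
    show ?thesis
    proof (rule exI[of _ "1 / C'"], rule conjI, use C' in simp, rule exI[of _ C], intro conjI allI impI, rule C(1))
      fix \<tau> assume "stopping_time \<F> \<tau>"
      then have \<tau>: "\<tau> \<in> ?J" by simp
      have "ennreal (1 / C') * (\<integral>\<^sup>+ \<omega>. at_ext \<Phi> (?Z \<tau> \<omega>) \<partial>M) \<le> ennreal (1 / C') * (ennreal C' * (\<integral>\<^sup>+ \<omega>. at_ext \<Phi> (?U \<tau> \<omega>) \<partial>M))"
        using C'(2)[OF \<tau>] by (rule mult_left_mono) simp
      also have "\<dots> = (\<integral>\<^sup>+ \<omega>. at_ext \<Phi> (?U \<tau> \<omega>) \<partial>M)"
        using C'(1) by (simp add: mult.assoc[symmetric] ennreal_mult[symmetric])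
      finally show "ennreal (1 / C') * (\<integral>\<^sup>+ \<omega>. at_ext \<Phi> (?Z \<tau> \<omega>) \<partial>M) \<le> (\<integral>\<^sup>+ \<omega>. at_ext \<Phi> (?U \<tau> \<omega>) \<partial>M)" .
      show "(\<integral>\<^sup>+ \<omega>. at_ext \<Phi> (?U \<tau> \<omega>) \<partial>M) \<le> ennreal C * (\<integral>\<^sup>+ \<omega>. at_ext \<Phi> (?Z \<tau> \<omega>) \<partial>M)"
        by (rule C(2)[OF \<tau>])
    qed
  qed
  show ?thesis
    using main main[OF moderate_powr] by blast
qed

end
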